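(* Let $1<p<\infty$, let $\Omega\subset\mathbb R^n$ be a bounded Lipschitz domain, $0<T<\infty$, $\Omega_T:=\Omega\times(0,T)$, and let $E\subset\Omega_T$ be compact. \begin{itemize} \item If $\dim^{\mathcal P}_{\mathcal H,p}(E)<n$, then $E$ does not support any nonzero finite positive Radon measure belonging to $W_M'(\Omega_T)$. \item If $\dim^{\mathcal P}_{\mathcal H,p}(E)>n$, then there exists a nonzero finite positive Radon measure $\lambda_E\in W_M'(\Omega_T)$ with $\operatorname{spt}\lambda_E\subset E$. \end{itemize}
   Context: $W^{-1,p'}(\Omega):=(W^{1,p}_0(\Omega))'$, $p'=p/(p-1)$, and $$W_M(\Omega_T):=\{u\in L^p(0,T;W_0^{1,p}(\Omega))\cap L^\infty(0,T;L^2(\Omega)):\ \partial_tu\in L^{p'}(0,T;W^{-1,p'}(\Omega))\},$$ with norm $\|u\|_{W_M}:=\|\nabla u\|_{L^p(\Omega_T)}+\|\partial_tu\|_{L^{p'}(0,T;W^{-1,p'}(\Omega))}+\|u\|_{L^\infty(0,T;L^2(\Omega))}$. Let $\mathscr D:=C_c^\infty(\Omega\times\mathbb R)|_{\Omega_T}$ (restrictions to $\Omega_T$), which is dense in $W_M(\Omega_T)$. A finite Radon measure $\mu$ on $\Omega_T$ belongs to $W_M'(\Omega_T)$ if it defines a continuous linear functional there, i.e. there is $C$ with $|\int_{\Omega_T}\varphi\,d\mu|\le C\|\varphi\|_{W_M}$ for all $\varphi\in\mathscr D$. $E$ supports a measure $\lambda$ if $\operatorname{spt}\lambda\subset E$.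 For $z=(x,t)$, $Q_{r,r^p}(z):=B_r(x)\times(t-r^p,t+r^p)$. For $E\subset\mathbb R^{n+1}$, $s\ge0$, $\delta>0$, $$\mathcal H^s_{p,\delta}(E):=\inf\Bigl\{\sum_{i=1}^\infty r_i^s:\ E\subset\bigcup_{i=1}^\infty Q_{r_i,r_i^p}(z_i),\ 0<r_i<\delta\Bigr\},\qquad \mathcal H^s_p(E):=\lim_{\delta\to0^+}\mathcal H^s_{p,\delta}(E),$$ and $\dim^{\mathcal P}_{\mathcal H,p}(E):=\inf\{0\le s<\infty:\mathcal H_p^s(E)=0\}$. *)

theory Defs
  imports "HOL-Analysis.Analysis" "HOL-Probability.Essential_Supremum"
begin

section \<open>Bounded Lipschitz domains\<close>

text \<open>
  Near each boundary point the domain is, in suitable orthonormal coordinates with last axis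
  \<open>e\<close>, the region strictly above the graph of a Lipschitz function \<open>\<gamma>\<close> of the coordinates
  orthogonal to \<open>e\<close>. The values of \<open>\<gamma>\<close> off the hyperplane orthogonal to \<open>e\<close> play no role.
\<close>

definition bounded_lipschitz_domain :: "'a::euclidean_space set \<Rightarrow> bool" where
  "bounded_lipschitz_domain \<Omega> \<longleftrightarrow>
     open \<Omega> \<and> connected \<Omega> \<and> \<Omega> \<noteq> {} \<and> bounded \<Omega> \<and>
     (\<forall>x\<in>frontier \<Omega>. \<exists>r>0. \<exists>e \<gamma> L. norm e = 1 \<and> L-lipschitz_on {y. y \<bullet> e = 0} \<gamma> \<and>
        \<Omega> \<inter> ball x r = {y \<in> ball x r. \<gamma> (y - (y \<bullet> e) *\<^sub>R e) < y \<bullet> e})"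

section \<open>Test functions\<close>

primrec C_k :: "nat \<Rightarrow> ('a::euclidean_space \<Rightarrow> real) \<Rightarrow> bool" where
  "C_k 0 f = continuous_on UNIV f"
| "C_k (Suc k) f = ((\<forall>x. f differentiable (at x)) \<and>
                    (\<forall>v. C_k k (\<lambda>x. frechet_derivative f (at x) v)))"

text \<open>
  An element of \<open>C\<^sub>c\<^sup>\<infinity>(U)\<close> is represented by its extension by zero to the whole space.
\<close>

definition Cc_infinity :: "'a::euclidean_space set \<Rightarrow> ('a \<Rightarrow> real) set" where
  "Cc_infinity U = {f. (\<forall>k. C_k k f) \<and> compact (closure {x. f x \<noteq> 0}) \<and>
                       closure {x. f x \<noteq> 0} \<subseteq> U}"

definition gradient :: "('a::euclidean_space \<Rightarrow> real) \<Rightarrow> 'a \<Rightarrow> 'a" where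
  "gradient f x = (\<Sum>i\<in>Basis. frechet_derivative f (at x) i *\<^sub>R i)"

definition space_gradient :: "('a::euclidean_space \<times> real \<Rightarrow> real) \<Rightarrow> 'a \<times> real \<Rightarrow> 'a" where
  "space_gradient \<phi> = (\<lambda>(x, t). gradient (\<lambda>y. \<phi> (y, t)) x)"

definition time_derivative :: "('a \<times> real \<Rightarrow> real) \<Rightarrow> 'a \<times> real \<Rightarrow> real" where
  "time_derivative \<phi> = (\<lambda>(x, t). deriv (\<lambda>s. \<phi> (x, s)) t)"

section \<open>Lebesgue and Sobolev spaces\<close>

definition mem_Lp :: "'b measure \<Rightarrow> real \<Rightarrow> ('b \<Rightarrow> 'c::euclidean_space) \<Rightarrow> bool" where
  "mem_Lp M p f \<longleftrightarrow> f \<in> borel_measurable M \<and> integrable M (\<lambda>x. norm (f x) powr p)"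

definition Lp_norm :: "'b measure \<Rightarrow> real \<Rightarrow> ('b \<Rightarrow> 'c::euclidean_space) \<Rightarrow> real" where
  "Lp_norm M p f = (LINT x|M. norm (f x) powr p) powr (1 / p)"

abbreviation leb :: "'a::euclidean_space set \<Rightarrow> 'a measure" where
  "leb U \<equiv> restrict_space lborel U"

definition weak_gradient :: "'a::euclidean_space set \<Rightarrow> ('a \<Rightarrow> real) \<Rightarrow> ('a \<Rightarrow> 'a) \<Rightarrow> bool" where
  "weak_gradient \<Omega> u g \<longleftrightarrow>
     (\<forall>\<phi>\<in>Cc_infinity \<Omega>. \<forall>i\<in>Basis.
        (LINT x|leb \<Omega>. u x * frechet_derivative \<phi> (at x) i) = - (LINT x|leb \<Omega>. (g x \<bullet> i) * \<phi> x))"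

text \<open>
  A Sobolev function is paired with (a representative of) its weak gradient, which is unique
  up to null sets.
\<close>

definition sobolev_W1 :: "real \<Rightarrow> 'a::euclidean_space set \<Rightarrow> (('a \<Rightarrow> real) \<times> ('a \<Rightarrow> 'a)) set" where
  "sobolev_W1 p \<Omega> = {(u, g). mem_Lp (leb \<Omega>) p u \<and> mem_Lp (leb \<Omega>) p g \<and> weak_gradient \<Omega> u g}"

definition sobolev_W1_0 :: "real \<Rightarrow> 'a::euclidean_space set \<Rightarrow> (('a \<Rightarrow> real) \<times> ('a \<Rightarrow> 'a)) set" where
  "sobolev_W1_0 p \<Omega> = {(u, g) \<in> sobolev_W1 p \<Omega>.
     \<exists>\<phi>. (\<forall>k. \<phi> k \<in> Cc_infinity \<Omega>) \<and>
         (\<lambda>k. Lp_norm (leb \<Omega>) p (\<lambda>x. \<phi> k x - u x)) \<longlonglongrightarrow> 0 \<and>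
         (\<lambda>k. Lp_norm (leb \<Omega>) p (\<lambda>x. gradient (\<phi> k) x - g x)) \<longlonglongrightarrow> 0}"

text \<open>
  The norm in \<open>W\<^sup>-\<^sup>1\<^sup>,\<^sup>p\<^sup>'(\<Omega>) = (W\<^sub>0\<^sup>1\<^sup>,\<^sup>p(\<Omega>))'\<close> of the functional \<open>v \<mapsto> \<integral>\<^sub>\<Omega> f v dx\<close>, where
  \<open>W\<^sub>0\<^sup>1\<^sup>,\<^sup>p(\<Omega>)\<close> carries the norm \<open>\<parallel>\<nabla>v\<parallel>\<^sub>L\<^sub>p\<close>. The supremum is finite for the only \<open>f\<close> at which it
  is used, the bounded Borel functions on a bounded \<open>\<Omega>\<close>, by Poincare's inequality.
\<close>

definition dual_norm :: "real \<Rightarrow> 'a::euclidean_space set \<Rightarrow> ('a \<Rightarrow> real) \<Rightarrow> real" where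
  "dual_norm p \<Omega> f =
     (SUP (v, g) \<in> {(v, g) \<in> sobolev_W1_0 p \<Omega>. Lp_norm (leb \<Omega>) p g \<le> 1}.
        \<bar>LINT x|leb \<Omega>. f x * v x\<bar>)"

section \<open>The parabolic energy space and its dual\<close>

definition test_functions :: "'a::euclidean_space set \<Rightarrow> ('a \<times> real \<Rightarrow> real) set" where
  "test_functions \<Omega> = Cc_infinity (\<Omega> \<times> UNIV)"

text \<open>
  The norm of \<open>W\<^sub>M(\<Omega>\<^sub>T)\<close> at the restriction to \<open>\<Omega>\<^sub>T\<close> of a test function \<open>\<phi>\<close>. Its weak derivatives
  are the classical ones, and \<open>\<partial>\<^sub>t\<phi>(\<cdot>,t)\<close> is the element \<open>v \<mapsto> \<integral>\<^sub>\<Omega> \<partial>\<^sub>t\<phi>(x,t) v(x) dx\<close> of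
  \<open>W\<^sup>-\<^sup>1\<^sup>,\<^sup>p\<^sup>'(\<Omega>)\<close>. All three terms depend on \<open>\<phi>\<close> only through its values on \<open>\<Omega>\<^sub>T\<close>.
\<close>

definition WM_norm :: "real \<Rightarrow> 'a::euclidean_space set \<Rightarrow> real \<Rightarrow> ('a \<times> real \<Rightarrow> real) \<Rightarrow> real" where
  "WM_norm p \<Omega> T \<phi> =
     Lp_norm (leb (\<Omega> \<times> {0<..<T})) p (space_gradient \<phi>) +
     Lp_norm (leb {0<..<T}) (p / (p - 1)) (\<lambda>t. dual_norm p \<Omega> (\<lambda>x. time_derivative \<phi> (x, t))) +
     real_of_ereal (esssup (leb {0<..<T}) (\<lambda>t. ereal (Lp_norm (leb \<Omega>) 2 (\<lambda>x. \<phi> (x, t)))))"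

definition finite_radon_measure_on :: "'b::topological_space set \<Rightarrow> 'b measure \<Rightarrow> bool" where
  "finite_radon_measure_on X \<mu> \<longleftrightarrow>
     sets \<mu> = sets (restrict_space borel X) \<and> finite_measure \<mu> \<and>
     (\<forall>B\<in>sets \<mu>. emeasure \<mu> B = (SUP K\<in>{K. K \<subseteq> B \<and> compact K}. emeasure \<mu> K))"

definition spt :: "'b::topological_space measure \<Rightarrow> 'b set" where
  "spt \<mu> = {z \<in> space \<mu>. \<forall>U. open U \<and> z \<in> U \<longrightarrow> emeasure \<mu> (U \<inter> space \<mu>) > 0}"

definition in_WM_dual :: "real \<Rightarrow> 'a::euclidean_space set \<Rightarrow> real \<Rightarrow> ('a \<times> real) measure \<Rightarrow> bool" where
  "in_WM_dual p \<Omega> T \<mu> \<longleftrightarrow>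
     (\<exists>C. \<forall>\<phi>\<in>test_functions \<Omega>. \<bar>LINT z|\<mu>. \<phi> z\<bar> \<le> C * WM_norm p \<Omega> T \<phi>)"

section \<open>Parabolic Hausdorff measure and dimension\<close>

definition pcyl :: "real \<Rightarrow> 'a::euclidean_space \<times> real \<Rightarrow> real \<Rightarrow> ('a \<times> real) set" where
  "pcyl p = (\<lambda>(x, t) r. ball x r \<times> {t - r powr p<..<t + r powr p})"

definition hausdorff_content ::
  "real \<Rightarrow> real \<Rightarrow> real \<Rightarrow> ('a::euclidean_space \<times> real) set \<Rightarrow> ennreal" where
  "hausdorff_content p s \<delta> E =
     (INF (z, r) \<in> {(z :: nat \<Rightarrow> 'a \<times> real, r :: nat \<Rightarrow> real).
                     E \<subseteq> (\<Union>i. pcyl p (z i) (r i)) \<and> (\<forall>i. 0 < r i \<and> r i < \<delta>)}.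
        \<Sum>i. ennreal (r i powr s))"

definition hausdorff_measure :: "real \<Rightarrow> real \<Rightarrow> ('a::euclidean_space \<times> real) set \<Rightarrow> ennreal" where
  "hausdorff_measure p s E = Lim (at_right 0) (\<lambda>\<delta>. hausdorff_content p s \<delta> E)"

definition hausdorff_dim :: "real \<Rightarrow> ('a::euclidean_space \<times> real) set \<Rightarrow> ereal" where
  "hausdorff_dim p E = (INF s \<in> {s. 0 \<le> s \<and> hausdorff_measure p s E = 0}. ereal s)"

end

theory Submission
  imports Defs "HOL-Probability.Probability"
begin

text \<open>
  Small dimension: cover almost all of \<open>\<mu>\<close> by parabolic cylinders of radius \<open>r\<^sub>i\<close> on which \<open>\<mu>\<close> is heavy
  and doubling, with disjoint enlargements, and superpose rescaled spatial profiles that are divergences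
  of compactly supported fields. Having mean zero, the profiles pair with \<open>W\<^sub>0\<^sup>1\<^sup>,\<^sup>p\<close> functions through
  gradients, so the time derivative is controlled without any loss from summation: all three parts of the
  norm are powers of \<open>\<Sum> r\<^sub>i\<^bsup>n\<^esup>\<close>, which tends to 0, while the integral against \<open>\<mu>\<close> stays bounded below.

  Large dimension: a greedy choice of point masses gives discrete measures with
  \<open>P(Q\<^sub>r) \<le> C r\<^bsup>s\<^esup>\<close>, \<open>s > n\<close>, down to the scale of discretisation. The derivative in \<open>r\<close> of the integral of
  the mollification of \<open>\<phi>\<close> at scale \<open>r\<close> is bounded by \<open>r\<^bsup>\<alpha>-1\<^esup>\<close> times the norm of \<open>\<phi>\<close> with \<open>\<alpha> > 0\<close>, by Hoelder's
  inequality for the gradient and by duality for the time derivative. Integrating in \<open>r\<close> gives a uniform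
  bound, which passes to a weak limit of the discrete measures.
\<close>

section \<open>Smooth functions\<close>

text \<open>The threshold n is where the scaling of the norm balances. A cylinder of radius r has
  volume of order r^(n+p); a unit profile on it has gradient of order 1/r and time derivative of
  order r^(-p). The obstacle is the time derivative: as an element of the dual of W_0^{1,p}, the
  derivative of a nonnegative bump would be tested against v instead of its gradient, and the
  contributions of many small cylinders would not add up cleanly. Written as div G, with G of order
  r^(1-p) and disjoint supports, it costs only the L^{p'} norm of G, whose p'-th power is additive;
  as (1-p)p' = -p, each cylinder costs r^n, just as it does for the gradient and the L^2 term. The
  price is that a divergence takes negative values. They are of order K^(-n) on a cylinder enlarged
  by a multiple of K, whose mass is at most of order K^s times that of the core, so s < n lets a
  large K decide the sign. In the opposite direction the derivative of the averages at scale r has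
  the exponents (s-n)/p - 1 and (s-n)(1-1/p) - 1, both integrable at 0 exactly when s > n.\<close>

definition smooth :: "('a::euclidean_space \<Rightarrow> real) \<Rightarrow> bool" where
  "smooth f \<longleftrightarrow> (\<forall>k. C_k k f)"

lemma has_derivative_frechet:
  "f differentiable (at x) \<Longrightarrow> (f has_derivative frechet_derivative f (at x)) (at x)"
  using frechet_derivative_works by blast

lemma frechet_derivative_eqI:
  "(f has_derivative f') (at x) \<Longrightarrow> frechet_derivative f (at x) = f'"
  using frechet_derivative_at by metis

lemma C_k_continuous: "C_k k f \<Longrightarrow> continuous_on UNIV f"
  by (cases k) (auto intro!: continuous_at_imp_continuous_on differentiable_imp_continuous_within)

lemma C_k_Suc_D: "C_k (Suc k) f \<Longrightarrow> C_k k f"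
proof (induction k arbitrary: f)
  case 0
  then show ?case using C_k_continuous[of 1 f] by simp
next
  case (Suc k)
  have "C_k (Suc k) (\<lambda>x. frechet_derivative f (at x) v)" for v
    using Suc.prems unfolding C_k.simps by blast
  then have "C_k k (\<lambda>x. frechet_derivative f (at x) v)" for v
    by (rule Suc.IH)
  moreover have "\<forall>x. f differentiable (at x)"
    using Suc.prems unfolding C_k.simps by blast
  ultimately show ?case by simp
qed

lemma smooth_differentiable: "smooth f \<Longrightarrow> f differentiable (at x)"
  unfolding smooth_def by (drule spec[of _ "Suc 0"]) simp

lemma smooth_has_derivative:
  "smooth f \<Longrightarrow> (f has_derivative frechet_derivative f (at x)) (at x)"
  by (simp add: smooth_differentiable has_derivative_frechet)

lemma smooth_frechet: "smooth f \<Longrightarrow> smooth (\<lambda>x. frechet_derivative f (at x) v)"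
proof -
  assume f: "smooth f"
  have "C_k k (\<lambda>x. frechet_derivative f (at x) v)" for k
  proof -
    have "C_k (Suc k) f" using f unfolding smooth_def by blast
    then show ?thesis by simp
  qed
  then show ?thesis unfolding smooth_def by blast
qed

lemma smooth_continuous_on: "smooth f \<Longrightarrow> continuous_on S f"
  unfolding smooth_def using C_k_continuous continuous_on_subset by blast

lemma C_k_const: "C_k k (\<lambda>x. c)"
proof (induction k arbitrary: c)
  case (Suc k)
  have "frechet_derivative (\<lambda>x::'a. c) (at x) v = 0" for x v
    by (simp add: frechet_derivative_eqI[OF has_derivative_const])
  then show ?case using Suc by simp
qed simp

lemma C_k_affine:
  assumes L: "bounded_linear L"
  shows "C_k k f \<Longrightarrow> C_k k (\<lambda>x. f (L x + c))"
proof (induction k arbitrary: f)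
  case 0
  have "continuous_on UNIV (\<lambda>x. L x + c)"
    by (intro continuous_intros linear_continuous_on L)
  then show ?case using 0 continuous_on_compose2[of UNIV f UNIV "\<lambda>x. L x + c"] by simp
next
  case (Suc k)
  have d: "((\<lambda>x. f (L x + c)) has_derivative (\<lambda>v. frechet_derivative f (at (L x + c)) (L v))) (at x)" for x
  proof -
    have "((\<lambda>x. L x + c) has_derivative L) (at x)"
      using bounded_linear_imp_has_derivative[OF L, of "at x"]
      by (auto intro!: derivative_eq_intros)
    moreover have "(f has_derivative frechet_derivative f (at (L x + c))) (at (L x + c))"
      using Suc.prems by (simp add: has_derivative_frechet)
    ultimately show ?thesis using diff_chain_at[of "\<lambda>x. L x + c" L x f] by (simp add: o_def)
  qed
  have "C_k k (\<lambda>x. frechet_derivative (\<lambda>x. f (L x + c)) (at x) v)" for v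
    unfolding frechet_derivative_eqI[OF d]
    by (rule Suc.IH) (use Suc.prems in simp)
  moreover have "(\<lambda>x. f (L x + c)) differentiable (at x)" for x
    using d unfolding differentiable_def by blast
  ultimately show ?case by simp
qed

lemma C_k_add: "C_k k f \<Longrightarrow> C_k k g \<Longrightarrow> C_k k (\<lambda>x. f x + g x)"
proof (induction k arbitrary: f g)
  case 0
  then show ?case by (simp add: continuous_on_add)
next
  case (Suc k)
  have d: "((\<lambda>x. f x + g x) has_derivative
     (\<lambda>v. frechet_derivative f (at x) v + frechet_derivative g (at x) v)) (at x)" for x
    using Suc.prems by (intro has_derivative_add has_derivative_frechet) auto
  have "C_k k (\<lambda>x. frechet_derivative (\<lambda>x. f x + g x) (at x) v)" for v
    unfolding frechet_derivative_eqI[OF d]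
    by (rule Suc.IH) (use Suc.prems in auto)
  moreover have "(\<lambda>x. f x + g x) differentiable (at x)" for x
    using d unfolding differentiable_def by blast
  ultimately show ?case by simp
qed

lemma C_k_mult: "C_k k f \<Longrightarrow> C_k k g \<Longrightarrow> C_k k (\<lambda>x. f x * g x)"
proof (induction k arbitrary: f g)
  case 0
  then show ?case by (simp add: continuous_on_mult)
next
  case (Suc k)
  have d: "((\<lambda>x. f x * g x) has_derivative
     (\<lambda>v. f x * frechet_derivative g (at x) v + frechet_derivative f (at x) v * g x)) (at x)" for x
    using Suc.prems by (intro has_derivative_mult has_derivative_frechet) auto
  have "C_k k (\<lambda>x. frechet_derivative (\<lambda>x. f x * g x) (at x) v)" for v
    unfolding frechet_derivative_eqI[OF d]
    by (intro C_k_add Suc.IH) (use Suc.prems Suc.prems[THEN C_k_Suc_D] in auto)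
  moreover have "(\<lambda>x. f x * g x) differentiable (at x)" for x
    using d unfolding differentiable_def by blast
  ultimately show ?case by simp
qed

text \<open>The whole tower \<open>F 0\<close>, \<open>F 1\<close>, ... of derivatives is carried
  along because the chain rule turns \<open>F j\<close> into \<open>F (Suc j)\<close>, so the
  induction must be free to move \<open>j\<close>. The set \<open>S\<close> admits outer functions
  that are differentiable only on a part of the line, such as powers on the positive reals.\<close>

lemma C_k_compose:
  assumes F: "\<And>j x. x \<in> S \<Longrightarrow> (F j has_real_derivative F (Suc j) x) (at x)"
    and S: "\<And>x. g x \<in> S"
  shows "C_k k g \<Longrightarrow> C_k k (\<lambda>x. F j (g x))"
proof (induction k arbitrary: j)
  case 0
  have "isCont (\<lambda>x. F j (g x)) x" for x
  proof (rule isCont_o2[of x g])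
    show "isCont g x" using 0 by (simp add: continuous_on_eq_continuous_at)
    show "isCont (F j) (g x)" by (rule DERIV_isCont[OF F[OF S]])
  qed
  then show ?case by (simp add: continuous_at_imp_continuous_on)
next
  case (Suc k)
  have d: "((\<lambda>x. F j (g x)) has_derivative
     (\<lambda>v. F (Suc j) (g x) * frechet_derivative g (at x) v)) (at x)" for x
  proof -
    have "(F j has_derivative ((*) (F (Suc j) (g x)))) (at (g x))"
      using F[OF S] by (simp add: has_field_derivative_def)
    moreover have "(g has_derivative frechet_derivative g (at x)) (at x)"
      using Suc.prems by (simp add: has_derivative_frechet)
    ultimately show ?thesis using diff_chain_at[of g _ x "F j"] by (simp add: o_def)
  qed
  have "C_k k (\<lambda>x. frechet_derivative (\<lambda>x. F j (g x)) (at x) v)" for v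
    unfolding frechet_derivative_eqI[OF d]
    by (intro C_k_mult Suc.IH) (use Suc.prems Suc.prems[THEN C_k_Suc_D] in auto)
  moreover have "(\<lambda>x. F j (g x)) differentiable (at x)" for x
    using d unfolding differentiable_def by blast
  ultimately show ?case by simp
qed

lemma smooth_const [simp, intro]: "smooth (\<lambda>x. c)"
  by (simp add: smooth_def C_k_const)

lemma smooth_add [intro]: "smooth f \<Longrightarrow> smooth g \<Longrightarrow> smooth (\<lambda>x. f x + g x)"
  by (simp add: smooth_def C_k_add)

lemma smooth_mult [intro]: "smooth f \<Longrightarrow> smooth g \<Longrightarrow> smooth (\<lambda>x. f x * g x)"
  by (simp add: smooth_def C_k_mult)

lemma smooth_sum [intro]: "(\<And>i. i \<in> I \<Longrightarrow> smooth (f i)) \<Longrightarrow> smooth (\<lambda>x. \<Sum>i\<in>I. f i x)"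
  by (induction I rule: infinite_finite_induct) auto

lemma smooth_affine: "bounded_linear L \<Longrightarrow> smooth f \<Longrightarrow> smooth (\<lambda>x. f (L x + c))"
  by (simp add: smooth_def C_k_affine)

lemma smooth_compose:
  assumes "\<And>j x. x \<in> S \<Longrightarrow> (F j has_real_derivative F (Suc j) x) (at x)"
    and "\<And>x. g x \<in> S" and "smooth g"
  shows "smooth (\<lambda>x. F j (g x))"
  using assms C_k_compose[of S F g] unfolding smooth_def by blast

lemma smooth_ident: "smooth (\<lambda>x::real. x)"
proof -
  have d: "((\<lambda>x::real. x) has_derivative (\<lambda>v. v)) (at x)" for x
    by (rule has_derivative_ident)
  have "C_k k (\<lambda>x::real. x)" for k
  proof (cases k)
    case (Suc m)
    show ?thesis unfolding Suc C_k.simps frechet_derivative_eqI[OF d]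
      using d C_k_const by (auto simp: differentiable_def)
  qed (simp add: continuous_on_id)
  then show ?thesis by (simp add: smooth_def)
qed

lemma smooth_bounded_linear: "bounded_linear L \<Longrightarrow> smooth (\<lambda>x. L x + c :: real)"
  by (rule smooth_affine[OF _ smooth_ident])

lemma smooth_inner: "smooth (\<lambda>x. x \<bullet> i)"
  using smooth_bounded_linear[OF bounded_linear_inner_left[of i], of 0] by simp

lemma smooth_inner_self: "smooth (\<lambda>x. x \<bullet> x)"
  by (subst euclidean_inner) (intro smooth_sum smooth_mult smooth_inner)

subsection \<open>A smooth function vanishing exactly on the negative half line\<close>

text \<open>For t > 0 the k-th derivative of exp(-1/t) is P(x) exp(-x) at x = 1/t. As dx/dt = -x^2,
  one more differentiation replaces P by x^2 (P - P'), which is the recursion.\<close>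

primrec expinv_poly :: "nat \<Rightarrow> real poly" where
  "expinv_poly 0 = 1"
| "expinv_poly (Suc k) = [:0, 0, 1:] * (expinv_poly k - pderiv (expinv_poly k))"

definition expinv_deriv :: "nat \<Rightarrow> real \<Rightarrow> real" where
  "expinv_deriv k t = (if t \<le> 0 then 0 else poly (expinv_poly k) (inverse t) * exp (- inverse t))"

definition expinv :: "real \<Rightarrow> real" where
  "expinv t = (if t \<le> 0 then 0 else exp (- inverse t))"

lemma expinv_deriv_0: "expinv = expinv_deriv 0"
  by (auto simp: expinv_def expinv_deriv_def fun_eq_iff)

lemma tendsto_poly_div_exp_0: "((\<lambda>x. poly q x * exp (- x)) \<longlongrightarrow> (0::real)) at_top"
proof -
  have "((\<lambda>x. \<Sum>i\<le>degree q. coeff q i * (x ^ i / exp x)) \<longlongrightarrow> (\<Sum>i\<le>degree q. coeff q i * (0::real))) at_top"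
    by (intro tendsto_sum tendsto_mult tendsto_const tendsto_power_div_exp_0)
  then show ?thesis
    by (simp add: poly_altdef exp_minus sum_distrib_right divide_inverse mult.assoc)
qed

lemma expinv_deriv_DERIV: "(expinv_deriv k has_real_derivative expinv_deriv (Suc k) t) (at t)"
proof -
  consider "t > 0" | "t < 0" | "t = 0" by linarith
  then show ?thesis
  proof cases
    case 1
    let ?f = "\<lambda>t. poly (expinv_poly k) (inverse t) * exp (- inverse t)"
    have i: "(inverse has_real_derivative - (inverse t ^ 2)) (at t)"
      using 1 DERIV_inverse[of t] by (simp add: numeral_2_eq_2)
    have "((\<lambda>t. poly (expinv_poly k) (inverse t)) has_real_derivative
        poly (pderiv (expinv_poly k)) (inverse t) * - (inverse t ^ 2)) (at t)"
      by (rule DERIV_chain2[OF poly_DERIV i])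
    moreover have "((\<lambda>t. exp (- inverse t)) has_real_derivative
        exp (- inverse t) * - (- (inverse t ^ 2))) (at t)"
      by (rule DERIV_chain2[OF DERIV_exp DERIV_minus[OF i]])
    ultimately have "(?f has_real_derivative
        poly (pderiv (expinv_poly k)) (inverse t) * - (inverse t ^ 2) * exp (- inverse t) +
        exp (- inverse t) * - (- (inverse t ^ 2)) * poly (expinv_poly k) (inverse t)) (at t)"
      by (rule DERIV_mult)
    moreover have "poly (pderiv (expinv_poly k)) (inverse t) * - (inverse t ^ 2) * exp (- inverse t) +
        exp (- inverse t) * - (- (inverse t ^ 2)) * poly (expinv_poly k) (inverse t) =
        expinv_deriv (Suc k) t"
      using 1 unfolding expinv_deriv_def by (simp add: algebra_simps power2_eq_square)
    ultimately have d: "(?f has_real_derivative expinv_deriv (Suc k) t) (at t)"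
      by simp
    show ?thesis
      by (rule has_field_derivative_transform_within_open[OF d, of "{0<..}"])
        (use 1 in \<open>auto simp: expinv_deriv_def\<close>)
  next
    case 2
    have d: "((\<lambda>x. 0) has_real_derivative expinv_deriv (Suc k) t) (at t)"
      using 2 by (simp add: expinv_deriv_def)
    show ?thesis
      by (rule has_field_derivative_transform_within_open[OF d, of "{..<0}"])
        (use 2 in \<open>auto simp: expinv_deriv_def\<close>)
  next
    case 3
    \<comment> \<open>The difference quotient at 0 contributes one more factor
      \<open>inverse h\<close>, hence the extra degree; the exponential still wins.\<close>
    let ?q = "[:0, 1:] * expinv_poly k"
    have "((\<lambda>h. poly ?q (inverse h) * exp (- inverse h)) \<longlongrightarrow> 0) (at_right 0)"
      using filterlim_compose[OF tendsto_poly_div_exp_0[of ?q] filterlim_inverse_at_top_right] .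
    then have r: "((\<lambda>h. expinv_deriv k h / h) \<longlongrightarrow> 0) (at_right 0)"
      by (rule Lim_transform_eventually)
        (auto simp: eventually_at_right_field expinv_deriv_def field_simps intro!: exI[of _ 1])
    have l: "((\<lambda>h. expinv_deriv k h / h) \<longlongrightarrow> 0) (at_left 0)"
      by (rule Lim_transform_eventually[OF tendsto_const])
        (auto simp: eventually_at_left_field expinv_deriv_def intro!: exI[of _ "-1"])
    have "((\<lambda>h. expinv_deriv k h / h) \<longlongrightarrow> 0) (at 0)"
      using filterlim_split_at[OF l r] .
    then show ?thesis using 3
      by (simp add: DERIV_def expinv_deriv_def)
  qed
qed

lemma smooth_expinv: "smooth g \<Longrightarrow> smooth (\<lambda>x. expinv (g x))"
  unfolding expinv_deriv_0
  by (rule smooth_compose[of UNIV]) (auto intro: expinv_deriv_DERIV)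

lemma expinv_nonneg: "expinv t \<ge> 0"
  and expinv_le_1: "expinv t \<le> 1"
  and expinv_pos_iff: "expinv t > 0 \<longleftrightarrow> t > 0"
  and expinv_eq_0_iff: "expinv t = 0 \<longleftrightarrow> t \<le> 0"
  by (auto simp: expinv_def)

lemma expinv_mono: "s \<le> t \<Longrightarrow> expinv s \<le> expinv t"
  by (auto simp: expinv_def)

lemma smooth_powr:
  assumes g: "smooth g" and pos: "\<And>x. g x > 0"
  shows "smooth (\<lambda>x. g x powr a)"
proof -
  \<comment> \<open>Falling factorial times a power: \<open>F j\<close> is the j-th derivative of
    \<open>u powr a\<close> on u > 0.\<close>
  define F where "F j u = (\<Prod>i<j. a - real i) * u powr (a - real j)" for j u
  have "(F j has_real_derivative F (Suc j) x) (at x)" if "x \<in> {0<..}" for j x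
    unfolding F_def using that
    by (auto intro!: derivative_eq_intros simp: algebra_simps)
  then have "smooth (\<lambda>x. F 0 (g x))"
    by (rule smooth_compose[of "{0<..}"]) (use g pos in auto)
  then show ?thesis by (simp add: F_def)
qed

section \<open>Integration\<close>

lemma Holder_integral:
  fixes f g :: "'b \<Rightarrow> real"
  assumes p: "1 < p" and pq: "1 / p + 1 / q = 1"
    and [measurable]: "f \<in> borel_measurable M" "g \<in> borel_measurable M"
    and f: "integrable M (\<lambda>x. \<bar>f x\<bar> powr p)" and g: "integrable M (\<lambda>x. \<bar>g x\<bar> powr q)"
  shows "integrable M (\<lambda>x. f x * g x)"
    and "(LINT x|M. \<bar>f x * g x\<bar>) \<le>
      (LINT x|M. \<bar>f x\<bar> powr p) powr (1 / p) * (LINT x|M. \<bar>g x\<bar> powr q) powr (1 / q)"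
proof -
  have q: "1 < q"
  proof -
    have "1 / q = 1 - 1 / p" using pq by simp
    then have "0 < 1 / q" "1 / q < 1" using p by auto
    then show ?thesis by (simp add: divide_less_eq split: if_splits)
  qed
  have Y: "\<bar>f x * g x\<bar> \<le> \<bar>f x\<bar> powr p / p + \<bar>g x\<bar> powr q / q" for x
    using Youngs_inequality[OF p q pq, of "\<bar>f x\<bar>" "\<bar>g x\<bar>"] by (simp add: abs_mult)
  have int: "integrable M (\<lambda>x. \<bar>f x\<bar> powr p / p + \<bar>g x\<bar> powr q / q)"
    using f g by simp
  show fg: "integrable M (\<lambda>x. f x * g x)"
    by (rule Bochner_Integration.integrable_bound[OF int]) (use Y order_trans[OF _ abs_ge_self] in auto)
  define A where "A = (LINT x|M. \<bar>f x\<bar> powr p) powr (1 / p)"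
  define B where "B = (LINT x|M. \<bar>g x\<bar> powr q) powr (1 / q)"
  have Ap: "A powr p = (LINT x|M. \<bar>f x\<bar> powr p)"
    unfolding A_def using p by (simp add: powr_powr integral_nonneg_AE)
  have Bq: "B powr q = (LINT x|M. \<bar>g x\<bar> powr q)"
    unfolding B_def using q by (simp add: powr_powr integral_nonneg_AE)
  \<comment> \<open>The main case divides f and g by their norms; if one of the norms vanishes, that
    function is 0 almost everywhere and so is the product.\<close>
  have zero: "(LINT x|M. \<bar>f x * g x\<bar>) \<le> A * B" if "A = 0 \<or> B = 0"
  proof -
    have "(LINT x|M. \<bar>f x\<bar> powr p) = 0 \<or> (LINT x|M. \<bar>g x\<bar> powr q) = 0"
      using that Ap Bq by auto
    then have "(AE x in M. \<bar>f x\<bar> powr p = 0) \<or> (AE x in M. \<bar>g x\<bar> powr q = 0)"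
      using f g by (subst (asm) (1 2) integral_nonneg_eq_0_iff_AE) auto
    then have "AE x in M. \<bar>f x * g x\<bar> = 0" by (auto elim: eventually_mono)
    then have "(LINT x|M. \<bar>f x * g x\<bar>) = 0" by (rule integral_eq_zero_AE)
    then show ?thesis by (simp add: A_def B_def)
  qed
  have "(LINT x|M. \<bar>f x * g x\<bar>) \<le> A * B"
  proof (cases "A = 0 \<or> B = 0")
    case False
    then have pos: "A > 0" "B > 0" by (auto simp: A_def B_def)
    have Y2: "\<bar>f x * g x\<bar> \<le> A * B * (\<bar>f x\<bar> powr p / (p * A powr p) + \<bar>g x\<bar> powr q / (q * B powr q))" for x
    proof -
      have "(\<bar>f x\<bar> / A) * (\<bar>g x\<bar> / B) \<le> (\<bar>f x\<bar> / A) powr p / p + (\<bar>g x\<bar> / B) powr q / q"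
        using pos by (intro Youngs_inequality[OF p q pq]) auto
      then have "\<bar>f x\<bar> * \<bar>g x\<bar> / (A * B) \<le> \<bar>f x\<bar> powr p / (p * A powr p) + \<bar>g x\<bar> powr q / (q * B powr q)"
        using pos by (simp add: powr_divide mult.commute)
      then show ?thesis using pos by (simp add: abs_mult pos_divide_le_eq mult.commute)
    qed
    have "(LINT x|M. \<bar>f x * g x\<bar>) \<le>
        (LINT x|M. A * B * (\<bar>f x\<bar> powr p / (p * A powr p) + \<bar>g x\<bar> powr q / (q * B powr q)))"
      by (rule integral_mono) (use f g fg Y2 in auto)
    also have "\<dots> = A * B * (A powr p / (p * A powr p) + B powr q / (q * B powr q))"
      using f g by (simp add: Ap Bq)
    also have "\<dots> = A * B * (1 / p + 1 / q)" using pos p q by (simp add: field_simps)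
    finally show ?thesis by (simp add: pq)
  qed (rule zero)
  then show "(LINT x|M. \<bar>f x * g x\<bar>) \<le>
      (LINT x|M. \<bar>f x\<bar> powr p) powr (1 / p) * (LINT x|M. \<bar>g x\<bar> powr q) powr (1 / q)"
    by (simp add: A_def B_def)
qed

lemma Holder_inner:
  fixes f g :: "'b \<Rightarrow> 'c::euclidean_space"
  assumes p: "1 < p" and pq: "1 / p + 1 / q = 1" and f: "mem_Lp M p f" and g: "mem_Lp M q g"
  shows "integrable M (\<lambda>x. f x \<bullet> g x)" and "\<bar>LINT x|M. f x \<bullet> g x\<bar> \<le> Lp_norm M p f * Lp_norm M q g"
proof -
  have [measurable]: "f \<in> borel_measurable M" "g \<in> borel_measurable M"
    using f g by (auto simp: mem_Lp_def)
  have "integrable M (\<lambda>x. norm (f x) * norm (g x))"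
    and le: "(LINT x|M. \<bar>norm (f x) * norm (g x)\<bar>) \<le> Lp_norm M p f * Lp_norm M q g"
    using Holder_integral[OF p pq, of "\<lambda>x. norm (f x)" M "\<lambda>x. norm (g x)"] f g
    unfolding mem_Lp_def Lp_norm_def by simp_all
  then have i: "integrable M (\<lambda>x. norm (f x) * norm (g x))" by simp
  show fg: "integrable M (\<lambda>x. f x \<bullet> g x)"
    by (rule Bochner_Integration.integrable_bound[OF i]) (auto simp: Cauchy_Schwarz_ineq2)
  have "\<bar>LINT x|M. f x \<bullet> g x\<bar> \<le> (LINT x|M. \<bar>f x \<bullet> g x\<bar>)"
    by (rule integral_abs_bound)
  also have "\<dots> \<le> (LINT x|M. \<bar>norm (f x) * norm (g x)\<bar>)"
    by (rule integral_mono) (use fg i Cauchy_Schwarz_ineq2 in auto)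
  finally show "\<bar>LINT x|M. f x \<bullet> g x\<bar> \<le> Lp_norm M p f * Lp_norm M q g" using le by simp
qed

lemma Lp_norm_nonneg: "0 \<le> Lp_norm M p f"
  by (simp add: Lp_norm_def)

lemma mem_Lp_bounded:
  assumes "finite_measure M" "f \<in> borel_measurable M" "\<And>x. x \<in> space M \<Longrightarrow> norm (f x) \<le> B" "0 \<le> p"
  shows "mem_Lp M p f"
proof -
  interpret finite_measure M by fact
  have [measurable]: "f \<in> borel_measurable M" by fact
  have "integrable M (\<lambda>x. norm (f x) powr p)"
    by (rule integrable_const_bound[where B = "B powr p"]) (use assms in \<open>auto intro!: AE_I2 powr_mono2\<close>)
  then show ?thesis by (simp add: mem_Lp_def assms)
qed

lemma finite_measure_leb:
  assumes "bounded (U :: 'a::euclidean_space set)" "U \<in> sets borel"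
  shows "finite_measure (leb U)"
proof (rule finite_measureI)
  show "emeasure (leb U) (space (leb U)) \<noteq> \<infinity>"
    using assms emeasure_bounded_finite[of U]
    by (simp add: space_restrict_space emeasure_restrict_space less_top)
qed

lemma integral_leb_eq:
  fixes f :: "'a::euclidean_space \<Rightarrow> 'b::{banach, second_countable_topology}"
  assumes "U \<in> sets borel" "\<And>x. x \<notin> U \<Longrightarrow> f x = 0"
  shows "integral\<^sup>L (leb U) f = integral\<^sup>L lborel f"
proof -
  have "indicator U x *\<^sub>R f x = f x" for x
    using assms(2)[of x] by (cases "x \<in> U") simp_all
  then have "(\<lambda>x. indicator U x *\<^sub>R f x) = f" by simp
  then show ?thesis using assms(1) by (simp add: integral_restrict_space)
qed

lemma integrable_leb:
  fixes f :: "'a::euclidean_space \<Rightarrow> 'b::{banach, second_countable_topology}"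
  assumes "U \<in> sets borel" "integrable lborel f"
  shows "integrable (leb U) f"
  using assms integrable_mult_indicator[of U lborel f] by (simp add: integrable_restrict_space)

lemma borel_measurable_leb:
  "f \<in> borel_measurable borel \<Longrightarrow> f \<in> borel_measurable (leb U)"
  by (rule measurable_restrict_space1) simp

lemma integrable_compact_support:
  fixes f :: "'a::euclidean_space \<Rightarrow> 'b::{banach, second_countable_topology}"
  assumes "continuous_on UNIV f" "compact K" "\<And>x. x \<notin> K \<Longrightarrow> f x = 0"
  shows "integrable lborel f"
proof -
  have "integrable lborel (\<lambda>x. indicator K x *\<^sub>R f x)"
    by (rule borel_integrable_compact[OF assms(2) continuous_on_subset[OF assms(1)]]) simp
  moreover have "indicator K x *\<^sub>R f x = f x" for x
    using assms(3)[of x] by (cases "x \<in> K") simp_all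
  ultimately show ?thesis by simp
qed

lemma bounded_compact_support:
  fixes f :: "'a::euclidean_space \<Rightarrow> 'b::real_normed_vector"
  assumes "continuous_on UNIV f" "compact K" "\<And>x. x \<notin> K \<Longrightarrow> f x = 0"
  obtains B where "B > 0" "\<And>x. norm (f x) \<le> B"
proof -
  have "compact (f ` K)"
    by (rule compact_continuous_image[OF continuous_on_subset[OF assms(1)] assms(2)]) simp
  then obtain B where B: "B > 0" "\<And>y. y \<in> f ` K \<Longrightarrow> norm y \<le> B"
    using compact_imp_bounded bounded_pos by metis
  have "norm (f x) \<le> B" for x
  proof (cases "x \<in> K")
    case False
    then have "f x = 0" by (rule assms(3))
    then show ?thesis using B(1) by simp
  qed (use B(2) in blast)
  then show ?thesis using B that by blast
qed

text \<open>A common box that carries \<open>f r\<close> and \<open>f' r\<close> for all r in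
  \<open>U\<close> turns the integral over the whole space into one over a compact interval, where
  continuity of the derivative justifies differentiation under the integral sign.\<close>

lemma DERIV_lborel_integral:
  fixes f f' :: "real \<Rightarrow> 'a::euclidean_space \<Rightarrow> real"
  assumes d: "\<And>r x. r \<in> U \<Longrightarrow> ((\<lambda>r. f r x) has_real_derivative f' r x) (at r)"
    and U: "open U" "convex U" "r0 \<in> U"
    and K: "\<And>r x. r \<in> U \<Longrightarrow> x \<notin> cbox a b \<Longrightarrow> f r x = 0" "\<And>r x. r \<in> U \<Longrightarrow> x \<notin> cbox a b \<Longrightarrow> f' r x = 0"
    and c: "\<And>r. r \<in> U \<Longrightarrow> continuous_on UNIV (f r)"
    and c': "continuous_on (U \<times> UNIV) (\<lambda>(r, x). f' r x)"
  shows "((\<lambda>r. LINT x|lborel. f r x) has_real_derivative (LINT x|lborel. f' r0 x)) (at r0)"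
proof -
  have c'r: "continuous_on UNIV (f' r)" if "r \<in> U" for r
    using continuous_on_compose2[OF c' continuous_on_Pair[OF continuous_on_const[of UNIV r] continuous_on_id]] that
    by auto
  have I: "(LINT x|lborel. g x) = integral (cbox a b) g"
    if "continuous_on UNIV g" "\<And>x. x \<notin> cbox a b \<Longrightarrow> g x = 0" for g :: "'a \<Rightarrow> real"
  proof -
    have "integrable lborel g" using that by (intro integrable_compact_support[where K = "cbox a b"]) auto
    then have "(g has_integral (LINT x|lborel. g x)) UNIV" by (rule has_integral_integral_lborel)
    moreover have "(if x \<in> cbox a b then g x else 0) = g x" for x
      using that(2)[of x] by (cases "x \<in> cbox a b") simp_all
    ultimately have "(g has_integral (LINT x|lborel. g x)) (cbox a b)"
      using has_integral_restrict_UNIV[of "cbox a b" g] by simp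
    then show ?thesis by (simp add: integral_unique)
  qed
  have "((\<lambda>r. integral (cbox a b) (f r)) has_field_derivative integral (cbox a b) (f' r0)) (at r0 within U)"
  proof (rule leibniz_rule_field_derivative)
    show "((\<lambda>r. f r x) has_real_derivative f' r x) (at r within U)" if "r \<in> U" for r x
      using d[OF that] by (rule has_field_derivative_at_within)
    show "f r integrable_on cbox a b" if "r \<in> U" for r
      by (rule integrable_continuous[OF continuous_on_subset[OF c[OF that] subset_UNIV]])
    show "continuous_on (U \<times> cbox a b) (\<lambda>(r, x). f' r x)"
      using c' by (rule continuous_on_subset) auto
  qed (use U in auto)
  then have "((\<lambda>r. integral (cbox a b) (f r)) has_field_derivative (LINT x|lborel. f' r0 x)) (at r0)"
    using I[of "f' r0", OF c'r[OF U(3)] K(2)[OF U(3)]] by (simp add: at_within_open[OF U(3,1)])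
  then show ?thesis
  proof (rule has_field_derivative_transform_within_open[OF _ U(1,3)])
    show "integral (cbox a b) (f r) = (LINT x|lborel. f r x)" if "r \<in> U" for r
      by (rule I[OF c[OF that] K(1)[OF that], symmetric])
  qed
qed

lemma lborel_integral_affine:
  fixes f :: "'a::euclidean_space \<Rightarrow> real"
  assumes c: "c > 0" and [measurable]: "f \<in> borel_measurable borel"
  shows "(LINT x|lborel. f (t + c *\<^sub>R x)) = (LINT x|lborel. f x) / c ^ DIM('a)"
proof -
  have "(LINT x|lborel. f x) = (LINT x|density (distr lborel borel (\<lambda>x. t + c *\<^sub>R x)) (\<lambda>_. \<bar>c\<bar>^DIM('a)). f x)"
    using c by (subst lborel_affine[of c t]) auto
  also have "\<dots> = c ^ DIM('a) * (LINT x|lborel. f (t + c *\<^sub>R x))"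
    using c by (subst integral_density) (auto simp: integral_distr)
  finally show ?thesis using c by simp
qed

lemma lborel_integral_translate:
  fixes f :: "'a::euclidean_space \<Rightarrow> real"
  assumes "f \<in> borel_measurable borel"
  shows "(LINT x|lborel. f (x + t)) = (LINT x|lborel. f x)"
  using lborel_integral_affine[of 1 f t] assms by (simp add: add.commute)

section \<open>Test functions and Sobolev functions\<close>

lemma Cc_infinity_smooth: "f \<in> Cc_infinity U \<Longrightarrow> smooth f"
  by (simp add: Cc_infinity_def smooth_def)

lemma Cc_infinityI:
  assumes "smooth f" "compact K" "K \<subseteq> U" "\<And>x. x \<notin> K \<Longrightarrow> f x = 0"
  shows "f \<in> Cc_infinity U"
proof -
  have "{x. f x \<noteq> 0} \<subseteq> K" using assms by auto
  then have K: "closure {x. f x \<noteq> 0} \<subseteq> K"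
    using assms(2) by (simp add: closure_minimal compact_imp_closed)
  moreover have "compact (closure {x. f x \<noteq> 0})"
    by (rule compact_closure[THEN iffD2, OF bounded_subset[OF compact_imp_bounded[OF assms(2)]]])
      (use assms in auto)
  ultimately show ?thesis using assms unfolding Cc_infinity_def smooth_def by auto
qed

text \<open>The closed support does it: off this closed set the function vanishes near every point,
  so its derivative vanishes too.\<close>

lemma Cc_infinity_support:
  assumes "f \<in> Cc_infinity U"
  obtains K where "compact K" "K \<subseteq> U" "\<And>x. x \<notin> K \<Longrightarrow> f x = 0"
    "\<And>x. x \<notin> K \<Longrightarrow> frechet_derivative f (at x) = (\<lambda>v. 0)"
proof -
  obtain K where K: "compact K" "K \<subseteq> U" and z: "\<And>x. x \<notin> K \<Longrightarrow> f x = 0"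
  proof
    show "compact (closure {x. f x \<noteq> 0})" "closure {x. f x \<noteq> 0} \<subseteq> U"
      using assms by (auto simp: Cc_infinity_def)
    show "f x = 0" if "x \<notin> closure {x. f x \<noteq> 0}" for x
      using that closure_subset[of "{x. f x \<noteq> 0}"] by blast
  qed
  have "frechet_derivative f (at x) = (\<lambda>v. 0)" if x: "x \<notin> K" for x
  proof (rule frechet_derivative_eqI)
    have "((\<lambda>y. 0) has_derivative (\<lambda>v. 0)) (at x)" by simp
    then show "(f has_derivative (\<lambda>v. 0)) (at x)"
      by (rule has_derivative_transform_within_open[of _ _ _ _ "- K"]) (use x z K(1) in \<open>auto simp: open_Compl compact_imp_closed\<close>)
  qed
  then show ?thesis using that K z by blast
qed

lemma Cc_infinity_frechet:
  assumes "f \<in> Cc_infinity U"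
  shows "(\<lambda>x. frechet_derivative f (at x) v) \<in> Cc_infinity U"
proof -
  obtain K where "compact K" "K \<subseteq> U" "\<And>x. x \<notin> K \<Longrightarrow> frechet_derivative f (at x) = (\<lambda>v. 0)"
    using Cc_infinity_support[OF assms] by metis
  then show ?thesis
    by (intro Cc_infinityI[of _ K] smooth_frechet Cc_infinity_smooth[OF assms]) auto
qed

lemma Cc_infinity_continuous: "f \<in> Cc_infinity U \<Longrightarrow> continuous_on S f"
  by (simp add: Cc_infinity_smooth smooth_continuous_on)

lemma Cc_infinity_borel: "f \<in> Cc_infinity U \<Longrightarrow> f \<in> borel_measurable borel"
  by (simp add: Cc_infinity_continuous borel_measurable_continuous_onI)

lemma Cc_infinity_integrable: "f \<in> Cc_infinity U \<Longrightarrow> integrable lborel f"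
  by (metis Cc_infinity_support Cc_infinity_continuous integrable_compact_support)

lemma Cc_infinity_bounded:
  assumes "f \<in> Cc_infinity U" obtains B where "B > 0" "\<And>x. \<bar>f x\<bar> \<le> B"
proof -
  obtain K where K: "compact K" "\<And>x. x \<notin> K \<Longrightarrow> f x = 0" using Cc_infinity_support[OF assms] by metis
  show ?thesis
    by (rule bounded_compact_support[of f K]) (use K assms Cc_infinity_continuous that in auto)
qed

lemma Cc_infinity_mult:
  assumes f: "f \<in> Cc_infinity U" and g: "smooth g"
  shows "(\<lambda>x. f x * g x) \<in> Cc_infinity U"
proof -
  obtain K where K: "compact K" "K \<subseteq> U" "\<And>x. x \<notin> K \<Longrightarrow> f x = 0" using Cc_infinity_support[OF f] by metis
  then show ?thesis
    using f g by (intro Cc_infinityI[of _ K]) (auto intro: Cc_infinity_smooth)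
qed

lemma Cc_infinity_sum:
  assumes "finite I" "\<And>i. i \<in> I \<Longrightarrow> f i \<in> Cc_infinity U"
  shows "(\<lambda>x. \<Sum>i\<in>I. f i x) \<in> Cc_infinity U"
  using assms
proof (induction I rule: finite_induct)
  case empty
  then show ?case by (intro Cc_infinityI[of _ "{}"]) auto
next
  case (insert j I)
  obtain K where K: "compact K" "K \<subseteq> U" "\<And>x. x \<notin> K \<Longrightarrow> f j x = 0"
    using Cc_infinity_support[of "f j" U] insert by (metis insertI1)
  obtain K' where K': "compact K'" "K' \<subseteq> U" "\<And>x. x \<notin> K' \<Longrightarrow> (\<Sum>i\<in>I. f i x) = 0"
    using Cc_infinity_support insert by (metis insertCI)
  have "smooth (\<lambda>x. f j x + (\<Sum>i\<in>I. f i x))"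
    using insert by (intro smooth_add smooth_sum Cc_infinity_smooth) auto
  then show ?case using K K' insert.hyps
    by (intro Cc_infinityI[of _ "K \<union> K'"]) (auto intro: compact_Un)
qed

section \<open>Gradients and integration by parts\<close>

lemma frechet_linear:
  assumes "f differentiable (at x)"
  shows "frechet_derivative f (at x) (u + v) = frechet_derivative f (at x) u + frechet_derivative f (at x) v"
    and "frechet_derivative f (at x) (c *\<^sub>R u) = c *\<^sub>R frechet_derivative f (at x) u"
  using linear_frechet_derivative[OF assms] by (auto simp: linear_add linear_scale)

lemma frechet_eq_gradient:
  assumes "f differentiable (at x)"
  shows "frechet_derivative f (at x) v = gradient f x \<bullet> v"
proof -
  have "frechet_derivative f (at x) v = frechet_derivative f (at x) (\<Sum>i\<in>Basis. (v \<bullet> i) *\<^sub>R i)"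
    by (simp add: euclidean_representation)
  also have "\<dots> = (\<Sum>i\<in>Basis. (v \<bullet> i) * frechet_derivative f (at x) i)"
    using linear_frechet_derivative[OF assms] by (simp add: linear_sum linear_scale)
  also have "\<dots> = gradient f x \<bullet> v"
    unfolding gradient_def inner_sum_left by (simp add: inner_commute mult.commute)
  finally show ?thesis .
qed

lemma gradient_eqI:
  assumes "(f has_derivative (\<lambda>v. w \<bullet> v)) (at x)"
  shows "gradient f x = w"
  unfolding gradient_def frechet_derivative_eqI[OF assms] by (simp add: euclidean_representation)

lemma gradient_inner: "i \<in> Basis \<Longrightarrow> gradient f x \<bullet> i = frechet_derivative f (at x) i"
  by (simp add: gradient_def inner_sum_left inner_Basis if_distrib sum.delta cong: if_cong)

lemma continuous_on_gradient: "smooth f \<Longrightarrow> continuous_on S (gradient f)"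
  unfolding gradient_def by (intro continuous_intros smooth_continuous_on smooth_frechet)

lemma gradient_support:
  assumes "f \<in> Cc_infinity U"
  obtains K where "compact K" "K \<subseteq> U" "\<And>x. x \<notin> K \<Longrightarrow> f x = 0" "\<And>x. x \<notin> K \<Longrightarrow> gradient f x = 0"
  using Cc_infinity_support[OF assms] that unfolding gradient_def
  by (metis (no_types, lifting) scale_zero_left sum.neutral)

text \<open>By translation invariance the integral of f(x + h e) does not depend on h;
  differentiating under the integral at h = 0 gives the claim without iterated integrals.\<close>

lemma integral_frechet_zero:
  fixes f :: "'a::euclidean_space \<Rightarrow> real"
  assumes f: "f \<in> Cc_infinity U"
  shows "(LINT x|lborel. frechet_derivative f (at x) e) = 0"
proof -
  obtain K where K: "compact K" "\<And>x. x \<notin> K \<Longrightarrow> f x = 0"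
    "\<And>x. x \<notin> K \<Longrightarrow> frechet_derivative f (at x) = (\<lambda>v. 0)"
    using Cc_infinity_support[OF f] by metis
  \<comment> \<open>The supports of all translates by h e with |h| <= 1 lie in one compact set,
    which supplies the common box.\<close>
  define K' where "K' = (\<lambda>(x, h). x - h *\<^sub>R e) ` (K \<times> {-1..1::real})"
  have "compact K'"
    unfolding K'_def using K(1)
    by (intro compact_continuous_image) (auto intro!: compact_Times continuous_intros simp: case_prod_unfold)
  then obtain a where a: "K' \<subseteq> cbox (-a) a"
    using bounded_subset_cbox_symmetric compact_imp_bounded by metis
  have nK: "x + h *\<^sub>R e \<notin> K" if "h \<in> {-1<..<1}" "x \<notin> cbox (-a) a" for x and h :: real
  proof
    assume "x + h *\<^sub>R e \<in> K"
    then have "(x + h *\<^sub>R e) - h *\<^sub>R e \<in> K'"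
      unfolding K'_def using that(1) by (intro image_eqI[of _ _ "(x + h *\<^sub>R e, h)"]) auto
    then show False using that(2) a by auto
  qed
  have d: "((\<lambda>h. f (x + h *\<^sub>R e)) has_real_derivative frechet_derivative f (at (x + h *\<^sub>R e)) e) (at h)" for x h
  proof -
    have "((\<lambda>h. x + h *\<^sub>R e) has_derivative (\<lambda>k. k *\<^sub>R e)) (at h)"
      by (auto intro!: derivative_eq_intros)
    then have "((\<lambda>h. f (x + h *\<^sub>R e)) has_derivative (\<lambda>k. frechet_derivative f (at (x + h *\<^sub>R e)) (k *\<^sub>R e))) (at h)"
      using diff_chain_at[OF _ smooth_has_derivative[OF Cc_infinity_smooth[OF f]], of "\<lambda>h. x + h *\<^sub>R e" _ h]
      by (simp add: o_def)
    then show ?thesis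
      by (simp add: has_field_derivative_def frechet_linear(2)[OF smooth_differentiable[OF Cc_infinity_smooth[OF f]]] mult_commute_abs)
  qed
  have "((\<lambda>h. LINT x|lborel. f (x + h *\<^sub>R e)) has_real_derivative
      (LINT x|lborel. frechet_derivative f (at (x + 0 *\<^sub>R e)) e)) (at (0::real))"
  proof (rule DERIV_lborel_integral[where U = "{-1<..<1}" and a = "-a" and b = a])
    show "continuous_on UNIV (\<lambda>x. f (x + r *\<^sub>R e))" for r
      by (rule continuous_on_compose2[OF Cc_infinity_continuous[OF f, of UNIV]]) (auto intro: continuous_intros)
    show "continuous_on ({-1<..<1} \<times> UNIV) (\<lambda>(r, x). frechet_derivative f (at (x + r *\<^sub>R e)) e)"
      unfolding case_prod_unfold
      by (rule continuous_on_compose2[OF Cc_infinity_continuous[OF Cc_infinity_frechet[OF f], of UNIV]])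
        (auto intro!: continuous_intros)
  qed (use d K nK in auto)
  then have "((\<lambda>h. LINT x|lborel. f x) has_real_derivative
      (LINT x|lborel. frechet_derivative f (at x) e)) (at (0::real))"
    by (simp add: lborel_integral_translate Cc_infinity_borel[OF f])
  then show ?thesis using DERIV_unique DERIV_const by blast
qed

lemma integration_by_parts:
  fixes f g :: "'a::euclidean_space \<Rightarrow> real"
  assumes f: "smooth f" and g: "g \<in> Cc_infinity U"
  shows "(LINT x|lborel. f x * frechet_derivative g (at x) e) =
    - (LINT x|lborel. frechet_derivative f (at x) e * g x)"
proof -
  have D: "((\<lambda>x. g x * f x) has_derivative
     (\<lambda>v. g x * frechet_derivative f (at x) v + frechet_derivative g (at x) v * f x)) (at x)" for x
    by (intro has_derivative_mult smooth_has_derivative f Cc_infinity_smooth[OF g])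
  then have d: "frechet_derivative (\<lambda>x. g x * f x) (at x) e =
      frechet_derivative f (at x) e * g x + f x * frechet_derivative g (at x) e" for x
    unfolding frechet_derivative_eqI[OF D] by simp
  have "integrable lborel (\<lambda>x. frechet_derivative f (at x) e * g x)"
    using Cc_infinity_integrable[OF Cc_infinity_mult[OF g smooth_frechet[OF f]]] by (simp add: mult.commute)
  moreover have "integrable lborel (\<lambda>x. f x * frechet_derivative g (at x) e)"
    using Cc_infinity_integrable[OF Cc_infinity_mult[OF Cc_infinity_frechet[OF g] f]] by (simp add: mult.commute)
  ultimately show ?thesis
    using integral_frechet_zero[OF Cc_infinity_mult[OF g f], of e] by (simp add: d)
qed

section \<open>Lebesgue norms and Poincare's inequality\<close>

lemma Lp_norm_zero [simp]: "0 < p \<Longrightarrow> Lp_norm M p (\<lambda>x. 0) = 0"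
  by (simp add: Lp_norm_def)

lemma Lp_norm_scale:
  fixes f :: "'b \<Rightarrow> 'c::euclidean_space"
  assumes "0 < p"
  shows "Lp_norm M p (\<lambda>x. c *\<^sub>R f x) = \<bar>c\<bar> * Lp_norm M p f"
  using assms by (simp add: Lp_norm_def powr_mult powr_powr integral_nonneg_AE)

lemma mem_Lp_scale: "mem_Lp M p f \<Longrightarrow> mem_Lp M p (\<lambda>x. c *\<^sub>R f x)"
  by (auto simp: mem_Lp_def powr_mult)

lemma mem_Lp_imp_L1:
  fixes f :: "'b \<Rightarrow> 'c::euclidean_space"
  assumes p: "1 < p" and fin: "finite_measure M" and f: "mem_Lp M p f"
  shows "integrable M f"
    and "(LINT x|M. norm (f x)) \<le> measure M (space M) powr (1 - 1 / p) * Lp_norm M p f"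
proof -
  interpret finite_measure M by fact
  have [measurable]: "f \<in> borel_measurable M" using f by (simp add: mem_Lp_def)
  define q where "q = p / (p - 1)"
  have pq: "1 / p + 1 / q = 1" using p by (simp add: q_def field_simps)
  have H: "integrable M (\<lambda>x. norm (f x) * 1)"
    "(LINT x|M. \<bar>norm (f x) * 1\<bar>) \<le>
      (LINT x|M. \<bar>norm (f x)\<bar> powr p) powr (1 / p) * (LINT x|M. \<bar>1 :: real\<bar> powr q) powr (1 / q)"
    using Holder_integral[OF p pq, of "\<lambda>x. norm (f x)" M "\<lambda>x. 1"] f by (simp_all add: mem_Lp_def)
  show "integrable M f" using H(1) by (simp add: integrable_norm_iff)
  have "1 / q = 1 - 1 / p" using pq by simp
  then show "(LINT x|M. norm (f x)) \<le> measure M (space M) powr (1 - 1 / p) * Lp_norm M p f"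
    using H(2) by (simp add: Lp_norm_def mult.commute)
qed

lemma mem_Lp_diff:
  fixes f g :: "'b \<Rightarrow> 'c::euclidean_space"
  assumes p: "0 < p" and f: "mem_Lp M p f" and g: "mem_Lp M p g"
  shows "mem_Lp M p (\<lambda>x. f x - g x)"
proof -
  have [measurable]: "f \<in> borel_measurable M" "g \<in> borel_measurable M"
    using f g by (auto simp: mem_Lp_def)
  have le: "norm (f x - g x) powr p \<le> 2 powr p * norm (f x) powr p + 2 powr p * norm (g x) powr p" for x
  proof -
    have "norm (f x - g x) \<le> 2 * max (norm (f x)) (norm (g x))"
      using norm_triangle_ineq4[of "f x" "g x"] by linarith
    then have "norm (f x - g x) powr p \<le> (2 * max (norm (f x)) (norm (g x))) powr p"
      using p by (intro powr_mono2) auto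
    also have "\<dots> = 2 powr p * max (norm (f x)) (norm (g x)) powr p" by (simp add: powr_mult)
    also have "\<dots> \<le> 2 powr p * norm (f x) powr p + 2 powr p * norm (g x) powr p"
      by (cases "norm (f x) \<le> norm (g x)") (auto simp: max_def)
    finally show ?thesis .
  qed
  have "integrable M (\<lambda>x. 2 powr p * norm (f x) powr p + 2 powr p * norm (g x) powr p)"
    using f g by (simp add: mem_Lp_def)
  then have "integrable M (\<lambda>x. norm (f x - g x) powr p)"
    by (rule Bochner_Integration.integrable_bound) (use le order_trans[OF _ abs_ge_self] in auto)
  then show ?thesis by (simp add: mem_Lp_def)
qed

text \<open>A segment of length \<open>D\<close> issuing from a point of \<open>U\<close> ends
  outside \<open>U\<close>, where \<phi> vanishes. So \<phi>(x) is minus the integral of a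
  directional derivative along this segment, and integrating in x with Fubini and translation
  invariance costs exactly the factor \<open>D\<close>.\<close>

lemma poincare_L1_smooth:
  fixes \<phi> :: "'a::euclidean_space \<Rightarrow> real"
  assumes \<phi>: "\<phi> \<in> Cc_infinity U" and U: "\<And>x y. x \<in> U \<Longrightarrow> y \<in> U \<Longrightarrow> dist x y < D" and D: "0 < D"
  shows "(LINT x|lborel. \<bar>\<phi> x\<bar>) \<le> D * (LINT x|lborel. norm (gradient \<phi> x))"
proof -
  obtain K where K: "compact K" "K \<subseteq> U" "\<And>x. x \<notin> K \<Longrightarrow> \<phi> x = 0" "\<And>x. x \<notin> K \<Longrightarrow> gradient \<phi> x = 0"
    using gradient_support[OF \<phi>] by metis
  have sm: "smooth \<phi>" by (rule Cc_infinity_smooth[OF \<phi>])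
  obtain e :: 'a where e: "norm e = 1" using SOME_Basis norm_Basis by blast
  have cg: "continuous_on S (gradient \<phi>)" for S by (rule continuous_on_gradient[OF sm])
  have [measurable]: "gradient \<phi> \<in> borel_measurable borel" "\<phi> \<in> borel_measurable borel"
    using cg Cc_infinity_borel[OF \<phi>] by (auto intro: borel_measurable_continuous_onI)
  have pt: "ennreal \<bar>\<phi> x\<bar> \<le> (\<integral>\<^sup>+\<tau>. ennreal (norm (gradient \<phi> (x + \<tau> *\<^sub>R e))) * indicator {0..D} \<tau> \<partial>lborel)" for x
  proof (cases "x \<in> K")
    case True
    have out: "\<phi> (x + D *\<^sub>R e) = 0"
    proof -
      have "x + D *\<^sub>R e \<notin> U" using U[of x "x + D *\<^sub>R e"] True K(2) e D by (auto simp: dist_norm)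
      then show ?thesis using K by blast
    qed
    define g where "g \<tau> = gradient \<phi> (x + \<tau> *\<^sub>R e) \<bullet> e" for \<tau>
    have cgx: "continuous_on S (\<lambda>\<tau>. gradient \<phi> (x + \<tau> *\<^sub>R e))" for S
      by (rule continuous_on_compose2[OF cg[of UNIV]]) (auto intro!: continuous_intros)
    have d: "((\<lambda>\<tau>. \<phi> (x + \<tau> *\<^sub>R e)) has_real_derivative g \<tau>) (at \<tau>)" for \<tau>
    proof -
      have "((\<lambda>h. x + h *\<^sub>R e) has_derivative (\<lambda>k. k *\<^sub>R e)) (at \<tau>)"
        by (auto intro!: derivative_eq_intros)
      then have "((\<lambda>h. \<phi> (x + h *\<^sub>R e)) has_derivative (\<lambda>k. frechet_derivative \<phi> (at (x + \<tau> *\<^sub>R e)) (k *\<^sub>R e))) (at \<tau>)"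
        using diff_chain_at[OF _ smooth_has_derivative[OF sm], of "\<lambda>h. x + h *\<^sub>R e" _ \<tau>]
        by (simp add: o_def)
      then show ?thesis
        by (simp add: has_field_derivative_def frechet_eq_gradient[OF smooth_differentiable[OF sm]] g_def mult_commute_abs)
    qed
    have int: "(g has_integral (\<phi> (x + D *\<^sub>R e) - \<phi> (x + 0 *\<^sub>R e))) {0..D}"
      using D d by (intro fundamental_theorem_of_calculus)
        (auto simp: has_real_derivative_iff_has_vector_derivative[symmetric] intro: has_field_derivative_at_within)
    have ng: "continuous_on {0..D} (\<lambda>\<tau>. norm (gradient \<phi> (x + \<tau> *\<^sub>R e)))"
      by (intro continuous_intros cgx)
    have "\<bar>\<phi> x\<bar> = norm (integral {0..D} g)" using int out by (simp add: integral_unique)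
    also have "\<dots> \<le> integral {0..D} (\<lambda>\<tau>. norm (gradient \<phi> (x + \<tau> *\<^sub>R e)))"
    proof (rule integral_norm_bound_integral)
      show "g integrable_on {0..D}" using int by blast
      show "(\<lambda>\<tau>. norm (gradient \<phi> (x + \<tau> *\<^sub>R e))) integrable_on {0..D}"
        using ng by (rule integrable_continuous_interval)
      show "norm (g \<tau>) \<le> norm (gradient \<phi> (x + \<tau> *\<^sub>R e))" for \<tau>
        unfolding g_def using Cauchy_Schwarz_ineq2[of "gradient \<phi> (x + \<tau> *\<^sub>R e)" e] e by simp
    qed
    finally have le: "\<bar>\<phi> x\<bar> \<le> integral {0..D} (\<lambda>\<tau>. norm (gradient \<phi> (x + \<tau> *\<^sub>R e)))" .
    have "((\<lambda>\<tau>. norm (gradient \<phi> (x + \<tau> *\<^sub>R e))) has_integral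
        integral {0..D} (\<lambda>\<tau>. norm (gradient \<phi> (x + \<tau> *\<^sub>R e)))) {0..D}"
      using integrable_continuous_interval[OF ng] by (rule integrable_integral)
    then have "(\<integral>\<^sup>+\<tau>. ennreal (norm (gradient \<phi> (x + \<tau> *\<^sub>R e))) * indicator {0..D} \<tau> \<partial>lborel) =
        ennreal (integral {0..D} (\<lambda>\<tau>. norm (gradient \<phi> (x + \<tau> *\<^sub>R e))))"
      by (intro nn_integral_has_integral_lebesgue'[of "{0..D}"]) auto
    then show ?thesis using le by (simp add: ennreal_leI)
  next
    case False
    then have "\<phi> x = 0" by (rule K(3))
    then show ?thesis by simp
  qed
  have ig: "integrable lborel (\<lambda>x. norm (gradient \<phi> x))"
    using integrable_compact_support[OF cg K(1) K(4)] by simp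
  have "(\<integral>\<^sup>+x. ennreal \<bar>\<phi> x\<bar> \<partial>lborel) \<le>
      (\<integral>\<^sup>+x. (\<integral>\<^sup>+\<tau>. ennreal (norm (gradient \<phi> (x + \<tau> *\<^sub>R e))) * indicator {0..D} \<tau> \<partial>lborel) \<partial>lborel)"
    by (intro nn_integral_mono pt)
  also have "\<dots> = (\<integral>\<^sup>+\<tau>. (\<integral>\<^sup>+x. ennreal (norm (gradient \<phi> (x + \<tau> *\<^sub>R e))) * indicator {0..D} \<tau> \<partial>lborel) \<partial>lborel)"
    by (rule lborel_pair.Fubini') measurable
  also have "\<dots> = (\<integral>\<^sup>+\<tau>. (\<integral>\<^sup>+x. ennreal (norm (gradient \<phi> x)) \<partial>lborel) * indicator {0..D} \<tau> \<partial>lborel)"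
  proof (rule nn_integral_cong)
    fix \<tau> :: real
    have "(\<integral>\<^sup>+x. ennreal (norm (gradient \<phi> x)) \<partial>lborel) = (\<integral>\<^sup>+x. ennreal (norm (gradient \<phi> x)) \<partial>distr lborel borel ((+) (\<tau> *\<^sub>R e)))"
      by (simp only: lborel_distr_plus)
    also have "\<dots> = (\<integral>\<^sup>+x. ennreal (norm (gradient \<phi> (x + \<tau> *\<^sub>R e))) \<partial>lborel)"
      by (subst nn_integral_distr) (auto simp: add.commute)
    finally show "(\<integral>\<^sup>+x. ennreal (norm (gradient \<phi> (x + \<tau> *\<^sub>R e))) * indicator {0..D} \<tau> \<partial>lborel) =
        (\<integral>\<^sup>+x. ennreal (norm (gradient \<phi> x)) \<partial>lborel) * indicator {0..D} \<tau>"
      by (simp add: nn_integral_multc)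
  qed
  also have "\<dots> = (\<integral>\<^sup>+x. ennreal (norm (gradient \<phi> x)) \<partial>lborel) * ennreal D"
    using D by (subst nn_integral_cmult) auto
  also have "\<dots> = ennreal (D * (LINT x|lborel. norm (gradient \<phi> x)))"
    using ig D by (subst nn_integral_eq_integral) (auto simp: ennreal_mult' mult.commute)
  finally show ?thesis
    using D by (subst (asm) nn_integral_eq_integral) (auto simp: Cc_infinity_integrable[OF \<phi>] integral_nonneg_AE)
qed

lemma Cc_infinity_gradient_mem_Lp:
  assumes \<phi>: "\<phi> \<in> Cc_infinity U" and fin: "finite_measure (leb V)" and p: "0 \<le> p"
  shows "mem_Lp (leb V) p \<phi>" "mem_Lp (leb V) p (gradient \<phi>)"
proof -
  obtain K where K: "compact K" "\<And>x. x \<notin> K \<Longrightarrow> \<phi> x = 0" "\<And>x. x \<notin> K \<Longrightarrow> gradient \<phi> x = 0"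
    using gradient_support[OF \<phi>] by metis
  have cg: "continuous_on UNIV (gradient \<phi>)"
    by (rule continuous_on_gradient[OF Cc_infinity_smooth[OF \<phi>]])
  obtain B where B: "\<And>x. norm (gradient \<phi> x) \<le> B"
    using bounded_compact_support[OF cg K(1) K(3)] by blast
  obtain B' where B': "\<And>x. \<bar>\<phi> x\<bar> \<le> B'" using Cc_infinity_bounded[OF \<phi>] by blast
  show "mem_Lp (leb V) p \<phi>"
    by (rule mem_Lp_bounded[where B = B'])
      (use fin p B' Cc_infinity_borel[OF \<phi>] in \<open>auto intro: borel_measurable_leb\<close>)
  show "mem_Lp (leb V) p (gradient \<phi>)"
    by (rule mem_Lp_bounded[where B = B])
      (use fin p B cg in \<open>auto intro!: borel_measurable_leb borel_measurable_continuous_onI\<close>)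
qed

text \<open>The function approximates itself, and the weak gradient identity is integration by
  parts: the integrands vanish off the domain, so the integrals extend to the whole space.\<close>

lemma Cc_infinity_in_sobolev:
  assumes \<phi>: "\<phi> \<in> Cc_infinity \<Omega>" and \<Omega>: "open \<Omega>" "bounded \<Omega>" and p: "1 < p"
  shows "(\<phi>, gradient \<phi>) \<in> sobolev_W1_0 p \<Omega>"
proof -
  have bor: "\<Omega> \<in> sets borel" using \<Omega> by simp
  have "weak_gradient \<Omega> \<phi> (gradient \<phi>)"
    unfolding weak_gradient_def
  proof (intro ballI)
    fix \<psi> and i :: 'a assume \<psi>: "\<psi> \<in> Cc_infinity \<Omega>" and i: "i \<in> Basis"
    obtain K where K: "K \<subseteq> \<Omega>" "\<And>x. x \<notin> K \<Longrightarrow> \<psi> x = 0"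
      "\<And>x. x \<notin> K \<Longrightarrow> frechet_derivative \<psi> (at x) = (\<lambda>v. 0)"
      using Cc_infinity_support[OF \<psi>] by metis
    have "(LINT x|leb \<Omega>. \<phi> x * frechet_derivative \<psi> (at x) i) = (LINT x|lborel. \<phi> x * frechet_derivative \<psi> (at x) i)"
    proof (rule integral_leb_eq[OF bor])
      show "\<phi> x * frechet_derivative \<psi> (at x) i = 0" if "x \<notin> \<Omega>" for x
      proof -
        have "x \<notin> K" using that K(1) by blast
        then show ?thesis using K(3) by simp
      qed
    qed
    also have "\<dots> = - (LINT x|lborel. frechet_derivative \<phi> (at x) i * \<psi> x)"
      by (rule integration_by_parts[OF Cc_infinity_smooth[OF \<phi>] \<psi>])
    also have "(LINT x|lborel. frechet_derivative \<phi> (at x) i * \<psi> x) = (LINT x|leb \<Omega>. (gradient \<phi> x \<bullet> i) * \<psi> x)"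
      unfolding gradient_inner[OF i]
    proof (rule integral_leb_eq[OF bor, symmetric])
      show "frechet_derivative \<phi> (at x) i * \<psi> x = 0" if "x \<notin> \<Omega>" for x
      proof -
        have "x \<notin> K" using that K(1) by blast
        then show ?thesis using K(2) by simp
      qed
    qed
    finally show "(LINT x|leb \<Omega>. \<phi> x * frechet_derivative \<psi> (at x) i) = - (LINT x|leb \<Omega>. (gradient \<phi> x \<bullet> i) * \<psi> x)" .
  qed
  then have "(\<phi>, gradient \<phi>) \<in> sobolev_W1 p \<Omega>"
    using p Cc_infinity_gradient_mem_Lp[OF \<phi> finite_measure_leb[OF \<Omega>(2) bor], of p]
    by (simp add: sobolev_W1_def)
  then show ?thesis
    unfolding sobolev_W1_0_def using \<phi> p by (auto intro!: exI[of _ "\<lambda>k. \<phi>"])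
qed

text \<open>Homogeneity is what turns a supremum over the unit ball into a bound for all
  pairs.\<close>

lemma sobolev_W1_0_scale:
  assumes vg: "(v, g) \<in> sobolev_W1_0 p \<Omega>" and p: "1 < p"
  shows "((\<lambda>x. c * v x), (\<lambda>x. c *\<^sub>R g x)) \<in> sobolev_W1_0 p \<Omega>"
proof -
  obtain \<phi> where \<phi>: "\<And>k. \<phi> k \<in> Cc_infinity \<Omega>"
    "(\<lambda>k. Lp_norm (leb \<Omega>) p (\<lambda>x. \<phi> k x - v x)) \<longlonglongrightarrow> 0"
    "(\<lambda>k. Lp_norm (leb \<Omega>) p (\<lambda>x. gradient (\<phi> k) x - g x)) \<longlonglongrightarrow> 0"
    and W: "mem_Lp (leb \<Omega>) p v" "mem_Lp (leb \<Omega>) p g" "weak_gradient \<Omega> v g"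
    using vg by (auto simp: sobolev_W1_0_def sobolev_W1_def)
  have g: "gradient (\<lambda>x. \<phi> k x * c) x = c *\<^sub>R gradient (\<phi> k) x" for k x
  proof (rule gradient_eqI)
    have "(\<phi> k has_derivative (\<lambda>v. gradient (\<phi> k) x \<bullet> v)) (at x)"
      using smooth_has_derivative[OF Cc_infinity_smooth[OF \<phi>(1)], of k x]
      unfolding frechet_eq_gradient[OF smooth_differentiable[OF Cc_infinity_smooth[OF \<phi>(1)]], abs_def] .
    then show "((\<lambda>x. \<phi> k x * c) has_derivative (\<lambda>v. c *\<^sub>R gradient (\<phi> k) x \<bullet> v)) (at x)"
      by (auto intro!: derivative_eq_intros simp: mult.commute)
  qed
  have "weak_gradient \<Omega> (\<lambda>x. c * v x) (\<lambda>x. c *\<^sub>R g x)"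
    using W(3) unfolding weak_gradient_def by (simp add: mult.assoc)
  then have "((\<lambda>x. c * v x), (\<lambda>x. c *\<^sub>R g x)) \<in> sobolev_W1 p \<Omega>"
    using mem_Lp_scale[OF W(1), of c] mem_Lp_scale[OF W(2), of c] by (simp add: sobolev_W1_def)
  moreover have "(\<lambda>k. Lp_norm (leb \<Omega>) p (\<lambda>x. \<phi> k x * c - c * v x)) \<longlonglongrightarrow> 0"
  proof -
    have "Lp_norm (leb \<Omega>) p (\<lambda>x. \<phi> k x * c - c * v x) = \<bar>c\<bar> * Lp_norm (leb \<Omega>) p (\<lambda>x. \<phi> k x - v x)" for k
      using Lp_norm_scale[of p "leb \<Omega>" c "\<lambda>x. \<phi> k x - v x"] p by (simp add: algebra_simps)
    then show ?thesis using tendsto_mult_left[OF \<phi>(2), of "\<bar>c\<bar>"] by simp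
  qed
  moreover have "(\<lambda>k. Lp_norm (leb \<Omega>) p (\<lambda>x. gradient (\<lambda>x. \<phi> k x * c) x - c *\<^sub>R g x)) \<longlonglongrightarrow> 0"
  proof -
    have "Lp_norm (leb \<Omega>) p (\<lambda>x. gradient (\<lambda>x. \<phi> k x * c) x - c *\<^sub>R g x) = \<bar>c\<bar> * Lp_norm (leb \<Omega>) p (\<lambda>x. gradient (\<phi> k) x - g x)" for k
      unfolding g scaleR_right_diff_distrib[symmetric] using p by (intro Lp_norm_scale) simp
    then show ?thesis using tendsto_mult_left[OF \<phi>(3), of "\<bar>c\<bar>"] by simp
  qed
  moreover have "(\<lambda>x. \<phi> k x * c) \<in> Cc_infinity \<Omega>" for k
    by (rule Cc_infinity_mult[OF \<phi>(1) smooth_const])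
  ultimately show ?thesis unfolding sobolev_W1_0_def
    by (auto intro!: exI[of _ "\<lambda>k x. \<phi> k x * c"])
qed

text \<open>Passes from smooth functions to their closure by density, with Hoelder's factor
  \<open>m\<close> for the bounded domain. An L^1 bound suffices for what follows: densities that
  are bounded pair with \<open>v\<close> through it, and it keeps the supremum in
  \<open>dual_norm\<close> finite. The second estimate retains the L^1 norm of the gradient, ready
  for integration over time slices.\<close>

lemma poincare_L1_sobolev:
  fixes \<Omega> :: "'a::euclidean_space set"
  assumes \<Omega>: "open \<Omega>" "bounded \<Omega>" and p: "1 < p"
  obtains C where "C > 0" "\<And>v g. (v, g) \<in> sobolev_W1_0 p \<Omega> \<Longrightarrow> (LINT x|leb \<Omega>. \<bar>v x\<bar>) \<le> C * Lp_norm (leb \<Omega>) p g"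
    "\<And>\<phi>. \<phi> \<in> Cc_infinity \<Omega> \<Longrightarrow> (LINT x|leb \<Omega>. \<bar>\<phi> x\<bar>) \<le> C * (LINT x|leb \<Omega>. norm (gradient \<phi> x))"
proof -
  have bor: "\<Omega> \<in> sets borel" using \<Omega> by simp
  note fin = finite_measure_leb[OF \<Omega>(2) bor]
  obtain D where D: "0 < D" "\<And>x y. x \<in> \<Omega> \<Longrightarrow> y \<in> \<Omega> \<Longrightarrow> dist x y < D"
  proof -
    obtain R where R: "\<And>x. x \<in> \<Omega> \<Longrightarrow> norm x \<le> R" using \<Omega>(2) by (auto simp: bounded_iff)
    have "dist x y < 2 * \<bar>R\<bar> + 1" if "x \<in> \<Omega>" "y \<in> \<Omega>" for x y
      using R[OF that(1)] R[OF that(2)] norm_triangle_ineq4[of x y] by (simp add: dist_norm)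
    then show ?thesis using that[of "2 * \<bar>R\<bar> + 1"] by simp
  qed
  define m where "m = measure (leb \<Omega>) (space (leb \<Omega>)) powr (1 - 1 / p)"
  define C where "C = D * m + D"
  have C: "C > 0" "D * m \<le> C" "D \<le> C" using D by (auto simp: C_def m_def intro!: add_nonneg_pos)
  have sm: "(LINT x|leb \<Omega>. \<bar>\<phi> x\<bar>) \<le> D * (LINT x|leb \<Omega>. norm (gradient \<phi> x))" if \<phi>: "\<phi> \<in> Cc_infinity \<Omega>" for \<phi>
  proof -
    obtain K where K: "K \<subseteq> \<Omega>" "\<And>x. x \<notin> K \<Longrightarrow> \<phi> x = 0" "\<And>x. x \<notin> K \<Longrightarrow> gradient \<phi> x = 0"
      using gradient_support[OF \<phi>] by metis
    have "(LINT x|leb \<Omega>. \<bar>\<phi> x\<bar>) = (LINT x|lborel. \<bar>\<phi> x\<bar>)"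
      by (rule integral_leb_eq[OF bor]) (use K(1) K(2) in force)
    moreover have "(LINT x|leb \<Omega>. norm (gradient \<phi> x)) = (LINT x|lborel. norm (gradient \<phi> x))"
      by (rule integral_leb_eq[OF bor]) (use K(1) K(3) in force)
    ultimately show ?thesis using poincare_L1_smooth[OF \<phi> D(2) D(1)] by simp
  qed
  have "(LINT x|leb \<Omega>. \<bar>v x\<bar>) \<le> C * Lp_norm (leb \<Omega>) p g" if vg: "(v, g) \<in> sobolev_W1_0 p \<Omega>" for v g
  proof -
    obtain \<phi> where \<phi>: "\<And>k. \<phi> k \<in> Cc_infinity \<Omega>"
      "(\<lambda>k. Lp_norm (leb \<Omega>) p (\<lambda>x. \<phi> k x - v x)) \<longlonglongrightarrow> 0"
      "(\<lambda>k. Lp_norm (leb \<Omega>) p (\<lambda>x. gradient (\<phi> k) x - g x)) \<longlonglongrightarrow> 0"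
      and W: "mem_Lp (leb \<Omega>) p v" "mem_Lp (leb \<Omega>) p g"
      using vg by (auto simp: sobolev_W1_0_def sobolev_W1_def)
    note L = Cc_infinity_gradient_mem_Lp[OF \<phi>(1) fin, of p]
    have le: "(LINT x|leb \<Omega>. \<bar>v x\<bar>) \<le> m * Lp_norm (leb \<Omega>) p (\<lambda>x. \<phi> k x - v x) +
        D * (m * Lp_norm (leb \<Omega>) p g + m * Lp_norm (leb \<Omega>) p (\<lambda>x. gradient (\<phi> k) x - g x))" for k
    proof -
      have d1: "mem_Lp (leb \<Omega>) p (\<lambda>x. \<phi> k x - v x)" using p L W by (intro mem_Lp_diff) auto
      have d2: "mem_Lp (leb \<Omega>) p (\<lambda>x. gradient (\<phi> k) x - g x)" using p L W by (intro mem_Lp_diff) auto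
      note i = mem_Lp_imp_L1(1)[OF p fin] and b = mem_Lp_imp_L1(2)[OF p fin, folded m_def]
      have "(LINT x|leb \<Omega>. \<bar>v x\<bar>) \<le> (LINT x|leb \<Omega>. \<bar>\<phi> k x - v x\<bar> + \<bar>\<phi> k x\<bar>)"
        using i[OF W(1)] i[OF d1] i[OF L(1)] p by (intro integral_mono) auto
      also have "\<dots> = (LINT x|leb \<Omega>. \<bar>\<phi> k x - v x\<bar>) + (LINT x|leb \<Omega>. \<bar>\<phi> k x\<bar>)"
        using i[OF W(1)] i[OF d1] i[OF L(1)] p by (intro Bochner_Integration.integral_add) auto
      also have "\<dots> \<le> m * Lp_norm (leb \<Omega>) p (\<lambda>x. \<phi> k x - v x) + D * (LINT x|leb \<Omega>. norm (gradient (\<phi> k) x))"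
        using b[OF d1] sm[OF \<phi>(1)] by (intro add_mono) auto
      also have "(LINT x|leb \<Omega>. norm (gradient (\<phi> k) x)) \<le> (LINT x|leb \<Omega>. norm (g x) + norm (gradient (\<phi> k) x - g x))"
        using i[OF W(2)] i[OF d2] i[OF L(2)] p norm_triangle_sub[of "gradient (\<phi> k) _"] by (intro integral_mono) auto
      also have "\<dots> = (LINT x|leb \<Omega>. norm (g x)) + (LINT x|leb \<Omega>. norm (gradient (\<phi> k) x - g x))"
        using i[OF W(2)] i[OF d2] by (intro Bochner_Integration.integral_add) auto
      also have "\<dots> \<le> m * Lp_norm (leb \<Omega>) p g + m * Lp_norm (leb \<Omega>) p (\<lambda>x. gradient (\<phi> k) x - g x)"
        using b[OF W(2)] b[OF d2] by (intro add_mono) auto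
      finally show ?thesis using D(1) by simp
    qed
    have "(\<lambda>k. m * Lp_norm (leb \<Omega>) p (\<lambda>x. \<phi> k x - v x) +
        D * (m * Lp_norm (leb \<Omega>) p g + m * Lp_norm (leb \<Omega>) p (\<lambda>x. gradient (\<phi> k) x - g x))) \<longlonglongrightarrow>
        m * 0 + D * (m * Lp_norm (leb \<Omega>) p g + m * 0)"
      by (intro tendsto_intros \<phi>)
    then have "(LINT x|leb \<Omega>. \<bar>v x\<bar>) \<le> m * 0 + D * (m * Lp_norm (leb \<Omega>) p g + m * 0)"
      by (rule LIMSEQ_le_const) (use le in blast)
    also have "\<dots> \<le> C * Lp_norm (leb \<Omega>) p g"
      using mult_right_mono[OF C(2) Lp_norm_nonneg, of "leb \<Omega>" p g] by (simp add: mult.assoc)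
    finally show ?thesis .
  qed
  moreover have "(LINT x|leb \<Omega>. \<bar>\<phi> x\<bar>) \<le> C * (LINT x|leb \<Omega>. norm (gradient \<phi> x))" if "\<phi> \<in> Cc_infinity \<Omega>" for \<phi>
    using sm[OF that] mult_right_mono[OF C(3), of "LINT x|leb \<Omega>. norm (gradient \<phi> x)"]
    by (simp add: integral_nonneg_AE)
  ultimately show ?thesis using that C(1) by blast
qed

section \<open>The dual norm\<close>

lemma zero_in_sobolev_W1_0: "1 < p \<Longrightarrow> ((\<lambda>x. 0), (\<lambda>x. 0)) \<in> sobolev_W1_0 p (\<Omega> :: 'a::euclidean_space set)"
proof -
  assume p: "1 < p"
  have z: "(\<lambda>x. 0) \<in> Cc_infinity \<Omega>" by (intro Cc_infinityI[of _ "{}"]) auto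
  have "gradient (\<lambda>x::'a. 0) = (\<lambda>x. 0)" by (intro ext gradient_eqI) simp
  then show ?thesis using p z
    by (auto simp: sobolev_W1_0_def sobolev_W1_def mem_Lp_def weak_gradient_def intro!: exI[of _ "\<lambda>k x. 0"])
qed

lemma dual_norm_le:
  assumes p: "1 < p"
    and "\<And>v g. (v, g) \<in> sobolev_W1_0 p \<Omega> \<Longrightarrow> \<bar>LINT x|leb \<Omega>. f x * v x\<bar> \<le> M * Lp_norm (leb \<Omega>) p g"
    and M: "0 \<le> M"
  shows "dual_norm p \<Omega> f \<le> M"
  unfolding dual_norm_def
proof (rule cSUP_least)
  show "{(v, g). (v, g) \<in> sobolev_W1_0 p \<Omega> \<and> Lp_norm (leb \<Omega>) p g \<le> 1} \<noteq> {}"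
    using zero_in_sobolev_W1_0[OF p, of \<Omega>] p by (auto intro!: exI[of _ "\<lambda>x. 0"])
  fix vg assume "vg \<in> {(v, g). (v, g) \<in> sobolev_W1_0 p \<Omega> \<and> Lp_norm (leb \<Omega>) p g \<le> 1}"
  then obtain v g where vg: "vg = (v, g)" "(v, g) \<in> sobolev_W1_0 p \<Omega>" "Lp_norm (leb \<Omega>) p g \<le> 1"
    by (cases vg) auto
  have "\<bar>LINT x|leb \<Omega>. f x * v x\<bar> \<le> M * Lp_norm (leb \<Omega>) p g" by (rule assms(2)[OF vg(2)])
  also have "\<dots> \<le> M" using mult_left_mono[OF vg(3) M] by simp
  finally show "(case vg of (v, g) \<Rightarrow> \<bar>LINT x|leb \<Omega>. f x * v x\<bar>) \<le> M" by (simp add: vg(1))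
qed

text \<open>A supremum of reals bounds its elements only for a set bounded above, so the pairing
  inequality and the nonnegativity of \<open>dual_norm\<close> carry an a priori bound
  \<open>B\<close>, supplied later by Poincare's inequality or by a direct pairing. The sign of
  \<open>B\<close> is left open, hence the absolute value.\<close>

lemma dual_norm_bdd_above:
  assumes B: "\<And>v g. (v, g) \<in> sobolev_W1_0 p \<Omega> \<Longrightarrow> \<bar>LINT x|leb \<Omega>. f x * v x\<bar> \<le> B * Lp_norm (leb \<Omega>) p g"
  shows "bdd_above ((\<lambda>(v, g). \<bar>LINT x|leb \<Omega>. f x * v x\<bar>) `
    {(v, g). (v, g) \<in> sobolev_W1_0 p \<Omega> \<and> Lp_norm (leb \<Omega>) p g \<le> 1})"
proof (rule bdd_aboveI2[of _ _ "\<bar>B\<bar>"])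
  fix vg assume "vg \<in> {(v, g). (v, g) \<in> sobolev_W1_0 p \<Omega> \<and> Lp_norm (leb \<Omega>) p g \<le> 1}"
  then obtain v g where vg: "vg = (v, g)" "(v, g) \<in> sobolev_W1_0 p \<Omega>" "Lp_norm (leb \<Omega>) p g \<le> 1"
    by (cases vg) auto
  have "\<bar>LINT x|leb \<Omega>. f x * v x\<bar> \<le> B * Lp_norm (leb \<Omega>) p g" by (rule B[OF vg(2)])
  also have "\<dots> \<le> \<bar>B\<bar> * Lp_norm (leb \<Omega>) p g" by (rule mult_right_mono) (auto simp: Lp_norm_nonneg)
  also have "\<dots> \<le> \<bar>B\<bar>" using mult_left_mono[OF vg(3), of "\<bar>B\<bar>"] by simp
  finally show "(case vg of (v, g) \<Rightarrow> \<bar>LINT x|leb \<Omega>. f x * v x\<bar>) \<le> \<bar>B\<bar>" by (simp add: vg(1))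
qed

lemma dual_norm_pairing:
  assumes p: "1 < p"
    and B: "\<And>v g. (v, g) \<in> sobolev_W1_0 p \<Omega> \<Longrightarrow> \<bar>LINT x|leb \<Omega>. f x * v x\<bar> \<le> B * Lp_norm (leb \<Omega>) p g"
    and vg: "(v, g) \<in> sobolev_W1_0 p \<Omega>"
  shows "\<bar>LINT x|leb \<Omega>. f x * v x\<bar> \<le> dual_norm p \<Omega> f * Lp_norm (leb \<Omega>) p g"
\<comment> \<open>With gradient norm 0 the pair cannot be normalised, but then the a priori bound
  already gives 0.\<close>
proof (cases "Lp_norm (leb \<Omega>) p g = 0")
  case True
  then show ?thesis using B[OF vg] by simp
next
  case False
  define N where "N = Lp_norm (leb \<Omega>) p g"
  have N: "N > 0" using False Lp_norm_nonneg[of "leb \<Omega>" p g] by (simp add: N_def)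
  let ?S = "{(v, g). (v, g) \<in> sobolev_W1_0 p \<Omega> \<and> Lp_norm (leb \<Omega>) p g \<le> 1}"
  note bdd = dual_norm_bdd_above[OF B]
  have "((\<lambda>x. (1 / N) * v x), (\<lambda>x. (1 / N) *\<^sub>R g x)) \<in> ?S"
    using sobolev_W1_0_scale[OF vg p, of "1 / N"] Lp_norm_scale[of p "leb \<Omega>" "1 / N" g] p N
    by (simp add: N_def)
  from cSUP_upper[OF this bdd]
  have "\<bar>LINT x|leb \<Omega>. f x * (v x / N)\<bar> \<le> dual_norm p \<Omega> f" by (simp add: dual_norm_def)
  also have "(LINT x|leb \<Omega>. f x * (v x / N)) = (LINT x|leb \<Omega>. f x * v x) / N" by simp
  finally show ?thesis using N by (simp add: N_def pos_divide_le_eq)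
qed

lemma dual_norm_nonneg:
  assumes p: "1 < p"
    and B: "\<And>v g. (v, g) \<in> sobolev_W1_0 p \<Omega> \<Longrightarrow> \<bar>LINT x|leb \<Omega>. f x * v x\<bar> \<le> B * Lp_norm (leb \<Omega>) p g"
  shows "0 \<le> dual_norm p \<Omega> f"
proof -
  let ?S = "{(v, g). (v, g) \<in> sobolev_W1_0 p \<Omega> \<and> Lp_norm (leb \<Omega>) p g \<le> 1}"
  note bdd = dual_norm_bdd_above[OF B]
  have "((\<lambda>x. 0), (\<lambda>x. 0)) \<in> ?S" using zero_in_sobolev_W1_0[OF p, of \<Omega>] p by simp
  from cSUP_upper[OF this bdd] show ?thesis by (simp add: dual_norm_def)
qed

section \<open>Parabolic cylinders and Hausdorff content\<close>

lemma mem_pcyl: "(y, s) \<in> pcyl p (x, t) r \<longleftrightarrow> dist x y < r \<and> \<bar>s - t\<bar> < r powr p"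
  by (auto simp: pcyl_def abs_less_iff)

lemma open_pcyl: "open (pcyl p z r)"
  by (auto simp: pcyl_def split: prod.split intro: open_Times)

lemma center_in_pcyl: "0 < r \<Longrightarrow> z \<in> pcyl p z r"
  by (cases z) (simp add: mem_pcyl)

lemma pcyl_mono: "0 \<le> p \<Longrightarrow> 0 < r \<Longrightarrow> r \<le> \<rho> \<Longrightarrow> pcyl p z r \<subseteq> pcyl p z \<rho>"
  using powr_mono2[of p r \<rho>] by (cases z) (auto simp: pcyl_def)

text \<open>In space this is the usual factor 3. In time three half-lengths
  \<open>\<rho> powr p\<close> must fit into \<open>(3 * \<rho>) powr p\<close>, which holds because
  3 <= \<open>3 powr p\<close> for p >= 1.\<close>

lemma pcyl_engulf:
  assumes p: "1 \<le> p" and r: "0 < r" "r \<le> \<rho>" and ne: "pcyl p z r \<inter> pcyl p z' \<rho> \<noteq> {}"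
  shows "pcyl p z r \<subseteq> pcyl p z' (3 * \<rho>)"
proof
  fix w assume w: "w \<in> pcyl p z r"
  obtain x t x' t' y s where z: "z = (x, t)" "z' = (x', t')" "w = (y, s)" by (cases z, cases z', cases w) auto
  obtain u v where uv: "(u, v) \<in> pcyl p z r" "(u, v) \<in> pcyl p z' \<rho>" using ne by auto
  have rp: "r powr p \<le> \<rho> powr p" using p r by (intro powr_mono2) auto
  have "(3::real) powr 1 \<le> 3 powr p" using p by (intro powr_mono) auto
  then have "3 * \<rho> powr p \<le> 3 powr p * \<rho> powr p" by (intro mult_right_mono) auto
  then have 3: "3 * \<rho> powr p \<le> (3 * \<rho>) powr p" using r by (simp add: powr_mult)
  have "dist x' y \<le> dist x' u + dist x u + dist x y"
    using dist_triangle[of x' y u] dist_triangle[of u y x] by (simp add: dist_commute)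
  also have "\<dots> < 3 * \<rho>" using w uv r by (simp add: z mem_pcyl)
  finally have "dist x' y < 3 * \<rho>" .
  moreover have "\<bar>s - t'\<bar> < (3 * \<rho>) powr p"
    using w uv rp 3 unfolding z mem_pcyl by linarith
  ultimately show "w \<in> pcyl p z' (3 * \<rho>)" by (simp add: z mem_pcyl)
qed

text \<open>Greedy selection: take a cylinder of largest radius, discard all that meet it, and
  continue with the rest. The conclusion is left as an intersection with a larger member, so that
  each application can choose its own enlargement. Cylinders of radius at most 0 are empty, meet
  nothing, and are exempt.\<close>

lemma Vitali_pcyl:
  fixes z :: "'i \<Rightarrow> 'a::euclidean_space \<times> real"
  assumes "finite I"
  obtains J where "J \<subseteq> I" "disjoint_family_on (\<lambda>j. pcyl p (z j) (r j)) J"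
    "\<And>i. i \<in> I \<Longrightarrow> 0 < r i \<Longrightarrow> \<exists>j\<in>J. r i \<le> r j \<and> pcyl p (z i) (r i) \<inter> pcyl p (z j) (r j) \<noteq> {}"
proof -
  let ?Q = "\<lambda>i. pcyl p (z i) (r i)"
  have "\<exists>J\<subseteq>I. disjoint_family_on ?Q J \<and>
      (\<forall>i\<in>I. 0 < r i \<longrightarrow> (\<exists>j\<in>J. r i \<le> r j \<and> ?Q i \<inter> ?Q j \<noteq> {}))"
    using assms
  proof (induction "card I" arbitrary: I rule: less_induct)
    case less
    show ?case
    proof (cases "I = {}")
      case False
      obtain i0 where i0: "i0 \<in> I" "\<And>i. i \<in> I \<Longrightarrow> r i \<le> r i0"
        using less.prems False Max_in[of "r ` I"] Max_ge[of "r ` I"] by (metis (no_types, lifting) finite_imageI image_iff image_is_empty imageI)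
      define I' where "I' = {i \<in> I - {i0}. ?Q i \<inter> ?Q i0 = {}}"
      have "card I' < card I" using less.prems i0(1) by (intro psubset_card_mono) (auto simp: I'_def)
      then obtain J' where J': "J' \<subseteq> I'" "disjoint_family_on ?Q J'"
        "\<forall>i\<in>I'. 0 < r i \<longrightarrow> (\<exists>j\<in>J'. r i \<le> r j \<and> ?Q i \<inter> ?Q j \<noteq> {})"
        using less.hyps[of I'] less.prems by (auto simp: I'_def)
      have "disjoint_family_on ?Q (insert i0 J')"
        using J'(1,2) unfolding disjoint_family_on_def I'_def by blast
      moreover have "\<exists>j\<in>insert i0 J'. r i \<le> r j \<and> ?Q i \<inter> ?Q j \<noteq> {}" if "i \<in> I" "0 < r i" for i
      proof (cases "i \<in> I'")
        case True
        then show ?thesis using J'(3) that by blast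
      next
        case False
        then have "?Q i \<inter> ?Q i0 \<noteq> {}"
          using that center_in_pcyl[of "r i" "z i" p] by (auto simp: I'_def)
        then show ?thesis using i0(2) that by blast
      qed
      moreover have "insert i0 J' \<subseteq> I" using J'(1) i0(1) by (auto simp: I'_def)
      ultimately show ?thesis by blast
    qed (auto simp: disjoint_family_on_def)
  qed
  then show ?thesis using that by blast
qed

lemma hausdorff_content_antimono:
  "\<delta> \<le> \<delta>' \<Longrightarrow> hausdorff_content p s \<delta>' E \<le> hausdorff_content p s \<delta> E"
  unfolding hausdorff_content_def
  by (rule INF_superset_mono) (auto intro: less_le_trans)

text \<open>The content is antitone in \<delta>, so its limit at 0 from the right exists and is the
  supremum; a vanishing measure therefore makes every content with \<delta> > 0 vanish.\<close>

lemma hausdorff_measure_eq_SUP: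
  "hausdorff_measure p s E = (SUP \<delta>\<in>{0<..}. hausdorff_content p s \<delta> E)"
  unfolding hausdorff_measure_def
proof (rule tendsto_Lim)
  show "((\<lambda>\<delta>. hausdorff_content p s \<delta> E) \<longlongrightarrow> (SUP \<delta>\<in>{0<..}. hausdorff_content p s \<delta> E)) (at_right 0)"
  proof (rule order_tendstoI)
    fix a assume "a < (SUP \<delta>\<in>{0<..}. hausdorff_content p s \<delta> E)"
    then obtain \<delta> where \<delta>: "\<delta> > 0" "a < hausdorff_content p s \<delta> E" by (auto simp: less_SUP_iff)
    have "a < hausdorff_content p s \<delta>' E" if "\<delta>' < \<delta>" for \<delta>'
      using \<delta>(2) hausdorff_content_antimono[of \<delta>' \<delta> p s E] that by (meson less_imp_le less_le_trans)
    then show "eventually (\<lambda>\<delta>. a < hausdorff_content p s \<delta> E) (at_right 0)"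
      using \<delta>(1) by (auto simp: eventually_at_right_field)
  next
    fix a assume a: "(SUP \<delta>\<in>{0<..}. hausdorff_content p s \<delta> E) < a"
    have "hausdorff_content p s \<delta> E < a" if "\<delta> > 0" for \<delta>
      using SUP_upper[of \<delta> "{0<..}" "\<lambda>\<delta>. hausdorff_content p s \<delta> E"] that a by (auto intro: le_less_trans)
    then show "eventually (\<lambda>\<delta>. hausdorff_content p s \<delta> E < a) (at_right 0)"
      by (auto simp: eventually_at_right_field intro: exI[of _ 1])
  qed
qed simp

lemma hausdorff_measure_zero_cover:
  fixes E :: "('a::euclidean_space \<times> real) set"
  assumes H: "hausdorff_measure p s E = 0" and "0 < \<delta>" "0 < \<eta>"
  obtains z r where "E \<subseteq> (\<Union>i::nat. pcyl p (z i) (r i))" "\<And>i. 0 < r i \<and> r i < \<delta>"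
    "(\<Sum>i. ennreal (r i powr s)) < ennreal \<eta>"
proof -
  have "hausdorff_content p s \<delta> E = 0"
    using H SUP_upper[of \<delta> "{0<..}" "\<lambda>\<delta>. hausdorff_content p s \<delta> E"] \<open>0 < \<delta>\<close>
    by (simp add: hausdorff_measure_eq_SUP)
  then have "hausdorff_content p s \<delta> E < ennreal \<eta>" using \<open>0 < \<eta>\<close> by simp
  then show ?thesis unfolding hausdorff_content_def INF_less_iff using that by auto
qed

text \<open>Positivity of the measure, defined through fine coverings, yields a lower bound for
  coverings of any size, since a sum below \<open>\<delta> powr s\<close> already forces every
  radius below \<delta>. Arbitrarily cheap finite coverings would thus be arbitrarily fine, and all
  contents would vanish.\<close>

lemma hausdorff_measure_nonzero_finite_covers:
  fixes E :: "('a::euclidean_space \<times> real) set"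
  assumes H: "hausdorff_measure p s E \<noteq> 0" and s: "0 < s"
  obtains K where "0 < K" "\<And>F. finite F \<Longrightarrow> (\<And>z r. (z, r) \<in> F \<Longrightarrow> 0 < r) \<Longrightarrow>
    E \<subseteq> (\<Union>(z, r)\<in>F. pcyl p z r) \<Longrightarrow> K \<le> (\<Sum>(z, r)\<in>F. r powr s)"
proof (rule ccontr)
  assume no: "\<not> thesis"
  note K = that
  have neg: "\<exists>F. finite F \<and> (\<forall>(z, r)\<in>F. 0 < r) \<and> E \<subseteq> (\<Union>(z, r)\<in>F. pcyl p z r) \<and>
      (\<Sum>(z, r)\<in>F. r powr s) < K" if "K > 0" for K
  proof (rule ccontr)
    assume "\<not> ?thesis"
    then have "K \<le> (\<Sum>(z, r)\<in>F. r powr s)"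
      if "finite F" "\<And>z r. (z, r) \<in> F \<Longrightarrow> 0 < r" "E \<subseteq> (\<Union>(z, r)\<in>F. pcyl p z r)" for F
      using that by (metis (no_types, lifting) case_prodI2 not_le)
    then show False using K[OF \<open>K > 0\<close>] no by blast
  qed
  have "hausdorff_content p s \<delta> E \<le> ennreal \<eta>" if \<delta>: "\<delta> > 0" and \<eta>: "\<eta> > 0" for \<delta> \<eta>
  proof -
    obtain F where F: "finite F" "\<forall>(z, r)\<in>F. 0 < r" "E \<subseteq> (\<Union>(z, r)\<in>F. pcyl p z r)"
      "(\<Sum>(z, r)\<in>F. r powr s) < min (\<eta> / 2) (\<delta> powr s)"
      using neg[of "min (\<eta> / 2) (\<delta> powr s)"] \<delta> \<eta> by auto
    have small: "r < \<delta>" if "(z, r) \<in> F" for z r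
    proof -
      have "r powr s \<le> (\<Sum>(z, r)\<in>F. r powr s)"
        using member_le_sum[OF that, of "\<lambda>(z, r). r powr s"] F(1) by force
      then have "r powr s < \<delta> powr s" using F(4) by simp
      then show ?thesis using s \<delta> powr_mono2[of s \<delta> r] by (meson le_less_trans less_imp_le not_le)
    qed
    obtain f where f: "bij_betw f {..<card F} F"
      using ex_bij_betw_nat_finite[OF F(1)] by (auto simp: atLeast0LessThan)
    \<comment> \<open>A covering in the definition is an infinite sequence with positive radii, so
      the finite one is padded by cylinders of weight at most \<open>b i\<close>; these bounds add
      up to \<eta>/2.\<close>
    define b where "b i = \<eta> / 2 * (1 / 2) ^ Suc i" for i
    have b: "b i > 0" for i using \<eta> by (simp add: b_def)
    define z where "z i = (if i < card F then fst (f i) else undefined)" for i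
    define r where "r i = (if i < card F then snd (f i) else min (\<delta> / 2) (b i powr (1 / s)))" for i
    have inF: "(z i, r i) \<in> F" if "i < card F" for i
      using f that by (auto simp: z_def r_def bij_betw_def)
    have r: "0 < r i \<and> r i < \<delta>" for i
    proof (cases "i < card F")
      case True
      then show ?thesis using inF[OF True] F(2) small by auto
    qed (use b[of i] \<delta> in \<open>auto simp: r_def min_def\<close>)
    have "E \<subseteq> (\<Union>i. pcyl p (z i) (r i))"
    proof
      fix w assume "w \<in> E"
      then obtain c where c: "c \<in> F" "w \<in> pcyl p (fst c) (snd c)" using F(3) by auto
      obtain i where "i < card F" "f i = c"
        using c(1) bij_betw_imp_surj_on[OF f] by (metis imageE lessThan_iff)
      then have "w \<in> pcyl p (z i) (r i)" using c(2) by (simp add: z_def r_def)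
      then show "w \<in> (\<Union>i. pcyl p (z i) (r i))" by blast
    qed
    then have "hausdorff_content p s \<delta> E \<le> (\<Sum>i. ennreal (r i powr s))"
      unfolding hausdorff_content_def using r by (intro INF_lower2[of "(z, r)"]) auto
    also have "\<dots> \<le> (\<Sum>i. ennreal (if i < card F then r i powr s else 0) + ennreal (b i))"
    proof (intro suminf_le summableI)
      fix i
      have "r i powr s \<le> b i" if "\<not> i < card F"
      proof -
        have "r i powr s \<le> (b i powr (1 / s)) powr s"
          using r[of i] s that by (intro powr_mono2) (auto simp: r_def)
        then show ?thesis using b[of i] s by (simp add: powr_powr)
      qed
      then show "ennreal (r i powr s) \<le> ennreal (if i < card F then r i powr s else 0) + ennreal (b i)"
        by (auto simp: ennreal_leI)
    qed
    also have "\<dots> = (\<Sum>i. ennreal (if i < card F then r i powr s else 0)) + (\<Sum>i. ennreal (b i))"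
      by (rule suminf_add[symmetric]) auto
    also have "(\<Sum>i. ennreal (if i < card F then r i powr s else 0)) = (\<Sum>i<card F. ennreal (if i < card F then r i powr s else 0))"
      by (rule suminf_finite) auto
    also have "\<dots> = ennreal (\<Sum>i<card F. r i powr s)"
      by (subst sum_ennreal[symmetric]) auto
    also have "(\<Sum>i<card F. r i powr s) = (\<Sum>c\<in>F. snd c powr s)"
      using sum.reindex_bij_betw[OF f, of "\<lambda>c. snd c powr s"] by (simp add: r_def)
    also have "(\<Sum>i. ennreal (b i)) = ennreal (\<eta> / 2)"
    proof (rule suminf_ennreal_eq)
      show "b sums (\<eta> / 2)" unfolding b_def using sums_mult[OF power_half_series, of "\<eta> / 2"] by simp
    qed (use b in \<open>auto intro: less_imp_le\<close>)
    also have "ennreal (\<Sum>c\<in>F. snd c powr s) + ennreal (\<eta> / 2) \<le> ennreal \<eta>"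
    proof -
      have "(\<Sum>c\<in>F. snd c powr s) \<le> \<eta> / 2" using F(4) by (simp add: case_prod_unfold)
      moreover have "0 \<le> (\<Sum>c\<in>F. snd c powr s)" by (intro sum_nonneg) simp
      ultimately have "ennreal ((\<Sum>c\<in>F. snd c powr s) + \<eta> / 2) \<le> ennreal \<eta>" by (intro ennreal_leI) simp
      then show ?thesis using \<eta> \<open>0 \<le> (\<Sum>c\<in>F. snd c powr s)\<close> by (simp add: ennreal_plus)
    qed
    finally show ?thesis .
  qed
  then have "hausdorff_content p s \<delta> E = 0" if "\<delta> > 0" for \<delta>
  proof -
    have "hausdorff_content p s \<delta> E \<le> 0" by (rule ennreal_le_epsilon) (use that \<open>\<And>\<delta> \<eta>. \<lbrakk>0 < \<delta>; 0 < \<eta>\<rbrakk> \<Longrightarrow> hausdorff_content p s \<delta> E \<le> ennreal \<eta>\<close> in simp)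
    then show ?thesis by simp
  qed
  then show False using H by (simp add: hausdorff_measure_eq_SUP)
qed

section \<open>A discrete Frostman lemma\<close>

text \<open>
  Points receive their masses one after the other, each as much as the capacity constraints
  still permit; a constraint that is tight remains tight later on.
\<close>

lemma greedy_masses:
  fixes S :: "'c \<Rightarrow> 'b set" and \<kappa> :: "'c \<Rightarrow> real"
  assumes "finite P" and C: "finite C" and \<kappa>: "\<And>c. c \<in> C \<Longrightarrow> 0 \<le> \<kappa> c"
    and "\<And>a. a \<in> P \<Longrightarrow> \<exists>c\<in>C. a \<in> S c"
  shows "\<exists>m. (\<forall>a. 0 \<le> m a) \<and> (\<forall>c\<in>C. sum m (P \<inter> S c) \<le> \<kappa> c) \<and>
    (\<forall>a\<in>P. \<exists>c\<in>C. a \<in> S c \<and> sum m (P \<inter> S c) = \<kappa> c)"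
  using assms(1,4)
proof (induction P rule: finite_induct)
  case empty
  then show ?case using \<kappa> by (intro exI[of _ "\<lambda>_. 0"]) auto
next
  case (insert a P)
  obtain m where m: "\<And>a. 0 \<le> m a" "\<And>c. c \<in> C \<Longrightarrow> sum m (P \<inter> S c) \<le> \<kappa> c"
    "\<And>a. a \<in> P \<Longrightarrow> \<exists>c\<in>C. a \<in> S c \<and> sum m (P \<inter> S c) = \<kappa> c"
  proof -
    have "\<exists>m. (\<forall>a. 0 \<le> m a) \<and> (\<forall>c\<in>C. sum m (P \<inter> S c) \<le> \<kappa> c) \<and>
        (\<forall>a\<in>P. \<exists>c\<in>C. a \<in> S c \<and> sum m (P \<inter> S c) = \<kappa> c)"
      by (rule insert.IH) (use insert.prems in blast)
    then show ?thesis using that by blast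
  qed
  define Ca where "Ca = {c \<in> C. a \<in> S c}"
  have Ca: "finite Ca" "Ca \<noteq> {}" using C insert.prems by (auto simp: Ca_def)
  define v where "v = Min ((\<lambda>c. \<kappa> c - sum m (P \<inter> S c)) ` Ca)"
  have v_le: "v \<le> \<kappa> c - sum m (P \<inter> S c)" if "c \<in> Ca" for c
    unfolding v_def using Ca that by (intro Min_le) auto
  obtain c0 where c0: "c0 \<in> Ca" "v = \<kappa> c0 - sum m (P \<inter> S c0)"
    using Min_in[of "(\<lambda>c. \<kappa> c - sum m (P \<inter> S c)) ` Ca"] Ca that unfolding v_def by blast
  have v0: "0 \<le> v" using c0 m(2)[of c0] by (simp add: Ca_def)
  define m' where "m' = m(a := v)"
  have s: "sum m' (insert a P \<inter> S c) = (if a \<in> S c then v else 0) + sum m (P \<inter> S c)" for c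
  proof -
    have "sum m' (P \<inter> S c) = sum m (P \<inter> S c)"
      using insert.hyps by (intro sum.cong) (auto simp: m'_def)
    then show ?thesis using insert.hyps by (simp add: m'_def)
  qed
  have "sum m' (insert a P \<inter> S c) \<le> \<kappa> c" if "c \<in> C" for c
    using m(2)[OF that] v_le[of c] that by (auto simp: s Ca_def)
  moreover have "\<exists>c\<in>C. b \<in> S c \<and> sum m' (insert a P \<inter> S c) = \<kappa> c" if b: "b \<in> insert a P" for b
  proof (cases "b = a")
    case True
    then show ?thesis using c0 by (auto simp: s Ca_def intro!: bexI[of _ c0])
  next
    case False
    then obtain c where c: "c \<in> C" "b \<in> S c" "sum m (P \<inter> S c) = \<kappa> c" using m(3) b by blast
    have "v = 0" if "a \<in> S c" using v_le[of c] v0 c that by (simp add: Ca_def)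
    then show ?thesis using c by (auto simp: s intro!: bexI[of _ c])
  qed
  moreover have "0 \<le> m' b" for b using m(1) v0 by (simp add: m'_def)
  ultimately show ?case by blast
qed

text \<open>Masses are placed on a finite net of E under dyadic capacity constraints at cylinders
  centred on the net. As each net point lies in a tight cylinder, a disjoint Vitali selection of
  tight ones, enlarged 9 times, covers E; disjointness adds up their capacities, and
  \<open>K\<close> bounds the total mass from below. The final constant is 54 = 6 * 9: the factor 6
  comes from replacing an arbitrary cylinder by a dyadic one centred on the net, the factor 9 from
  normalising the mass.\<close>

lemma discrete_frostman:
  fixes E :: "('a::euclidean_space \<times> real) set"
  assumes p: "1 \<le> p" and s: "0 < s" and E: "compact E"
    and K: "0 < K" "\<And>F. finite F \<Longrightarrow> (\<And>z r. (z, r) \<in> F \<Longrightarrow> 0 < r) \<Longrightarrow>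
      E \<subseteq> (\<Union>(z, r)\<in>F. pcyl p z r) \<Longrightarrow> K \<le> (\<Sum>(z, r)\<in>F. r powr s)"
  obtains P m where "finite P" "P \<subseteq> E" "\<And>a. 0 \<le> m a" "sum m P = 1"
    "\<And>z r. (1 / 2) ^ j \<le> r \<Longrightarrow> r \<le> 1 / 3 \<Longrightarrow> sum m (P \<inter> pcyl p z r) \<le> 54 powr s / K * r powr s"
proof -
  define \<epsilon> where "\<epsilon> = (1 / 2 :: real) ^ j"
  have \<epsilon>: "\<epsilon> > 0" by (simp add: \<epsilon>_def)
  obtain P where P: "P \<subseteq> E" "finite P" "E \<subseteq> (\<Union>a\<in>P. pcyl p a \<epsilon>)"
    using compactE_image[OF E, of E "\<lambda>a. pcyl p a \<epsilon>"] open_pcyl center_in_pcyl[OF \<epsilon>] by (metis UN_I subsetI)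
  define C where "C = P \<times> {..j}"
  define S where "S = (\<lambda>(a :: 'a \<times> real, i). pcyl p a ((1 / 2 :: real) ^ i))"
  define \<kappa> where "\<kappa> = (\<lambda>(a :: 'a \<times> real, i). ((1 / 2 :: real) ^ i) powr s)"
  have "\<exists>c\<in>C. a \<in> S c" if "a \<in> P" for a
    using that center_in_pcyl[of 1 a p] unfolding C_def S_def
    by (intro bexI[of _ "(a, 0)"]) auto
  then obtain m where m: "\<And>a. 0 \<le> m a" "\<And>c. c \<in> C \<Longrightarrow> sum m (P \<inter> S c) \<le> \<kappa> c"
    "\<And>a. a \<in> P \<Longrightarrow> \<exists>c\<in>C. a \<in> S c \<and> sum m (P \<inter> S c) = \<kappa> c"
  proof -
    have "\<exists>m. (\<forall>a. 0 \<le> m a) \<and> (\<forall>c\<in>C. sum m (P \<inter> S c) \<le> \<kappa> c) \<and>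
        (\<forall>a\<in>P. \<exists>c\<in>C. a \<in> S c \<and> sum m (P \<inter> S c) = \<kappa> c)"
      by (rule greedy_masses) (use P(2) \<open>\<And>a. a \<in> P \<Longrightarrow> \<exists>c\<in>C. a \<in> S c\<close> in \<open>auto simp: C_def \<kappa>_def\<close>)
    then show ?thesis using that by blast
  qed
  define tight where "tight = {c \<in> C. sum m (P \<inter> S c) = \<kappa> c}"
  have ft: "finite tight" using P(2) by (simp add: tight_def C_def)
  let ?r = "\<lambda>c. (1 / 2 :: real) ^ snd c"
  obtain J where J: "J \<subseteq> tight" "disjoint_family_on (\<lambda>c. pcyl p (fst c) (?r c)) J"
    "\<And>c. c \<in> tight \<Longrightarrow> 0 < ?r c \<Longrightarrow> \<exists>d\<in>J. ?r c \<le> ?r d \<and> pcyl p (fst c) (?r c) \<inter> pcyl p (fst d) (?r d) \<noteq> {}"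
    using Vitali_pcyl[OF ft, of p fst ?r] by blast
  have S: "S c = pcyl p (fst c) (?r c)" for c by (simp add: S_def case_prod_unfold)
  have fJ: "finite J" using J(1) ft finite_subset by blast
  \<comment> \<open>One factor 3 swallows the net cylinder of a point into an enlarged tight
    cylinder, another swallows that one into an enlarged selected cylinder.\<close>
  define F where "F = (\<lambda>c. (fst c, 9 * ?r c)) ` J"
  have "E \<subseteq> (\<Union>(z, r)\<in>F. pcyl p z r)"
  proof
    fix w assume "w \<in> E"
    then obtain a where a: "a \<in> P" "w \<in> pcyl p a \<epsilon>" using P(3) by auto
    obtain c where c: "c \<in> tight" "a \<in> S c" using m(3)[OF a(1)] by (auto simp: tight_def)
    obtain d where d: "d \<in> J" "?r c \<le> ?r d" "S c \<inter> S d \<noteq> {}" using J(3)[OF c(1)] by (auto simp: S)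
    have "\<epsilon> \<le> ?r c" using c(1) unfolding \<epsilon>_def tight_def C_def by (intro power_decreasing) auto
    moreover have "a \<in> pcyl p a \<epsilon> \<inter> pcyl p (fst c) (?r c)"
      using c(2) center_in_pcyl[OF \<epsilon>, of a p] unfolding S by blast
    ultimately have "pcyl p a \<epsilon> \<subseteq> pcyl p (fst c) (3 * ?r c)"
      using pcyl_engulf[OF p \<epsilon>, of "?r c" a "fst c"] by blast
    moreover have "pcyl p (fst c) (3 * ?r c) \<subseteq> pcyl p (fst d) (3 * (3 * ?r d))"
    proof (rule pcyl_engulf[OF p])
      have "S c \<subseteq> pcyl p (fst c) (3 * ?r c)" "S d \<subseteq> pcyl p (fst d) (3 * ?r d)"
        unfolding S by (rule pcyl_mono; use p in simp)+
      then show "pcyl p (fst c) (3 * ?r c) \<inter> pcyl p (fst d) (3 * ?r d) \<noteq> {}" using d(3) by blast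
    qed (use d(2) in auto)
    ultimately have "w \<in> pcyl p (fst d) (9 * ?r d)" using a(2) by auto
    then show "w \<in> (\<Union>(z, r)\<in>F. pcyl p z r)" using d(1) by (auto simp: F_def)
  qed
  then have "K \<le> (\<Sum>(z, r)\<in>F. r powr s)"
    using fJ by (intro K(2)) (auto simp: F_def)
  also have "\<dots> \<le> (\<Sum>c\<in>J. (9 * ?r c) powr s)"
    unfolding F_def using sum_image_le[of J "\<lambda>(z, r). r powr s" "\<lambda>c. (fst c, 9 * ?r c)"] fJ by (simp add: o_def)
  also have "\<dots> = 9 powr s * (\<Sum>c\<in>J. \<kappa> c)"
    unfolding sum_distrib_left by (intro sum.cong refl) (auto simp: \<kappa>_def powr_mult split: prod.split)
  also have "(\<Sum>c\<in>J. \<kappa> c) = (\<Sum>c\<in>J. sum m (P \<inter> S c))"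
    using J(1) by (intro sum.cong refl) (auto simp: tight_def)
  also have "\<dots> = sum m (\<Union>c\<in>J. P \<inter> S c)"
  proof (rule sum.UNION_disjoint[symmetric])
    show "\<forall>c\<in>J. \<forall>d\<in>J. c \<noteq> d \<longrightarrow> P \<inter> S c \<inter> (P \<inter> S d) = {}"
      using J(2) unfolding disjoint_family_on_def S by blast
  qed (use P(2) fJ in auto)
  also have "\<dots> \<le> sum m P"
    using P(2) m(1) by (intro sum_mono2) auto
  finally have total: "K \<le> 9 powr s * sum m P" by simp
  define M where "M = sum m P"
  have M: "M \<ge> K / 9 powr s" "M > 0"
  proof -
    show "M \<ge> K / 9 powr s" using total by (simp add: M_def divide_le_eq mult.commute)
    moreover have "0 < K / 9 powr s" using K(1) by simp
    ultimately show "M > 0" by linarith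
  qed
  have local_bound: "sum m (P \<inter> pcyl p z r) \<le> (6 * r) powr s" if r: "(1 / 2) ^ j \<le> r" "r \<le> 1 / 3" for z r
  proof (cases "P \<inter> pcyl p z r = {}")
    case False
    then obtain a where a: "a \<in> P" "a \<in> pcyl p z r" by auto
    have r0: "r > 0" using r(1) \<epsilon> unfolding \<epsilon>_def by linarith
    have "\<exists>i. (1 / 2) ^ i < 3 * r" using real_arch_pow_inv[of "3 * r" "1 / 2"] r0 by auto
    \<comment> \<open>The predecessor k of this least index satisfies 3 r <= (1/2)^k <= 6 r. It
      exists because r <= 1/3 excludes the index 0, and r >= (1/2)^j puts k within the constrained
      levels.\<close>
    define i where "i = (LEAST i. (1 / 2) ^ i < 3 * r)"
    have i: "(1 / 2) ^ i < 3 * r" unfolding i_def by (rule LeastI_ex) fact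
    have "i \<noteq> 0" using i r(2) by (intro notI) simp
    then obtain k where k: "i = Suc k" using not0_implies_Suc by blast
    have k1: "3 * r \<le> (1 / 2) ^ k" using not_less_Least[of k "\<lambda>i. (1 / 2) ^ i < 3 * r"] k by (simp add: i_def)
    have k2: "(1 / 2) ^ k \<le> 6 * r" using i by (simp add: k)
    have "k \<le> j"
    proof (rule ccontr)
      assume "\<not> k \<le> j"
      then have "(1 / 2 :: real) ^ k \<le> (1 / 2) ^ j" by (intro power_decreasing) auto
      then show False using k1 r(1) r0 by linarith
    qed
    have "pcyl p z r \<subseteq> pcyl p a (3 * r)"
      using a(2) center_in_pcyl[OF r0, of a p] by (intro pcyl_engulf[OF p r0 order_refl]) blast
    also have "\<dots> \<subseteq> pcyl p a ((1 / 2) ^ k)" using p r0 k1 by (intro pcyl_mono) auto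
    finally have "sum m (P \<inter> pcyl p z r) \<le> sum m (P \<inter> S (a, k))"
      using P(2) m(1) by (intro sum_mono2) (auto simp: S)
    also have "\<dots> \<le> \<kappa> (a, k)" using a(1) \<open>k \<le> j\<close> by (intro m(2)) (auto simp: C_def)
    also have "\<dots> \<le> (6 * r) powr s" using k2 s by (auto simp: \<kappa>_def intro!: powr_mono2)
    finally show ?thesis .
  qed simp
  have "sum (\<lambda>a. m a / M) (P \<inter> pcyl p z r) \<le> 54 powr s / K * r powr s"
    if r: "(1 / 2) ^ j \<le> r" "r \<le> 1 / 3" for z r
  proof -
    have r0: "r > 0" using r(1) \<epsilon> unfolding \<epsilon>_def by linarith
    have "sum (\<lambda>a. m a / M) (P \<inter> pcyl p z r) = sum m (P \<inter> pcyl p z r) / M" by (simp add: sum_divide_distrib)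
    also have "\<dots> \<le> (6 * r) powr s / M"
      using M(2) local_bound[OF r] by (intro divide_right_mono) auto
    also have "\<dots> \<le> (6 * r) powr s / (K / 9 powr s)"
      using M K(1) by (intro divide_left_mono mult_pos_pos) auto
    also have "\<dots> = 54 powr s / K * r powr s"
      using r0 powr_mult[of 6 9 s] by (simp add: powr_mult field_simps)
    finally show ?thesis .
  qed
  moreover have "sum (\<lambda>a. m a / M) P = 1" using M(2) by (simp add: M_def sum_divide_distrib[symmetric])
  ultimately show ?thesis using that[of P "\<lambda>a. m a / M"] P m(1) M(2) by auto
qed

section \<open>Weak limits of discrete measures on a compact set\<close>

text \<open>Base 4 leaves a gap: digit differences of modulus at most 1 after position k sum to at
  most a third of the leading term, so they cannot cancel it. In base 2 they could.\<close>

lemma suminf_quarter_digits_lower_bound: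
  fixes c :: "nat \<Rightarrow> real"
  assumes c: "\<And>i. \<bar>c i\<bar> \<le> 1" and z: "\<And>i. i < k \<Longrightarrow> c i = 0" and k: "\<bar>c k\<bar> = 1"
  shows "2 / 3 * (1 / 4) ^ k \<le> \<bar>\<Sum>i. c i * (1 / 4) ^ i\<bar>"
proof -
  have sm: "summable (\<lambda>i. c i * (1 / 4) ^ i)"
  proof (rule summable_comparison_test'[of "\<lambda>i. (1 / 4 :: real) ^ i"])
    show "norm (c i * (1 / 4) ^ i) \<le> (1 / 4) ^ i" for i
      using mult_right_mono[OF c[of i], of "(1 / 4) ^ i"] by (simp add: abs_mult)
  qed (simp add: summable_geometric)
  have "(\<Sum>i. c i * (1 / 4) ^ i) = (\<Sum>i. c (i + Suc k) * (1 / 4) ^ (i + Suc k)) + (\<Sum>i<Suc k. c i * (1 / 4) ^ i)"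
    by (rule suminf_split_initial_segment[OF sm])
  also have "(\<Sum>i<Suc k. c i * (1 / 4) ^ i) = c k * (1 / 4) ^ k" using z by simp
  finally have eq: "(\<Sum>i. c i * (1 / 4) ^ i) = (\<Sum>i. c (i + Suc k) * (1 / 4) ^ (i + Suc k)) + c k * (1 / 4) ^ k" .
  have gs: "(\<lambda>i. (1 / 4 :: real) ^ (i + Suc k)) sums (1 / 3 * (1 / 4) ^ k)"
    using sums_mult2[OF geometric_sums[of "1 / 4 :: real"], of "(1 / 4) ^ Suc k"] by (simp add: power_add)
  have "norm (\<Sum>i. c (i + Suc k) * (1 / 4) ^ (i + Suc k)) \<le> (\<Sum>i. (1 / 4) ^ (i + Suc k))"
  proof (rule norm_suminf_le)
    show "norm (c (i + Suc k) * (1 / 4) ^ (i + Suc k)) \<le> (1 / 4) ^ (i + Suc k)" for i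
      using mult_right_mono[OF c[of "i + Suc k"], of "(1 / 4) ^ (i + Suc k)"] by (simp add: abs_mult)
  qed (use gs sums_summable in blast)
  also have "\<dots> = 1 / 3 * (1 / 4) ^ k" using gs by (simp add: sums_iff)
  finally have "\<bar>\<Sum>i. c (i + Suc k) * (1 / 4) ^ (i + Suc k)\<bar> \<le> 1 / 3 * (1 / 4) ^ k" by simp
  moreover have "\<bar>c k * (1 / 4) ^ k\<bar> = (1 / 4) ^ k" using k by (simp add: abs_mult)
  ultimately show ?thesis unfolding eq by linarith
qed

text \<open>
  Membership in the sets of a countable base, read as base-4 digits 0 and 1, embeds a compact set
  into the line with a uniformly continuous inverse.
\<close>

lemma compact_parametrization:
  fixes E :: "'a::euclidean_space set"
  assumes E: "compact E"
  obtains f :: "'a \<Rightarrow> real" and g :: "real \<Rightarrow> 'a" where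
    "\<And>a. f a \<in> {0..2}" "continuous_on UNIV g" "\<And>a. a \<in> E \<Longrightarrow> g (f a) = a"
proof -
  obtain B :: "'a set set" where B: "countable B" "topological_basis B"
    using ex_countable_basis by blast
  define U where "U = from_nat_into B"
  have Bne: "B \<noteq> {}" using B(2) topological_basisE[OF B(2) open_UNIV UNIV_I] by blast
  have U: "\<exists>k. U k = V" if "V \<in> B" for V
    using from_nat_into_surj[OF B(1) that] by (simp add: U_def)
  have Uopen: "open (U k)" for k
    using from_nat_into[OF Bne] topological_basis_open[OF B(2)] by (auto simp: U_def)
  define b :: "'a \<Rightarrow> nat \<Rightarrow> real" where "b a k = of_bool (a \<in> U k)" for a k
  define f where "f a = (\<Sum>k. b a k * (1 / 4) ^ k)" for a
  have sm: "summable (\<lambda>k. b a k * (1 / 4) ^ k)" for a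
    by (rule summable_comparison_test'[of "\<lambda>i. (1 / 4 :: real) ^ i"]) (auto simp: b_def summable_geometric)
  have f02: "f a \<in> {0..2}" for a
  proof -
    have "f a \<le> (\<Sum>k. (1 / 4) ^ k)"
      unfolding f_def by (intro suminf_le sm) (auto simp: b_def summable_geometric)
    also have "\<dots> = 4 / 3" using suminf_geometric[of "1 / 4 :: real"] by simp
    finally have "f a \<le> 2" by simp
    moreover have "0 \<le> f a" unfolding f_def by (intro suminf_nonneg sm) (auto simp: b_def)
    ultimately show ?thesis by simp
  qed
  have uc: "\<exists>\<delta>>0. \<forall>a\<in>E. \<forall>a'\<in>E. \<bar>f a - f a'\<bar> < \<delta> \<longrightarrow> dist a a' < \<epsilon>" if \<epsilon>: "\<epsilon> > 0" for \<epsilon>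
  proof -
    \<comment> \<open>Base sets whose points are pairwise closer than \<epsilon>: finitely many of
      them cover E, and two points of E whose codes agree on the finitely many indices involved lie
      in a common one.\<close>
    define I where "I = {k. \<forall>x\<in>U k. \<forall>y\<in>U k. dist x y < \<epsilon>}"
    have "E \<subseteq> (\<Union>k\<in>I. U k)"
    proof
      fix a assume "a \<in> E"
      obtain V where V: "V \<in> B" "a \<in> V" "V \<subseteq> ball a (\<epsilon> / 2)"
        using topological_basisE[OF B(2), of "ball a (\<epsilon> / 2)" a] \<epsilon> by auto
      obtain k where k: "U k = V" using U[OF V(1)] by blast
      have "dist x y < \<epsilon>" if "x \<in> V" "y \<in> V" for x y
      proof -
        have "dist a x < \<epsilon> / 2" "dist a y < \<epsilon> / 2" using V(3) that by auto
        then show ?thesis using dist_triangle[of x y a] by (simp add: dist_commute)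
      qed
      then have "k \<in> I" by (simp add: I_def k)
      then show "a \<in> (\<Union>k\<in>I. U k)" using V(2) k by blast
    qed
    then obtain I' where I': "I' \<subseteq> I" "finite I'" "E \<subseteq> (\<Union>k\<in>I'. U k)"
      using compactE_image[OF E, of I U] Uopen by metis
    define n where "n = Max (insert 0 I')"
    have n: "k \<le> n" if "k \<in> I'" for k using that I'(2) by (simp add: n_def)
    have "dist a a' < \<epsilon>" if a: "a \<in> E" "a' \<in> E" and fa: "\<bar>f a - f a'\<bar> < 2 / 3 * (1 / 4) ^ n" for a a'
    proof -
      have agree: "b a k = b a' k" if "k \<le> n" for k
      proof (rule ccontr)
        assume ne: "b a k \<noteq> b a' k"
        define l where "l = (LEAST k. b a k \<noteq> b a' k)"
        have l: "b a l \<noteq> b a' l" unfolding l_def by (rule LeastI) (rule ne)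
        have lk: "l \<le> k" unfolding l_def by (rule Least_le) (rule ne)
        have "f a - f a' = (\<Sum>i. b a i * (1 / 4) ^ i - b a' i * (1 / 4) ^ i)"
          unfolding f_def by (rule suminf_diff[OF sm sm])
        also have "\<dots> = (\<Sum>i. (b a i - b a' i) * (1 / 4) ^ i)" by (simp add: left_diff_distrib)
        finally have eq: "f a - f a' = (\<Sum>i. (b a i - b a' i) * (1 / 4) ^ i)" .
        have "2 / 3 * (1 / 4) ^ l \<le> \<bar>f a - f a'\<bar>"
          unfolding eq
        proof (rule suminf_quarter_digits_lower_bound)
          show "b a i - b a' i = 0" if "i < l" for i
            using not_less_Least[of i "\<lambda>k. b a k \<noteq> b a' k"] that by (simp add: l_def)
          show "\<bar>b a l - b a' l\<bar> = 1" using l by (auto simp: b_def)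
        qed (auto simp: b_def)
        moreover have "(1 / 4 :: real) ^ n \<le> (1 / 4) ^ l" using lk that by (intro power_decreasing) auto
        ultimately show False using fa by linarith
      qed
      obtain k where k: "k \<in> I'" "a \<in> U k" using I'(3) a(1) by blast
      then have "a' \<in> U k" using agree[OF n[OF k(1)]] by (simp add: b_def)
      then show ?thesis using k I'(1) by (auto simp: I_def)
    qed
    then show ?thesis by (intro exI[of _ "2 / 3 * (1 / 4) ^ n"]) auto
  qed
  have inj: "inj_on f E"
  proof (rule inj_onI, rule ccontr)
    fix a a' assume *: "a \<in> E" "a' \<in> E" "f a = f a'" "a \<noteq> a'"
    then show False using uc[of "dist a a'"] by force
  qed
  define h where "h = the_inv_into E f"
  have h: "h (f a) = a" if "a \<in> E" for a unfolding h_def by (rule the_inv_into_f_f[OF inj that])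
  have "uniformly_continuous_on (f ` E) h"
    unfolding uniformly_continuous_on_def
  proof (intro allI impI)
    fix \<epsilon> :: real assume "\<epsilon> > 0"
    then obtain \<delta> where "\<delta> > 0" "\<forall>a\<in>E. \<forall>a'\<in>E. \<bar>f a - f a'\<bar> < \<delta> \<longrightarrow> dist a a' < \<epsilon>" using uc by blast
    then show "\<exists>d>0. \<forall>x\<in>f ` E. \<forall>x'\<in>f ` E. dist x' x < d \<longrightarrow> dist (h x') (h x) < \<epsilon>"
      by (intro exI[of _ \<delta>]) (auto simp: h dist_real_def)
  qed
  then obtain h' where h': "uniformly_continuous_on (closure (f ` E)) h'" "\<And>x. x \<in> f ` E \<Longrightarrow> h x = h' x"
    using uniformly_continuous_on_extension_on_closure by metis
  \<comment> \<open>Uniform continuity has extended the inverse to the closure of the image;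
    Tietze's theorem extends it to the whole line, so that measures on the line can be pushed
    forward by \<open>g\<close>.\<close>
  obtain g :: "real \<Rightarrow> 'a" where g: "continuous_on UNIV g" "\<And>x. x \<in> closure (f ` E) \<Longrightarrow> g x = h' x"
    using Tietze_unbounded[OF uniformly_continuous_imp_continuous[OF h'(1)], of UNIV] by auto
  have "g (f a) = a" if "a \<in> E" for a
    using g(2)[of "f a"] h'(2)[of "f a"] h[OF that] that closure_subset[of "f ` E"] by auto
  then show ?thesis using that f02 g(1) by blast
qed

text \<open>Transported to [0,2] by the parametrization, the measures are trivially tight, so Helly
  selection gives a weakly convergent subsequence of laws on the line. Pushing the limit forward by
  the continuous map \<open>g\<close> returns to the original space, since
  \<open>g (f a) = a\<close> at the points that carry mass.\<close>

lemma weak_limit_of_discrete: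
  fixes E :: "'a::euclidean_space set" and P :: "nat \<Rightarrow> 'a set" and m :: "nat \<Rightarrow> 'a \<Rightarrow> real"
  assumes E: "compact E" and P: "\<And>j. finite (P j)" "\<And>j. P j \<subseteq> E"
    and m: "\<And>j a. 0 \<le> m j a" "\<And>j. sum (m j) (P j) = 1"
  obtains M s where "prob_space M" "sets M = sets borel" "emeasure M (- E) = 0" "strict_mono (s :: nat \<Rightarrow> nat)"
    "\<forall>\<phi> B. continuous_on UNIV \<phi> \<longrightarrow> (\<forall>x. \<bar>\<phi> x\<bar> \<le> B) \<longrightarrow>
      (\<lambda>k. \<Sum>a\<in>P (s k). m (s k) a * \<phi> a) \<longlonglongrightarrow> (LINT x|M. \<phi> x)"
proof -
  obtain f :: "'a \<Rightarrow> real" and g where f: "\<And>a. f a \<in> {0..2}" and g: "continuous_on UNIV g"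
    and gf: "\<And>a. a \<in> E \<Longrightarrow> g (f a) = a"
    using compact_parametrization[OF E] by blast
  have Ene: "E \<noteq> {}" using m(2)[of 0] P(2)[of 0] by auto
  define \<nu> where "\<nu> j = distr (point_measure (P j) (\<lambda>a. ennreal (m j a))) borel f" for j
  \<comment> \<open>\<open>f\<close> is measurable for free: a point measure carries all subsets of
    its underlying set.\<close>
  have fm: "f \<in> measurable (point_measure (P j) (\<lambda>a. ennreal (m j a))) borel" for j
    by (simp add: measurable_point_measure_eq1)
  have rd: "real_distribution (\<nu> j)" for j
  proof -
    have "prob_space (point_measure (P j) (\<lambda>a. ennreal (m j a)))"
      by (rule prob_space_point_measure) (use P m in auto)
    then have "prob_space (\<nu> j)" unfolding \<nu>_def by (rule prob_space.prob_space_distr) (rule fm)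
    then show ?thesis unfolding real_distribution_def real_distribution_axioms_def by (simp add: \<nu>_def)
  qed
  have int: "(LINT x|\<nu> j. h x) = (\<Sum>a\<in>P j. m j a * h (f a))" if [measurable]: "h \<in> borel_measurable borel" for h :: "real \<Rightarrow> real" and j
  proof -
    have "(LINT x|\<nu> j. h x) = (LINT a|point_measure (P j) (\<lambda>a. ennreal (m j a)). h (f a))"
      unfolding \<nu>_def by (rule integral_distr[OF fm]) measurable
    also have "\<dots> = (\<Sum>a\<in>P j. m j a *\<^sub>R h (f a))"
      by (rule lebesgue_integral_point_measure_finite) (use P m in auto)
    finally show ?thesis by simp
  qed
  have "tight \<nu>"
    unfolding tight_def
  proof (intro conjI allI impI rd)
    fix \<epsilon> :: real assume \<epsilon>: "0 < \<epsilon>"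
    \<comment> \<open>Tightness is phrased with intervals open on the left, so the left end is -1 in
      order not to lose the value 0.\<close>
    have "measure (\<nu> j) {-1<..2} = 1" for j
    proof -
      interpret real_distribution "\<nu> j" by (rule rd)
      have "measure (\<nu> j) {-1<..2} = (LINT x|\<nu> j. indicator {-1<..2} x)" by simp
      also have "\<dots> = (\<Sum>a\<in>P j. m j a * indicator {-1<..2} (f a))" by (rule int) simp
      also have "\<dots> = (\<Sum>a\<in>P j. m j a)" 
      proof (rule sum.cong)
        show "m j a * indicator {-1<..2} (f a) = m j a" for a using f[of a] by (simp add: indicator_def)
      qed simp
      finally show ?thesis using m(2) by simp
    qed
    then show "\<exists>a b. a < b \<and> (\<forall>n. 1 - \<epsilon> < measure (\<nu> n) {a<..b})"
      using \<epsilon> by (intro exI[of _ "-1"] exI[of _ 2]) auto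
  qed
  then obtain s N where s: "strict_mono (s :: nat \<Rightarrow> nat)" and N: "real_distribution N" and wc: "weak_conv_m (\<nu> \<circ> id \<circ> s) N"
    using tight_imp_convergent_subsubsequence[of \<nu> id] by (auto simp: strict_mono_id)
  interpret N: real_distribution N by (rule N)
  interpret rN: real_distribution "(\<nu> \<circ> id \<circ> s) k" for k using rd by simp
  have [measurable]: "g \<in> borel_measurable borel" using g by (rule borel_measurable_continuous_onI)
  define M where "M = distr N borel g"
  have conv: "(\<lambda>k. \<Sum>a\<in>P (s k). m (s k) a * \<phi> a) \<longlonglongrightarrow> (LINT x|M. \<phi> x)"
    if \<phi>: "continuous_on UNIV \<phi>" "\<And>x. \<bar>\<phi> x\<bar> \<le> B" for \<phi> B
  proof -
    have [measurable]: "\<phi> \<in> borel_measurable borel" using \<phi>(1) by (rule borel_measurable_continuous_onI)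
    have "continuous_on UNIV (\<lambda>x. \<phi> (g x))" by (rule continuous_on_compose2[OF \<phi>(1) g]) auto
    then have "isCont (\<lambda>x. \<phi> (g x)) x" for x by (simp add: continuous_on_eq_continuous_at)
    then have "(\<lambda>k. LINT x|(\<nu> \<circ> id \<circ> s) k. \<phi> (g x)) \<longlonglongrightarrow> (LINT x|N. \<phi> (g x))"
      using \<phi>(2) by (intro weak_conv_imp_integral_bdd_continuous_conv[OF _ _ wc]) (auto intro: rd N)
    moreover have "(LINT x|(\<nu> \<circ> id \<circ> s) k. \<phi> (g x)) = (\<Sum>a\<in>P (s k). m (s k) a * \<phi> a)" for k
    proof -
      have "(LINT x|(\<nu> \<circ> id \<circ> s) k. \<phi> (g x)) = (\<Sum>a\<in>P (s k). m (s k) a * \<phi> (g (f a)))"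
        by (simp add: int)
      also have "\<dots> = (\<Sum>a\<in>P (s k). m (s k) a * \<phi> a)"
        using P(2) by (intro sum.cong refl) (auto simp: gf subset_iff)
      finally show ?thesis .
    qed
    moreover have "(LINT x|N. \<phi> (g x)) = (LINT x|M. \<phi> x)"
      unfolding M_def by (rule integral_distr[symmetric]) measurable
    ultimately show ?thesis by simp
  qed
  have pM: "prob_space M" unfolding M_def by (rule N.prob_space_distr) simp
  interpret M: prob_space M by (rule pM)
  have sM: "sets M = sets borel" by (simp add: M_def)
  \<comment> \<open>Testing with the truncated distance to E shows that the limit charges only
    E.\<close>
  define h where "h x = min 1 (infdist x E)" for x
  have h: "continuous_on UNIV h" unfolding h_def by (intro continuous_intros)
  have h01: "\<bar>h x\<bar> \<le> 1" "0 \<le> h x" for x by (auto simp: h_def infdist_nonneg)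
  have "(\<lambda>k. \<Sum>a\<in>P (s k). m (s k) a * h a) \<longlonglongrightarrow> (LINT x|M. h x)" by (rule conv[OF h h01(1)])
  moreover have "(\<Sum>a\<in>P (s k). m (s k) a * h a) = 0" for k
    using P(2) by (intro sum.neutral) (auto simp: h_def subset_iff)
  ultimately have h0: "(LINT x|M. h x) = 0" by (simp add: LIMSEQ_const_iff)
  have [measurable]: "h \<in> borel_measurable M"
    unfolding measurable_cong_sets[OF sM refl] using h by (rule borel_measurable_continuous_onI)
  have "integrable M h" by (rule M.integrable_const_bound[of _ 1]) (use h01 in auto)
  then have "AE x in M. h x = 0" using h0 h01 integral_nonneg_eq_0_iff_AE[of M h] by simp
  then have "AE x in M. x \<in> E"
  proof (eventually_elim)
    case (elim x)
    then have "infdist x E = 0" by (auto simp: h_def min_def split: if_splits)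
    then show ?case using in_closed_iff_infdist_zero[OF compact_imp_closed[OF E] Ene] by simp
  qed
  moreover have "- E \<in> sets M" using E by (simp add: sM compact_imp_closed)
  ultimately have "emeasure M (- E) = 0"
    by (subst (asm) AE_iff_measurable[of "- E"]) (auto simp: M_def)
  then show ?thesis using that pM sM s conv by blast
qed

section \<open>Space-time test functions\<close>

lemma smooth_time_slice: "smooth \<phi> \<Longrightarrow> smooth (\<lambda>y. \<phi> (y, t))"
  using smooth_affine[of "\<lambda>y. (y, 0)" \<phi> "(0, t)"]
  by (simp add: bounded_linear_Pair bounded_linear_ident bounded_linear_zero)

lemma smooth_fst: "smooth f \<Longrightarrow> smooth (\<lambda>z. f (fst z))"
  using smooth_affine[of fst f 0] by (simp add: bounded_linear_fst)

lemma smooth_snd: "smooth f \<Longrightarrow> smooth (\<lambda>z. f (snd z))"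
  using smooth_affine[of snd f 0] by (simp add: bounded_linear_snd)

lemma smooth_scale: "smooth f \<Longrightarrow> smooth (\<lambda>x. f ((x - x0) /\<^sub>R r))"
  using smooth_affine[of "\<lambda>x. x /\<^sub>R r" f "- (x0 /\<^sub>R r)"]
  by (simp add: bounded_linear_scaleR_right scaleR_diff_right)

lemma space_derivative:
  assumes "smooth \<phi>"
  shows "((\<lambda>y. \<phi> (y, t)) has_derivative (\<lambda>v. frechet_derivative \<phi> (at (x, t)) (v, 0))) (at x)"
proof -
  have "((\<lambda>y. (y, t)) has_derivative (\<lambda>v. (v, 0))) (at x)"
    by (auto intro!: derivative_eq_intros)
  then show ?thesis
    using diff_chain_at[OF _ smooth_has_derivative[OF assms], of "\<lambda>y. (y, t)" _ x] by (simp add: o_def)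
qed

lemma space_gradient_inner:
  assumes "smooth \<phi>"
  shows "space_gradient \<phi> (x, t) \<bullet> v = frechet_derivative \<phi> (at (x, t)) (v, 0)"
proof -
  have "frechet_derivative (\<lambda>y. \<phi> (y, t)) (at x) v = space_gradient \<phi> (x, t) \<bullet> v"
    unfolding space_gradient_def prod.case
    by (rule frechet_eq_gradient[OF smooth_differentiable[OF smooth_time_slice[OF assms]]])
  then show ?thesis by (simp add: frechet_derivative_eqI[OF space_derivative[OF assms]])
qed

lemma time_derivative_eq:
  fixes \<phi> :: "'a::euclidean_space \<times> real \<Rightarrow> real"
  assumes "smooth \<phi>"
  shows "time_derivative \<phi> = (\<lambda>z. frechet_derivative \<phi> (at z) (0, 1))"
    and "((\<lambda>s. \<phi> (x, s)) has_real_derivative time_derivative \<phi> (x, t)) (at t)"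
proof -
  have d: "((\<lambda>s. \<phi> (x, s)) has_real_derivative frechet_derivative \<phi> (at (x, t)) (0, 1)) (at t)" for x t
  proof -
    have "((\<lambda>s. (x, s)) has_derivative (\<lambda>h. (0, h))) (at t)"
      by (auto intro!: derivative_eq_intros)
    then have "((\<lambda>s. \<phi> (x, s)) has_derivative (\<lambda>h. frechet_derivative \<phi> (at (x, t)) (0, h))) (at t)"
      using diff_chain_at[OF _ smooth_has_derivative[OF assms], of "\<lambda>s. (x, s)" _ t] by (simp add: o_def)
    moreover have "(\<lambda>h. frechet_derivative \<phi> (at (x, t)) (0, h)) = (*) (frechet_derivative \<phi> (at (x, t)) (0, 1))"
    proof
      fix h :: real
      show "frechet_derivative \<phi> (at (x, t)) (0, h) = frechet_derivative \<phi> (at (x, t)) (0, 1) * h"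
        using frechet_linear(2)[OF smooth_differentiable[OF assms], of "(x, t)" h "(0, 1)"] by simp
    qed
    ultimately show ?thesis unfolding has_field_derivative_def by metis
  qed
  show t: "time_derivative \<phi> = (\<lambda>z. frechet_derivative \<phi> (at z) (0, 1))"
    using DERIV_imp_deriv[OF d] by (auto simp: time_derivative_def fun_eq_iff)
  show "((\<lambda>s. \<phi> (x, s)) has_real_derivative time_derivative \<phi> (x, t)) (at t)"
    unfolding t by (rule d)
qed

lemma frechet_space_time:
  fixes \<phi> :: "'a::euclidean_space \<times> real \<Rightarrow> real"
  assumes "smooth \<phi>"
  shows "frechet_derivative \<phi> (at z) (v, h) = space_gradient \<phi> z \<bullet> v + time_derivative \<phi> z * h"
proof -
  obtain x t where z: "z = (x, t)" by (cases z)
  have "frechet_derivative \<phi> (at z) ((v, 0) + h *\<^sub>R (0, 1)) =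
      frechet_derivative \<phi> (at z) (v, 0) + h *\<^sub>R frechet_derivative \<phi> (at z) (0, 1)"
    by (simp only: frechet_linear[OF smooth_differentiable[OF assms]])
  then show ?thesis
    by (simp add: space_gradient_inner[OF assms] time_derivative_eq(1)[OF assms] z mult.commute)
qed

lemma continuous_on_space_gradient:
  fixes \<phi> :: "'a::euclidean_space \<times> real \<Rightarrow> real"
  assumes "smooth \<phi>"
  shows "continuous_on S (space_gradient \<phi>)"
proof -
  have "space_gradient \<phi> = (\<lambda>z. \<Sum>i\<in>Basis. frechet_derivative \<phi> (at z) (i, 0) *\<^sub>R i)"
  proof
    fix z :: "'a \<times> real"
    have "space_gradient \<phi> z = (\<Sum>i\<in>Basis. (space_gradient \<phi> z \<bullet> i) *\<^sub>R i)"
      by (simp add: euclidean_representation)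
    then show "space_gradient \<phi> z = (\<Sum>i\<in>Basis. frechet_derivative \<phi> (at z) (i, 0) *\<^sub>R i)"
      by (cases z) (simp add: space_gradient_inner[OF assms])
  qed
  then show ?thesis
    by (simp add: smooth_continuous_on smooth_frechet[OF assms] continuous_intros)
qed

lemma test_function_smooth: "\<phi> \<in> test_functions \<Omega> \<Longrightarrow> smooth \<phi>"
  unfolding test_functions_def by (rule Cc_infinity_smooth)

lemma test_function_slice:
  assumes "\<phi> \<in> test_functions \<Omega>"
  shows "(\<lambda>y. \<phi> (y, t)) \<in> Cc_infinity \<Omega>"
proof -
  obtain K where K: "compact K" "K \<subseteq> \<Omega> \<times> UNIV" "\<And>x. x \<notin> K \<Longrightarrow> \<phi> x = 0"
    using Cc_infinity_support[of \<phi>] assms unfolding test_functions_def by metis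
  show ?thesis
  proof (rule Cc_infinityI[of _ "fst ` K"])
    show "smooth (\<lambda>y. \<phi> (y, t))" by (rule smooth_time_slice[OF test_function_smooth[OF assms]])
    show "compact (fst ` K)" using K(1) by (intro compact_continuous_image continuous_intros)
    show "fst ` K \<subseteq> \<Omega>" using K(2) by auto
    show "\<phi> (y, t) = 0" if "y \<notin> fst ` K" for y
      by (rule K(3)) (use that in \<open>force simp: image_iff\<close>)
  qed
qed

lemma test_function_time_derivative:
  assumes "\<phi> \<in> test_functions \<Omega>"
  shows "time_derivative \<phi> \<in> test_functions \<Omega>"
  unfolding time_derivative_eq(1)[OF test_function_smooth[OF assms]]
  using assms unfolding test_functions_def by (rule Cc_infinity_frechet)

lemma test_function_support:
  assumes "\<phi> \<in> test_functions \<Omega>"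
  obtains K where "compact K" "K \<subseteq> \<Omega> \<times> UNIV" "\<And>z. z \<notin> K \<Longrightarrow> \<phi> z = 0"
    "\<And>z. z \<notin> K \<Longrightarrow> space_gradient \<phi> z = 0" "\<And>z. z \<notin> K \<Longrightarrow> time_derivative \<phi> z = 0"
proof -
  obtain K where K: "compact K" "K \<subseteq> \<Omega> \<times> UNIV" "\<And>z. z \<notin> K \<Longrightarrow> \<phi> z = 0"
    "\<And>z. z \<notin> K \<Longrightarrow> frechet_derivative \<phi> (at z) = (\<lambda>v. 0)"
    using Cc_infinity_support[of \<phi>] assms unfolding test_functions_def by metis
  have "space_gradient \<phi> z = 0" if "z \<notin> K" for z
  proof -
    have "space_gradient \<phi> z \<bullet> v = 0" for v
      using K(4)[OF that] space_gradient_inner[OF test_function_smooth[OF assms], of "fst z" "snd z" v] by simp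
    then show ?thesis using inner_eq_zero_iff by blast
  qed
  moreover have "time_derivative \<phi> z = 0" if "z \<notin> K" for z
    using K(4)[OF that] by (simp add: time_derivative_eq(1)[OF test_function_smooth[OF assms]])
  ultimately show ?thesis using that K by blast
qed

lemma Cc_infinity_lipschitz:
  assumes f: "f \<in> Cc_infinity U"
  obtains L where "L \<ge> 0" "\<And>x y. \<bar>f x - f y\<bar> \<le> L * dist x y"
proof -
  have sm: "smooth f" by (rule Cc_infinity_smooth[OF f])
  obtain K where K: "compact K" "\<And>x. x \<notin> K \<Longrightarrow> gradient f x = 0" using gradient_support[OF f] by metis
  obtain B where B: "B > 0" "\<And>x. norm (gradient f x) \<le> B"
    using bounded_compact_support[OF continuous_on_gradient[OF sm] K] by blast
  have "norm (f x - f y) \<le> B * norm (x - y)" for x y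
  proof (rule differentiable_bound[of UNIV f "\<lambda>x. frechet_derivative f (at x)"])
    show "(f has_derivative frechet_derivative f (at x)) (at x within UNIV)" for x
      using smooth_has_derivative[OF sm] by simp
    show "onorm (frechet_derivative f (at x)) \<le> B" for x
    proof (rule onorm_le)
      fix v
      have "norm (frechet_derivative f (at x) v) \<le> norm (gradient f x) * norm v"
        using Cauchy_Schwarz_ineq2 by (simp add: frechet_eq_gradient[OF smooth_differentiable[OF sm]])
      also have "\<dots> \<le> B * norm v" using B(2) by (intro mult_right_mono) auto
      finally show "norm (frechet_derivative f (at x) v) \<le> B * norm v" .
    qed
  qed auto
  then show ?thesis using that[of B] B(1) by (simp add: dist_norm)
qed

text \<open>A diagonal linear change of variables; the basis of the product consists of the vectors
  (i, 0) and (0, 1), which \<open>c\<close> tells apart by the second component.\<close>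

lemma parabolic_scaling_integral:
  fixes f :: "'a::euclidean_space \<times> real \<Rightarrow> real"
  assumes [measurable]: "f \<in> borel_measurable borel" and r: "0 < r" "0 < q"
  shows "(LINT w|lborel. f (x0 + r *\<^sub>R fst w, t0 + q * snd w)) = (LINT z|lborel. f z) / (r ^ DIM('a) * q)"
proof -
  define c where "c j = (if snd j = 0 then r else q)" for j :: "'a \<times> real"
  define T where "T w = (x0, t0) + (\<Sum>j\<in>Basis. (c j * (w \<bullet> j)) *\<^sub>R j)" for w :: "'a \<times> real"
  have T: "T w = (x0 + r *\<^sub>R fst w, t0 + q * snd w)" for w
  proof -
    have "(\<Sum>j\<in>Basis. (c j * (w \<bullet> j)) *\<^sub>R j) =
        (\<Sum>i\<in>Basis. (r * (fst w \<bullet> i)) *\<^sub>R (i, 0)) + (q * snd w) *\<^sub>R (0, 1)"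
      by (cases w) (simp add: sum_Basis_prod_eq c_def)
    also have "(\<Sum>i\<in>Basis. (r * (fst w \<bullet> i)) *\<^sub>R (i, 0 :: real)) = (r *\<^sub>R fst w, 0)"
    proof (rule prod_eqI)
      have "(\<Sum>i\<in>Basis. (r * (fst w \<bullet> i)) *\<^sub>R i) = r *\<^sub>R (\<Sum>i\<in>Basis. (fst w \<bullet> i) *\<^sub>R i)"
        by (simp add: scaleR_sum_right)
      then show "fst (\<Sum>i\<in>Basis. (r * (fst w \<bullet> i)) *\<^sub>R (i, 0 :: real)) = fst (r *\<^sub>R fst w, 0 :: real)"
        by (simp add: fst_sum euclidean_representation)
    qed (simp add: snd_sum)
    finally show ?thesis by (simp add: T_def)
  qed
  have prod: "(\<Prod>j\<in>(Basis :: ('a \<times> real) set). \<bar>c j\<bar>) = r ^ DIM('a) * q"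
  proof -
    have "(\<Prod>j\<in>(Basis :: ('a \<times> real) set). \<bar>c j\<bar>) =
        (\<Prod>j\<in>(\<lambda>u. (u, 0)) ` (Basis :: 'a set). \<bar>c j\<bar>) * (\<Prod>j\<in>(\<lambda>u. (0, u)) ` (Basis :: real set). \<bar>c j\<bar>)"
      unfolding Basis_prod_def by (rule prod.union_disjoint) auto
    also have "(\<Prod>j\<in>(\<lambda>u. (u, 0)) ` (Basis :: 'a set). \<bar>c j\<bar>) = (\<Prod>j\<in>(\<lambda>u. (u, 0 :: real)) ` (Basis :: 'a set). r)"
      by (rule prod.cong) (use r in \<open>auto simp: c_def\<close>)
    also have "\<dots> = r ^ DIM('a)"
      by (simp add: card_image inj_on_def)
    finally show ?thesis using r by (simp add: c_def)
  qed
  have lb: "lborel = density (distr lborel borel T) (\<lambda>_. ennreal (\<Prod>j\<in>Basis. \<bar>c j\<bar>))"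
    unfolding T_def by (rule lborel_affine_euclidean) (use r in \<open>auto simp: c_def\<close>)
  have Tm [measurable]: "T \<in> borel_measurable borel"
    unfolding T_def by measurable
  have "(LINT z|lborel. f z) = (LINT z|density (distr lborel borel T) (\<lambda>_. ennreal (\<Prod>j\<in>Basis. \<bar>c j\<bar>)). f z)"
    using lb by simp
  also have "\<dots> = (\<Prod>j\<in>(Basis :: ('a \<times> real) set). \<bar>c j\<bar>) * (LINT w|lborel. f (T w))"
    by (subst integral_density) (auto simp: integral_distr prod_nonneg)
  finally show ?thesis using r by (simp add: T prod)
qed

lemma integral_leb_Times:
  fixes f :: "'a::euclidean_space \<times> 'b::euclidean_space \<Rightarrow> real"
  assumes A: "A \<in> sets borel" and B: "B \<in> sets borel" and f: "integrable (leb (A \<times> B)) f"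
  shows "integral\<^sup>L (leb (A \<times> B)) f = (LINT t|leb B. LINT x|leb A. f (x, t))"
    and "integrable (leb B) (\<lambda>t. LINT x|leb A. f (x, t))"
    and "AE t in leb B. integrable (leb A) (\<lambda>x. f (x, t))"
proof -
  have AB: "A \<times> B \<in> sets borel" using A B by (rule borel_Times) 
  let ?g = "\<lambda>z. indicator (A \<times> B) z *\<^sub>R f z"
  have g: "integrable (lborel \<Otimes>\<^sub>M lborel) (\<lambda>(x, t). ?g (x, t))"
    using f AB by (simp add: integrable_restrict_space lborel_prod case_prod_unfold)
  have in1: "(LINT x|lborel. ?g (x, t)) = indicator B t *\<^sub>R (LINT x|leb A. f (x, t))" for t
  proof -
    have "?g (x, t) = indicator B t *\<^sub>R (indicator A x *\<^sub>R f (x, t))" for x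
      by (simp add: indicator_times)
    then show ?thesis using A by (simp only: integral_restrict_space integral_scaleR_right) (simp add: integral_restrict_space)
  qed
  have "integral\<^sup>L (leb (A \<times> B)) f = integral\<^sup>L lborel ?g"
    using AB by (simp add: integral_restrict_space)
  also have "\<dots> = (LINT t|lborel. LINT x|lborel. ?g (x, t))"
    using lborel_pair.integral_snd[OF g] by (simp add: lborel_prod case_prod_unfold)
  also have "\<dots> = (LINT t|leb B. LINT x|leb A. f (x, t))"
    using B by (simp only: in1) (simp add: integral_restrict_space)
  finally show "integral\<^sup>L (leb (A \<times> B)) f = (LINT t|leb B. LINT x|leb A. f (x, t))" .
  have "integrable lborel (\<lambda>t. LINT x|lborel. ?g (x, t))"
    using lborel_pair.integrable_snd[OF g] by simp
  then show "integrable (leb B) (\<lambda>t. LINT x|leb A. f (x, t))"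
    using B unfolding in1 by (simp add: integrable_restrict_space)
  have "AE t in lborel. integrable lborel (\<lambda>x. ?g (x, t))"
    using lborel_pair.AE_integrable_snd[OF g] by simp
  then have "AE t in lborel. t \<in> B \<longrightarrow> integrable (leb A) (\<lambda>x. f (x, t))"
    by eventually_elim (use A in \<open>auto simp: integrable_restrict_space indicator_times\<close>)
  then show "AE t in leb B. integrable (leb A) (\<lambda>x. f (x, t))"
    using B by (simp add: AE_restrict_space_iff)
qed

section \<open>Pairing the time derivative with a smooth function\<close>

text \<open>Each time slice of W is an admissible element of W_0^{1,p}, so the dual norm bounds the
  slice integral by d(t) N(t); Hoelder in time with exponents p/(p-1) and p concludes. What needs
  care is the measurability of d, as the dual norm is a supremum over a large family.\<close>

lemma time_derivative_pairing:
  fixes \<Omega> :: "'a::euclidean_space set"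
  assumes \<Omega>: "open \<Omega>" "bounded \<Omega>" and p: "1 < p" and T: "0 < T"
    and \<phi>: "\<phi> \<in> test_functions \<Omega>"
    and W: "\<And>t. (\<lambda>x. W (x, t)) \<in> Cc_infinity \<Omega>"
    and Wm: "W \<in> borel_measurable borel" "\<And>z. \<bar>W z\<bar> \<le> B"
    and Gm: "space_gradient W \<in> borel_measurable borel" "\<And>z. norm (space_gradient W z) \<le> B"
  shows "\<bar>LINT z|leb (\<Omega> \<times> {0<..<T}). time_derivative \<phi> z * W z\<bar> \<le>
    Lp_norm (leb {0<..<T}) (p / (p - 1)) (\<lambda>t. dual_norm p \<Omega> (\<lambda>x. time_derivative \<phi> (x, t))) *
    Lp_norm (leb (\<Omega> \<times> {0<..<T})) p (space_gradient W)"
proof -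
  define q where "q = p / (p - 1)"
  have pq: "1 / q + 1 / p = 1" and q1: "1 < q" using p by (simp_all add: q_def field_simps)
  have bor: "\<Omega> \<in> sets borel" "{0<..<T} \<in> sets borel" using \<Omega> by auto
  have AB: "\<Omega> \<times> {0<..<T} \<in> sets borel" by (intro borel_Times bor)
  have bAB: "bounded (\<Omega> \<times> {0<..<T})" using \<Omega> by (intro bounded_Times) auto
  interpret fA: finite_measure "leb \<Omega>" by (rule finite_measure_leb[OF \<Omega>(2) bor(1)])
  interpret fB: finite_measure "leb {0<..<T}" by (rule finite_measure_leb) auto
  interpret fAB: finite_measure "leb (\<Omega> \<times> {0<..<T})" by (rule finite_measure_leb[OF bAB AB])
  obtain C where C: "C > 0" "\<And>v g. (v, g) \<in> sobolev_W1_0 p \<Omega> \<Longrightarrow> (LINT x|leb \<Omega>. \<bar>v x\<bar>) \<le> C * Lp_norm (leb \<Omega>) p g"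
    using poincare_L1_sobolev[OF \<Omega> p] by metis
  define F where "F = time_derivative \<phi>"
  have F: "F \<in> Cc_infinity (\<Omega> \<times> UNIV)"
    using test_function_time_derivative[OF \<phi>] by (simp add: F_def test_functions_def)
  have Fb [measurable]: "F \<in> borel_measurable borel" by (rule Cc_infinity_borel[OF F])
  obtain B' where B': "B' > 0" "\<And>z. \<bar>F z\<bar> \<le> B'" using Cc_infinity_bounded[OF F] by blast
  obtain L where L: "L \<ge> 0" "\<And>z w. \<bar>F z - F w\<bar> \<le> L * dist z w" using Cc_infinity_lipschitz[OF F] by blast
  have Ft: "(\<lambda>x. F (x, t)) \<in> borel_measurable (leb \<Omega>)" for t
    by (rule borel_measurable_leb) measurable
  have vint: "integrable (leb \<Omega>) v" if "(v, g) \<in> sobolev_W1_0 p \<Omega>" for v g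
    using that by (intro mem_Lp_imp_L1(1)[OF p fA.finite_measure_axioms]) (auto simp: sobolev_W1_0_def sobolev_W1_def)
  \<comment> \<open>A bounded density pairs with Sobolev functions through the L^1 Poincare bound;
    this serves both F itself and its time increments.\<close>
  have bv: "integrable (leb \<Omega>) (\<lambda>x. f x * v x) \<and> \<bar>LINT x|leb \<Omega>. f x * v x\<bar> \<le> b * C * Lp_norm (leb \<Omega>) p g"
    if vg: "(v, g) \<in> sobolev_W1_0 p \<Omega>" and f: "f \<in> borel_measurable (leb \<Omega>)" "\<And>x. \<bar>f x\<bar> \<le> b" for v g f b
  proof -
    have b0: "0 \<le> b" using f(2)[of undefined] by simp
    have le: "\<bar>f x * v x\<bar> \<le> b * \<bar>v x\<bar>" for x using f(2)[of x] by (simp add: abs_mult mult_right_mono)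
    have i: "integrable (leb \<Omega>) (\<lambda>x. b * \<bar>v x\<bar>)" using vint[OF vg] by simp
    have fv: "integrable (leb \<Omega>) (\<lambda>x. f x * v x)"
      by (rule Bochner_Integration.integrable_bound[OF i])
        (use f vint[OF vg] le b0 in \<open>auto intro!: borel_measurable_times simp: abs_mult\<close>)
    have "\<bar>LINT x|leb \<Omega>. f x * v x\<bar> \<le> (LINT x|leb \<Omega>. \<bar>f x * v x\<bar>)" by (rule integral_abs_bound)
    also have "\<dots> \<le> (LINT x|leb \<Omega>. b * \<bar>v x\<bar>)" by (rule integral_mono) (use fv i le in auto)
    also have "\<dots> = b * (LINT x|leb \<Omega>. \<bar>v x\<bar>)" by simp
    also have "\<dots> \<le> b * (C * Lp_norm (leb \<Omega>) p g)" by (intro mult_left_mono C(2)[OF vg] b0)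
    finally show ?thesis using fv by (simp add: mult.assoc)
  qed
  define d where "d t = dual_norm p \<Omega> (\<lambda>x. F (x, t))" for t
  have bF: "\<bar>LINT x|leb \<Omega>. F (x, t) * v x\<bar> \<le> B' * C * Lp_norm (leb \<Omega>) p g" if "(v, g) \<in> sobolev_W1_0 p \<Omega>" for v g t
    using bv[OF that Ft B'(2)] by blast
  have pair: "\<bar>LINT x|leb \<Omega>. F (x, t) * v x\<bar> \<le> d t * Lp_norm (leb \<Omega>) p g" if "(v, g) \<in> sobolev_W1_0 p \<Omega>" for v g t
    unfolding d_def by (rule dual_norm_pairing[OF p bF that])
  have d0: "0 \<le> d t" for t unfolding d_def by (rule dual_norm_nonneg[OF p bF])
  have dB: "d t \<le> B' * C" for t
    unfolding d_def by (rule dual_norm_le[OF p bF]) (use B' C in auto)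
  \<comment> \<open>F is Lipschitz in time uniformly in x, hence so is d; this continuity provides
    the measurability.\<close>
  have dL: "d t \<le> d u + L * dist t u * C" for t u
  proof -
    have "\<bar>LINT x|leb \<Omega>. F (x, t) * v x\<bar> \<le> (d u + L * dist t u * C) * Lp_norm (leb \<Omega>) p g"
      if vg: "(v, g) \<in> sobolev_W1_0 p \<Omega>" for v g
    proof -
      have "\<bar>F (x, t) - F (x, u)\<bar> \<le> L * dist t u" for x
        using L(2)[of "(x, t)" "(x, u)"] by (simp add: dist_Pair_Pair)
      then have 1: "integrable (leb \<Omega>) (\<lambda>x. (F (x, t) - F (x, u)) * v x)"
        "\<bar>LINT x|leb \<Omega>. (F (x, t) - F (x, u)) * v x\<bar> \<le> L * dist t u * C * Lp_norm (leb \<Omega>) p g"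
        using bv[OF vg borel_measurable_diff[OF Ft Ft]] by auto
      have 2: "integrable (leb \<Omega>) (\<lambda>x. F (x, u) * v x)" using bv[OF vg Ft B'(2)] by blast
      have "(LINT x|leb \<Omega>. F (x, t) * v x) = (LINT x|leb \<Omega>. (F (x, t) - F (x, u)) * v x + F (x, u) * v x)"
        by (simp add: algebra_simps)
      also have "\<dots> = (LINT x|leb \<Omega>. (F (x, t) - F (x, u)) * v x) + (LINT x|leb \<Omega>. F (x, u) * v x)"
        using 1 2 by simp
      finally show ?thesis using 1(2) pair[OF vg, of u] by (simp add: distrib_right)
    qed
    then show ?thesis unfolding d_def[of t]
      by (intro dual_norm_le[OF p]) (use d0 L C in auto)
  qed
  have dcont: "continuous_on UNIV d"
  proof (rule lipschitz_on_continuous_on)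
    show "(L * C)-lipschitz_on UNIV d"
    proof (rule lipschitz_onI)
      show "dist (d t) (d u) \<le> L * C * dist t u" for t u
        using dL[of t u] dL[of u t] by (simp add: dist_real_def abs_le_iff algebra_simps abs_minus_commute)
    qed (use L C in simp)
  qed
  have [measurable]: "d \<in> borel_measurable (leb {0<..<T})"
    using dcont by (intro borel_measurable_leb borel_measurable_continuous_onI)
  have dLp: "integrable (leb {0<..<T}) (\<lambda>t. \<bar>d t\<bar> powr q)"
    using mem_Lp_bounded[OF fB.finite_measure_axioms, of d "B' * C" q] d0 dB q1 by (simp add: mem_Lp_def)
  define G where "G = space_gradient W"
  have Wt: "((\<lambda>x. W (x, t)), (\<lambda>x. G (x, t))) \<in> sobolev_W1_0 p \<Omega>" for t
    using Cc_infinity_in_sobolev[OF W \<Omega> p, of t] by (simp add: G_def space_gradient_def)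
  have Gmem: "mem_Lp (leb (\<Omega> \<times> {0<..<T})) p G"
    unfolding G_def by (rule mem_Lp_bounded[OF fAB.finite_measure_axioms borel_measurable_leb[OF Gm(1)] Gm(2)]) (use p in auto)
  then have iG: "integrable (leb (\<Omega> \<times> {0<..<T})) (\<lambda>z. norm (G z) powr p)" by (simp add: mem_Lp_def)
  define N where "N t = Lp_norm (leb \<Omega>) p (\<lambda>x. G (x, t))" for t
  have Np: "\<bar>N t\<bar> powr p = (LINT x|leb \<Omega>. norm (G (x, t)) powr p)" for t
    using p by (simp add: N_def Lp_norm_def powr_powr integral_nonneg_AE)
  have iN: "integrable (leb {0<..<T}) (\<lambda>t. \<bar>N t\<bar> powr p)"
    unfolding Np by (rule integral_leb_Times(2)[OF bor iG])
  have "N = (\<lambda>t. (LINT x|leb \<Omega>. norm (G (x, t)) powr p) powr (1 / p))"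
    by (simp add: N_def Lp_norm_def fun_eq_iff)
  then have [measurable]: "N \<in> borel_measurable (leb {0<..<T})"
    using borel_measurable_integrable[OF integral_leb_Times(2)[OF bor iG]] by simp
  have iFW: "integrable (leb (\<Omega> \<times> {0<..<T})) (\<lambda>z. F z * W z)"
  proof (rule fAB.integrable_const_bound[of _ "B' * B"])
    have "\<bar>F z * W z\<bar> \<le> B' * B" for z
      using B'(2)[of z] Wm(2)[of z] by (simp add: abs_mult mult_mono')
    then show "AE z in leb (\<Omega> \<times> {0<..<T}). norm (F z * W z) \<le> B' * B" by simp
    show "(\<lambda>z. F z * W z) \<in> borel_measurable (leb (\<Omega> \<times> {0<..<T}))"
      using Wm(1) by (intro borel_measurable_leb) measurable
  qed
  note H = Holder_integral[OF q1 pq, of d "leb {0<..<T}" N, OF _ _ dLp iN]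
  have "\<bar>LINT z|leb (\<Omega> \<times> {0<..<T}). F z * W z\<bar> = \<bar>LINT t|leb {0<..<T}. LINT x|leb \<Omega>. F (x, t) * W (x, t)\<bar>"
    by (simp add: integral_leb_Times(1)[OF bor iFW])
  also have "\<dots> \<le> (LINT t|leb {0<..<T}. \<bar>LINT x|leb \<Omega>. F (x, t) * W (x, t)\<bar>)"
    by (rule integral_abs_bound)
  also have "\<dots> \<le> (LINT t|leb {0<..<T}. \<bar>d t * N t\<bar>)"
  proof (rule integral_mono)
    show "integrable (leb {0<..<T}) (\<lambda>t. \<bar>LINT x|leb \<Omega>. F (x, t) * W (x, t)\<bar>)"
      using integral_leb_Times(2)[OF bor iFW] by simp
    show "integrable (leb {0<..<T}) (\<lambda>t. \<bar>d t * N t\<bar>)" using H(1) by simp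
    show "\<bar>LINT x|leb \<Omega>. F (x, t) * W (x, t)\<bar> \<le> \<bar>d t * N t\<bar>" for t
      using pair[OF Wt, of t t] unfolding N_def by linarith
  qed
  also have "\<dots> \<le> (LINT t|leb {0<..<T}. \<bar>d t\<bar> powr q) powr (1 / q) * (LINT t|leb {0<..<T}. \<bar>N t\<bar> powr p) powr (1 / p)"
    by (rule H(2)) measurable
  also have "(LINT t|leb {0<..<T}. \<bar>N t\<bar> powr p) = (LINT z|leb (\<Omega> \<times> {0<..<T}). norm (G z) powr p)"
    unfolding Np by (rule integral_leb_Times(1)[OF bor iG, symmetric])
  finally show ?thesis
    by (simp add: Lp_norm_def F_def G_def d_def q_def)
qed

section \<open>Measures with a growth condition\<close>

definition unit_cylinder :: "('a::euclidean_space \<times> real) set" where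
  "unit_cylinder = ball 0 1 \<times> {-1<..<1}"

definition rescale :: "real \<Rightarrow> real \<Rightarrow> 'a::euclidean_space \<times> real \<Rightarrow> 'a \<times> real \<Rightarrow> 'a \<times> real" where
  "rescale p r a z = ((fst z - fst a) /\<^sub>R r, (snd z - snd a) / r powr p)"

text \<open>Convolution of the discrete measure with the kernel dilated to scale r, without the
  normalising factor r^(-n-p), which appears explicitly in the formulas that use it.\<close>

definition kernel_sum ::
  "real \<Rightarrow> ('a::euclidean_space \<times> real) set \<Rightarrow> ('a \<times> real \<Rightarrow> real) \<Rightarrow> real \<Rightarrow>
    ('a \<times> real \<Rightarrow> 'c::euclidean_space) \<Rightarrow> 'a \<times> real \<Rightarrow> 'c" where
  "kernel_sum p P m r k z = (\<Sum>a\<in>P. m a *\<^sub>R k (rescale p r a z))"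

lemma rescale_in_unit_cylinder:
  assumes r: "0 < r"
  shows "rescale p r a z \<in> unit_cylinder \<longleftrightarrow> z \<in> pcyl p a r"
proof -
  obtain x t y s where az: "a = (x, t)" "z = (y, s)" by (cases a; cases z)
  have rp: "0 < r powr p" using r by simp
  have "norm ((y - x) /\<^sub>R r) < 1 \<longleftrightarrow> dist x y < r"
    using r by (simp add: dist_norm norm_minus_commute divide_inverse[symmetric] mult.commute[of "inverse r"])
  moreover have "- 1 < (s - t) / r powr p \<and> (s - t) / r powr p < 1 \<longleftrightarrow> \<bar>s - t\<bar> < r powr p"
    using rp by (auto simp: pos_less_divide_eq pos_divide_less_eq)
  ultimately show ?thesis
    by (simp add: az rescale_def unit_cylinder_def mem_pcyl)
qed

lemma pcyl_sym: "a \<in> pcyl p z r \<longleftrightarrow> z \<in> pcyl p a r"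
  by (cases a; cases z) (auto simp: mem_pcyl dist_commute abs_minus_commute)

lemma continuous_rescale: "continuous_on S (rescale p r a)"
  unfolding rescale_def[abs_def] divide_inverse by (intro continuous_intros)

lemma rescale_measurable [measurable]: "rescale p r a \<in> borel_measurable borel"
  by (intro borel_measurable_continuous_onI continuous_rescale)

lemma bounded_unit_cylinder: "bounded (unit_cylinder :: ('a::euclidean_space \<times> real) set)"
  unfolding unit_cylinder_def by (intro bounded_Times) auto

lemma kernel_sum_support:
  assumes "0 < r" "\<And>w. w \<notin> unit_cylinder \<Longrightarrow> k w = 0" "\<And>a. a \<in> P \<Longrightarrow> z \<notin> pcyl p a r"
  shows "kernel_sum p P m r k z = 0"
  unfolding kernel_sum_def
proof (intro sum.neutral ballI)
  fix a assume "a \<in> P"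
  then have "rescale p r a z \<notin> unit_cylinder" using assms(3) rescale_in_unit_cylinder[OF assms(1)] by blast
  then show "m a *\<^sub>R k (rescale p r a z) = 0" using assms(2) by simp
qed

lemma kernel_sum_measurable [measurable]:
  "k \<in> borel_measurable borel \<Longrightarrow> kernel_sum p P m r k \<in> borel_measurable borel"
  unfolding kernel_sum_def[abs_def]
  by (intro borel_measurable_sum borel_measurable_scaleR borel_measurable_const
      measurable_compose[OF rescale_measurable])

lemma rescale_integral:
  fixes f :: "'a::euclidean_space \<times> real \<Rightarrow> 'a \<times> real \<Rightarrow> real"
  assumes [measurable]: "(\<lambda>z. f z (rescale p r a z)) \<in> borel_measurable borel" and r: "0 < r"
  shows "(LINT w|lborel. f (fst a + r *\<^sub>R fst w, snd a + r powr p * snd w) w) =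
    (LINT z|lborel. f z (rescale p r a z)) / (r ^ DIM('a) * r powr p)"
proof -
  have "rescale p r a (fst a + r *\<^sub>R fst w, snd a + r powr p * snd w) = w" for w
    using r by (simp add: rescale_def)
  then show ?thesis
    using parabolic_scaling_integral[OF assms(1) r, of "r powr p" "fst a" "snd a"] r by simp
qed

text \<open>Interpolation between two easy bounds. At z only the masses in the cylinder around z
  count, since membership in cylinders is symmetric in centre and point; this gives the sup bound B
  * D. The L^1 norm is at most that of one dilated kernel because the total mass is 1. Then |f|^q <=
  (sup |f|)^(q-1) |f|.\<close>

lemma kernel_sum_bounds:
  fixes k :: "'a::euclidean_space \<times> real \<Rightarrow> 'c::euclidean_space"
  assumes [measurable]: "k \<in> borel_measurable borel"
    and B: "\<And>w. norm (k w) \<le> B" and k0: "\<And>w. w \<notin> unit_cylinder \<Longrightarrow> k w = 0"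
    and P: "finite P" and m: "\<And>a. 0 \<le> m a" "sum m P = 1" and r: "0 < r"
    and D: "\<And>z. sum m (P \<inter> pcyl p z r) \<le> D" and q: "1 < q"
    and U: "U \<in> sets borel" "bounded U"
  shows "norm (kernel_sum p P m r k z) \<le> B * D"
    and "mem_Lp (leb U) q (kernel_sum p P m r k)"
    and "Lp_norm (leb U) q (kernel_sum p P m r k) \<le>
      ((B * D) powr (q - 1) * (B * measure lborel (unit_cylinder :: ('a \<times> real) set) * (r ^ DIM('a) * r powr p))) powr (1 / q)"
proof -
  let ?K = "kernel_sum p P m r k"
  have B0: "0 \<le> B" using B[of undefined] norm_ge_zero order_trans by blast
  show bd: "norm (?K z) \<le> B * D" for z
  proof -
    have "norm (?K z) \<le> (\<Sum>a\<in>P. m a * norm (k (rescale p r a z)))"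
      unfolding kernel_sum_def using m(1) by (intro order_trans[OF norm_sum]) simp
    also have "\<dots> \<le> (\<Sum>a\<in>P. if a \<in> pcyl p z r then m a * B else 0)"
    proof (rule sum_mono)
      fix a
      show "m a * norm (k (rescale p r a z)) \<le> (if a \<in> pcyl p z r then m a * B else 0)"
      proof (cases "a \<in> pcyl p z r")
        case True
        then show ?thesis using mult_left_mono[OF B m(1)] by simp
      next
        case False
        then have "k (rescale p r a z) = 0"
          using k0[of "rescale p r a z"] rescale_in_unit_cylinder[OF r] pcyl_sym by metis
        then show ?thesis using False by simp
      qed
    qed
    also have "\<dots> = sum m (P \<inter> pcyl p z r) * B"
      using P by (simp add: sum.inter_restrict[symmetric] sum_distrib_right)
    also have "\<dots> \<le> D * B" by (intro mult_right_mono D B0)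
    finally show ?thesis by (simp add: mult.commute)
  qed
  have fin: "finite_measure (leb U)" by (rule finite_measure_leb[OF U(2,1)])
  show mem: "mem_Lp (leb U) q ?K"
    by (rule mem_Lp_bounded[OF fin _ bd]) (use q in \<open>auto intro!: borel_measurable_leb\<close>)
  have fu: "emeasure lborel (unit_cylinder :: ('a \<times> real) set) < \<infinity>"
    by (rule emeasure_bounded_finite[OF bounded_unit_cylinder])
  have su [measurable]: "(unit_cylinder :: ('a \<times> real) set) \<in> sets borel"
    unfolding unit_cylinder_def by (intro borel_open open_Times) auto
  have iu: "integrable lborel (\<lambda>w :: 'a \<times> real. B * indicator unit_cylinder w :: real)"
    using fu by (intro integrable_mult_right integrable_real_indicator) auto
  have kle: "norm (k w) \<le> B * indicator unit_cylinder w" for w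
    using B[of w] k0[of w] by (cases "w \<in> unit_cylinder") auto
  have single: "integrable lborel (\<lambda>z. norm (k (rescale p r a z)))"
    "(LINT z|lborel. norm (k (rescale p r a z))) \<le> B * measure lborel (unit_cylinder :: ('a \<times> real) set) * (r ^ DIM('a) * r powr p)" for a
  proof -
    have ip: "integrable lborel (\<lambda>z. B * indicator (pcyl p a r) z :: real)"
    proof (intro integrable_mult_right integrable_real_indicator)
      show "pcyl p a r \<in> sets lborel" using borel_open[OF open_pcyl] by simp
      have "bounded (pcyl p a r)" by (cases a) (auto simp: pcyl_def intro!: bounded_Times)
      then show "emeasure lborel (pcyl p a r) < \<infinity>" by (rule emeasure_bounded_finite)
    qed
    show "integrable lborel (\<lambda>z. norm (k (rescale p r a z)))"
    proof (rule Bochner_Integration.integrable_bound[OF ip])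
      show "AE z in lborel. norm (norm (k (rescale p r a z))) \<le> norm (B * indicator (pcyl p a r) z :: real)"
        using kle[of "rescale p r a _"] B0 by (intro AE_I2) (simp add: indicator_def rescale_in_unit_cylinder[OF r])
      show "(\<lambda>z. norm (k (rescale p r a z))) \<in> borel_measurable lborel"
        using measurable_compose[OF rescale_measurable assms(1)] by simp
    qed
    have "(LINT z|lborel. norm (k (rescale p r a z))) = (LINT w|lborel. norm (k w)) * (r ^ DIM('a) * r powr p)"
      using rescale_integral[of "\<lambda>z w. norm (k w)" p r a] r by simp
    also have "(LINT w|lborel. norm (k w)) \<le> (LINT w|lborel. B * indicator (unit_cylinder :: ('a \<times> real) set) w)"
      by (rule integral_mono'[OF iu]) (use kle B0 in auto)
    also have "\<dots> = B * measure lborel (unit_cylinder :: ('a \<times> real) set)" by simp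
    finally show "(LINT z|lborel. norm (k (rescale p r a z))) \<le> B * measure lborel (unit_cylinder :: ('a \<times> real) set) * (r ^ DIM('a) * r powr p)"
      using r by (simp add: mult_right_mono)
  qed
  define X where "X = B * measure lborel (unit_cylinder :: ('a \<times> real) set) * (r ^ DIM('a) * r powr p)"
  have iS: "integrable lborel (\<lambda>z. \<Sum>a\<in>P. m a * norm (k (rescale p r a z)))"
    using single(1) by (intro Bochner_Integration.integrable_sum integrable_mult_right)
  have L1: "(LINT z|leb U. norm (?K z)) \<le> X"
  proof -
    have "(LINT z|leb U. norm (?K z)) = (LINT z|lborel. indicator U z * norm (?K z))"
      using U(1) by (simp add: integral_restrict_space)
    also have "\<dots> \<le> (LINT z|lborel. (\<Sum>a\<in>P. m a * norm (k (rescale p r a z))))"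
    proof (rule integral_mono'[OF iS])
      fix z
      have "norm (?K z) \<le> (\<Sum>a\<in>P. m a * norm (k (rescale p r a z)))"
        unfolding kernel_sum_def using m(1) by (intro order_trans[OF norm_sum]) simp
      moreover have "0 \<le> (\<Sum>a\<in>P. m a * norm (k (rescale p r a z)))" using m(1) by (intro sum_nonneg) simp
      ultimately show "indicator U z * norm (?K z) \<le> (\<Sum>a\<in>P. m a * norm (k (rescale p r a z)))"
        "0 \<le> (\<Sum>a\<in>P. m a * norm (k (rescale p r a z)))" by (auto simp: indicator_def)
    qed
    also have "\<dots> = (\<Sum>a\<in>P. m a * (LINT z|lborel. norm (k (rescale p r a z))))"
      using single(1) by (subst Bochner_Integration.integral_sum) auto
    also have "\<dots> \<le> (\<Sum>a\<in>P. m a * X)"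
      unfolding X_def by (intro sum_mono mult_left_mono single(2) m(1))
    also have "\<dots> = X" using m(2) by (simp add: sum_distrib_right[symmetric])
    finally show ?thesis .
  qed
  have iK: "integrable (leb U) (\<lambda>z. norm (?K z))"
    using mem_Lp_imp_L1(1)[OF q fin mem] by simp
  have "(LINT z|leb U. norm (?K z) powr q) \<le> (LINT z|leb U. (B * D) powr (q - 1) * norm (?K z))"
  proof (rule integral_mono')
    show "integrable (leb U) (\<lambda>z. (B * D) powr (q - 1) * norm (?K z))" using iK by simp
    fix z
    show "norm (?K z) powr q \<le> (B * D) powr (q - 1) * norm (?K z)"
    proof (cases "?K z = 0")
      case False
      have "norm (?K z) powr q = norm (?K z) powr (q - 1) * norm (?K z)"
        using False by (simp add: powr_diff)
      also have "\<dots> \<le> (B * D) powr (q - 1) * norm (?K z)"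
        using bd q by (intro mult_right_mono powr_mono2) auto
      finally show ?thesis .
    qed (use q in simp)
  qed auto
  also have "\<dots> \<le> (B * D) powr (q - 1) * X"
    using L1 by (simp add: mult_left_mono)
  finally show "Lp_norm (leb U) q ?K \<le> ((B * D) powr (q - 1) * (B * measure lborel (unit_cylinder :: ('a \<times> real) set) * (r ^ DIM('a) * r powr p))) powr (1 / q)"
    unfolding Lp_norm_def X_def using q by (intro powr_mono2) (auto simp: integral_nonneg_AE)
qed

section \<open>Parabolic averages and the kernels of their derivative in the radius\<close>

definition bump :: "'a::euclidean_space \<Rightarrow> real" where
  "bump y = expinv (1 - y \<bullet> y)"

definition cyl_bump :: "'a::euclidean_space \<times> real \<Rightarrow> real" where
  "cyl_bump w = bump (fst w) * bump (snd w)"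

lemma smooth_bump: "smooth (bump :: 'a::euclidean_space \<Rightarrow> real)"
proof -
  have "smooth (\<lambda>y :: 'a. expinv (1 + (-1) * (y \<bullet> y)))"
    by (intro smooth_expinv smooth_add smooth_mult smooth_const smooth_inner_self)
  then show ?thesis by (simp add: bump_def[abs_def])
qed

lemma bump_nonneg: "0 \<le> bump y" and bump_le_1: "bump y \<le> 1"
  by (simp_all add: bump_def expinv_nonneg expinv_le_1)

lemma bump_eq_0: "1 \<le> norm y \<Longrightarrow> bump y = 0"
  using power_mono[of 1 "norm y" 2] by (simp add: bump_def expinv_eq_0_iff power2_norm_eq_inner)

lemma gradient_bump: "gradient bump y = (- 2 * expinv_deriv 1 (1 - y \<bullet> y)) *\<^sub>R y"
proof (rule gradient_eqI)
  have 1: "((\<lambda>y. 1 - y \<bullet> y) has_derivative (\<lambda>v. - (2 * (y \<bullet> v)))) (at y)"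
    by (auto intro!: derivative_eq_intros simp: inner_commute)
  have 2: "(expinv has_derivative ((*) (expinv_deriv 1 (1 - y \<bullet> y)))) (at (1 - y \<bullet> y))"
    using expinv_deriv_DERIV[of 0 "1 - y \<bullet> y"] by (simp add: has_field_derivative_def expinv_deriv_0)
  have "(bump has_derivative (\<lambda>v. expinv_deriv 1 (1 - y \<bullet> y) * - (2 * (y \<bullet> v)))) (at y)"
    using diff_chain_at[OF 1 2] by (simp add: o_def bump_def[abs_def])
  then show "(bump has_derivative (\<lambda>v. (- 2 * expinv_deriv 1 (1 - y \<bullet> y)) *\<^sub>R y \<bullet> v)) (at y)"
    by (simp add: mult.assoc mult.left_commute)
qed

lemma gradient_bump_eq_0: "1 \<le> norm y \<Longrightarrow> gradient bump y = 0"
  using power_mono[of 1 "norm y" 2] by (simp add: gradient_bump expinv_deriv_def power2_norm_eq_inner)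

lemma cyl_bump_eq_0: "w \<notin> unit_cylinder \<Longrightarrow> cyl_bump w = 0"
  using bump_eq_0[of "fst w"] bump_eq_0[of "snd w"]
  by (cases w) (auto simp: cyl_bump_def unit_cylinder_def)

lemma smooth_cyl_bump: "smooth cyl_bump"
  unfolding cyl_bump_def[abs_def] by (intro smooth_mult smooth_fst smooth_snd smooth_bump)

lemma continuous_cyl_bump [continuous_intros]: "continuous_on S f \<Longrightarrow> continuous_on S (\<lambda>x. cyl_bump (f x))"
  using continuous_on_compose2[OF smooth_continuous_on[OF smooth_cyl_bump, of UNIV]] by blast

lemma cyl_bump_integral_pos: "0 < (LINT w|lborel. cyl_bump (w :: 'a::euclidean_space \<times> real))"
proof -
  have c: "continuous_on UNIV (cyl_bump :: 'a \<times> real \<Rightarrow> real)" by (rule smooth_continuous_on[OF smooth_cyl_bump])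
  have n: "0 \<le> cyl_bump w" for w :: "'a \<times> real" by (simp add: cyl_bump_def bump_nonneg)
  have i: "integrable lborel (cyl_bump :: 'a \<times> real \<Rightarrow> real)"
    by (rule integrable_compact_support[OF c, of "closure unit_cylinder"])
      (use cyl_bump_eq_0 closure_subset[of "unit_cylinder :: ('a \<times> real) set"] in \<open>auto simp: bounded_unit_cylinder\<close>)
  define S :: "('a \<times> real) set" where "S = unit_cylinder"
  have pos: "0 < cyl_bump w" if "w \<in> S" for w
    using that power_strict_mono[of "norm (fst w)" 1 2] power_strict_mono[of "\<bar>snd w\<bar>" 1 2]
    by (cases w) (auto simp: S_def unit_cylinder_def cyl_bump_def bump_def expinv_pos_iff dot_square_norm power2_eq_square abs_less_iff intro!: mult_pos_pos)
  have "(LINT w|lborel. cyl_bump (w :: 'a \<times> real)) \<noteq> 0"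
  proof
    assume "(LINT w|lborel. cyl_bump (w :: 'a \<times> real)) = 0"
    then have "AE w in lborel. cyl_bump (w :: 'a \<times> real) = 0"
      using integral_nonneg_eq_0_iff_AE[OF i] n by simp
    then have "AE w in lborel. w \<notin> S" by eventually_elim (use pos in force)
    moreover have oS: "open S" unfolding S_def unit_cylinder_def by (intro open_Times) auto
    ultimately have "emeasure lborel S = 0"
      by (subst (asm) AE_iff_measurable[of S]) auto
    then have "S \<in> null_sets lborel" using oS by (intro null_setsI) auto
    then have "negligible S" by (simp add: negligible_iff_null_sets null_sets_completionI)
    then have "S = {}" using open_not_negligible[OF oS] by blast
    then show False by (auto simp: S_def unit_cylinder_def)
  qed
  moreover have "0 \<le> (LINT w|lborel. cyl_bump (w :: 'a \<times> real))" using n by (simp add: integral_nonneg_AE)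
  ultimately show ?thesis by simp
qed

text \<open>The dilation acts inside \<phi>, so differentiation in r falls on \<phi> and not on the
  bump. The average is not normalised: as r tends to 0 it tends to \<phi>(a) times the integral of
  \<open>cyl_bump\<close>.\<close>

definition avg :: "real \<Rightarrow> ('a::euclidean_space \<times> real \<Rightarrow> real) \<Rightarrow> 'a \<times> real \<Rightarrow> real \<Rightarrow> real" where
  "avg p \<phi> a r = (LINT w|lborel. \<phi> (fst a + r *\<^sub>R fst w, snd a + r powr p * snd w) * cyl_bump w)"

text \<open>This kernel and \<open>kernel_time\<close> multiply the bump by the space and time
  components of the velocity of the dilated point, up to the factor p r^(p-1) in time, as the chain
  rule produces them when \<open>avg\<close> is differentiated in r.\<close>

definition kernel_space :: "'a::euclidean_space \<times> real \<Rightarrow> 'a" where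
  "kernel_space w = cyl_bump w *\<^sub>R fst w"

definition kernel_time :: "'a::euclidean_space \<times> real \<Rightarrow> real" where
  "kernel_time w = cyl_bump w * snd w"

text \<open>The spatial gradient of \<open>kernel_time\<close>; its L^p norm is what multiplies the
  dual norm of the time derivative.\<close>

definition kernel_mixed :: "'a::euclidean_space \<times> real \<Rightarrow> 'a" where
  "kernel_mixed w = (bump (snd w) * snd w) *\<^sub>R gradient bump (fst w)"

lemma unit_cylinder_bounds: "w \<in> unit_cylinder \<Longrightarrow> norm (fst w) < 1 \<and> \<bar>snd w\<bar> < 1"
  by (auto simp: unit_cylinder_def)

lemma kernel_zero:
  assumes "w \<notin> unit_cylinder"
  shows "kernel_space w = 0" "kernel_time w = 0" "kernel_mixed w = 0"
proof -
  show "kernel_space w = 0" "kernel_time w = 0"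
    using cyl_bump_eq_0[OF assms] by (simp_all add: kernel_space_def kernel_time_def)
  have "1 \<le> norm (fst w) \<or> 1 \<le> norm (snd w)" using assms by (cases w) (auto simp: unit_cylinder_def)
  then show "kernel_mixed w = 0"
    using gradient_bump_eq_0[of "fst w"] bump_eq_0[of "snd w"] by (auto simp: kernel_mixed_def)
qed

lemma kernel_continuous:
  "continuous_on UNIV (kernel_space :: 'a::euclidean_space \<times> real \<Rightarrow> 'a)"
  "continuous_on UNIV (kernel_time :: 'a::euclidean_space \<times> real \<Rightarrow> real)"
  "continuous_on UNIV (kernel_mixed :: 'a::euclidean_space \<times> real \<Rightarrow> 'a)"
proof -
  show "continuous_on UNIV (kernel_space :: 'a::euclidean_space \<times> real \<Rightarrow> 'a)"
    "continuous_on UNIV (kernel_time :: 'a::euclidean_space \<times> real \<Rightarrow> real)"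
    unfolding kernel_space_def[abs_def] kernel_time_def[abs_def] by (intro continuous_intros)+
  have 1: "continuous_on UNIV (\<lambda>w :: 'a \<times> real. bump (snd w))"
    by (rule smooth_continuous_on[OF smooth_snd[OF smooth_bump]])
  have 2: "continuous_on UNIV (\<lambda>w :: 'a \<times> real. gradient bump (fst w))"
    by (rule continuous_on_compose2[OF continuous_on_gradient[OF smooth_bump, of UNIV]]) (auto intro: continuous_intros)
  show "continuous_on UNIV (kernel_mixed :: 'a::euclidean_space \<times> real \<Rightarrow> 'a)"
    unfolding kernel_mixed_def[abs_def] by (intro continuous_intros 1 2)
qed

lemma kernel_bounded:
  obtains B where "B > 0" "\<And>w :: 'a::euclidean_space \<times> real. norm (kernel_space w) \<le> B"
    "\<And>w :: 'a \<times> real. norm (kernel_time w) \<le> B" "\<And>w :: 'a \<times> real. norm (kernel_mixed w) \<le> B"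
proof -
  let ?K = "closure unit_cylinder :: ('a \<times> real) set"
  have K: "compact ?K" by (simp add: bounded_unit_cylinder)
  have z: "w \<notin> unit_cylinder" if "w \<notin> ?K" for w using that closure_subset by blast
  obtain B1 where B1: "B1 > 0" "\<And>w :: 'a \<times> real. norm (kernel_space w) \<le> B1"
    using bounded_compact_support[OF kernel_continuous(1) K kernel_zero(1)[OF z]] by blast
  obtain B2 where B2: "B2 > 0" "\<And>w :: 'a \<times> real. norm (kernel_time w) \<le> B2"
    using bounded_compact_support[OF kernel_continuous(2) K kernel_zero(2)[OF z]] by blast
  obtain B3 where B3: "B3 > 0" "\<And>w :: 'a \<times> real. norm (kernel_mixed w) \<le> B3"
    using bounded_compact_support[OF kernel_continuous(3) K kernel_zero(3)[OF z]] by blast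
  show ?thesis
  proof (rule that[of "B1 + B2 + B3"])
    show "norm (kernel_space w) \<le> B1 + B2 + B3" for w :: "'a \<times> real" using B1(2)[of w] B2(1) B3(1) by linarith
    show "norm (kernel_time w) \<le> B1 + B2 + B3" for w :: "'a \<times> real" using B2(2)[of w] B1(1) B3(1) by linarith
    show "norm (kernel_mixed w) \<le> B1 + B2 + B3" for w :: "'a \<times> real" using B3(2)[of w] B2(1) B1(1) by linarith
  qed (use B1(1) B2(1) B3(1) in simp)
qed

text \<open>The chain rule on r > 0, where \<open>r powr p\<close> is differentiable; the support of
  the bump supplies the box for differentiation under the integral.\<close>

lemma avg_DERIV:
  fixes \<phi> :: "'a::euclidean_space \<times> real \<Rightarrow> real" and a :: "'a \<times> real" and p :: real
  assumes \<phi>: "\<phi> \<in> test_functions \<Omega>" and r: "0 < r"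
  defines "pt \<equiv> \<lambda>r w. (fst a + r *\<^sub>R fst w, snd a + r powr p * snd w)"
  shows "(avg p \<phi> a has_real_derivative
    (LINT w|lborel. (space_gradient \<phi> (pt r w) \<bullet> fst w + time_derivative \<phi> (pt r w) * (p * r powr (p - 1) * snd w)) * cyl_bump w)) (at r)"
proof -
  have sm: "smooth \<phi>" by (rule test_function_smooth[OF \<phi>])
  obtain c where c: "unit_cylinder \<subseteq> cbox (- c) (c :: 'a \<times> real)"
    using bounded_subset_cbox_symmetric[OF bounded_unit_cylinder] by blast
  have z: "cyl_bump w = 0" if "w \<notin> cbox (- c) c" for w :: "'a \<times> real"
    using that c cyl_bump_eq_0 by blast
  have cpt: "continuous_on ({0<..} \<times> UNIV) (\<lambda>x. pt (fst x) (snd x))"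
    unfolding pt_def by (intro continuous_intros) auto
  have "((\<lambda>r. LINT w|lborel. \<phi> (pt r w) * cyl_bump w) has_real_derivative
    (LINT w|lborel. (space_gradient \<phi> (pt r w) \<bullet> fst w + time_derivative \<phi> (pt r w) * (p * r powr (p - 1) * snd w)) * cyl_bump w)) (at r)"
  proof (rule DERIV_lborel_integral[where U = "{0<..}" and a = "-c" and b = c])
    fix r :: real and w :: "'a \<times> real" assume "r \<in> {0<..}"
    then have r: "r > 0" by simp
    have "((\<lambda>r. pt r w) has_derivative (\<lambda>k. (k *\<^sub>R fst w, k * (p * r powr (p - 1) * snd w)))) (at r)"
    proof -
      have "((\<lambda>r. r powr p) has_derivative (\<lambda>k. p * r powr (p - 1) * k)) (at r)"
        using has_real_derivative_powr[OF r, of p] by (simp add: has_field_derivative_def)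
      then have "((\<lambda>r. snd a + r powr p * snd w) has_derivative (\<lambda>k. 0 + p * r powr (p - 1) * k * snd w)) (at r)"
        by (intro has_derivative_add has_derivative_const has_derivative_mult_left)
      moreover have "((\<lambda>r. fst a + r *\<^sub>R fst w) has_derivative (\<lambda>k. k *\<^sub>R fst w)) (at r)"
        by (auto intro!: derivative_eq_intros)
      ultimately have "((\<lambda>r. pt r w) has_derivative (\<lambda>k. (k *\<^sub>R fst w, 0 + p * r powr (p - 1) * k * snd w))) (at r)"
        unfolding pt_def by (intro has_derivative_Pair)
      also have "(\<lambda>k. (k *\<^sub>R fst w, 0 + p * r powr (p - 1) * k * snd w)) = (\<lambda>k. (k *\<^sub>R fst w, k * (p * r powr (p - 1) * snd w)))"
        by (simp add: fun_eq_iff)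
      finally show ?thesis .
    qed
    then have d: "((\<lambda>r. \<phi> (pt r w)) has_derivative
        (\<lambda>k. frechet_derivative \<phi> (at (pt r w)) (k *\<^sub>R fst w, k * (p * r powr (p - 1) * snd w)))) (at r)"
      using diff_chain_at[OF _ smooth_has_derivative[OF sm], of "\<lambda>r. pt r w" _ r] by (simp add: o_def)
    let ?D = "space_gradient \<phi> (pt r w) \<bullet> fst w + time_derivative \<phi> (pt r w) * (p * r powr (p - 1) * snd w)"
    have eq: "frechet_derivative \<phi> (at (pt r w)) (k *\<^sub>R fst w, k * (p * r powr (p - 1) * snd w)) = ?D * k" for k
      by (simp add: frechet_space_time[OF sm] algebra_simps)
    have "((\<lambda>r. \<phi> (pt r w)) has_real_derivative ?D) (at r)"
      using d unfolding has_field_derivative_def eq .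
    then show "((\<lambda>r. \<phi> (pt r w) * cyl_bump w) has_real_derivative ?D * cyl_bump w) (at r)"
      by (rule DERIV_cmult_right)
  next
    fix r :: real assume "r \<in> {0<..}"
    have "continuous_on UNIV (pt r)" unfolding pt_def by (intro continuous_intros)
    then have "continuous_on UNIV (\<lambda>w. \<phi> (pt r w))"
      using continuous_on_compose2[OF smooth_continuous_on[OF sm, of UNIV]] by blast
    then show "continuous_on UNIV (\<lambda>w. \<phi> (pt r w) * cyl_bump w)" by (intro continuous_intros)
  next
    have 1: "continuous_on ({0<..} \<times> UNIV) (\<lambda>x. space_gradient \<phi> (pt (fst x) (snd x)))"
      by (rule continuous_on_compose2[OF continuous_on_space_gradient[OF sm, of UNIV] cpt]) auto
    have 2: "continuous_on ({0<..} \<times> UNIV) (\<lambda>x. time_derivative \<phi> (pt (fst x) (snd x)))"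
      by (rule continuous_on_compose2[OF smooth_continuous_on[OF test_function_smooth[OF test_function_time_derivative[OF \<phi>]], of UNIV] cpt]) auto
    show "continuous_on ({0<..} \<times> UNIV) (\<lambda>(r, w). (space_gradient \<phi> (pt r w) \<bullet> fst w +
        time_derivative \<phi> (pt r w) * (p * r powr (p - 1) * snd w)) * cyl_bump w)"
      unfolding case_prod_unfold by (intro continuous_intros 1 2) auto
  qed (use r z in auto)
  then show ?thesis by (simp add: avg_def[abs_def] pt_def)
qed

lemma kernel_sum_continuous:
  assumes "continuous_on UNIV k"
  shows "continuous_on S (kernel_sum p P m r k)"
  unfolding kernel_sum_def[abs_def]
  by (intro continuous_intros continuous_on_compose2[OF assms continuous_rescale]) auto

text \<open>A space derivative of the dilated kernel costs 1/r. The time factor is constant on a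
  slice, so only the bump in the space variable is differentiated. These are the facts that make the
  kernel sum admissible in \<open>time_derivative_pairing\<close>.\<close>

lemma kernel_time_gradient:
  fixes P :: "('a::euclidean_space \<times> real) set"
  assumes r: "0 < r"
  shows "smooth (\<lambda>x. kernel_sum p P m r kernel_time (x, t))"
    and "space_gradient (kernel_sum p P m r kernel_time) = (\<lambda>z. (1 / r) *\<^sub>R kernel_sum p P m r kernel_mixed z)"
proof -
  have eq: "kernel_sum p P m r kernel_time (x, t) =
      (\<Sum>a\<in>P. (m a * (bump ((t - snd a) / r powr p) * ((t - snd a) / r powr p))) * bump ((x - fst a) /\<^sub>R r))" for x t
    unfolding kernel_sum_def rescale_def kernel_time_def cyl_bump_def fst_conv snd_conv real_scaleR_def
    by (intro sum.cong refl) (simp only: ac_simps)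
  show "smooth (\<lambda>x. kernel_sum p P m r kernel_time (x, t))"
    unfolding eq by (intro smooth_sum smooth_mult smooth_const smooth_scale smooth_bump)
  have b: "((\<lambda>x. bump ((x - x0) /\<^sub>R r)) has_derivative (\<lambda>v. (gradient bump ((x - x0) /\<^sub>R r) /\<^sub>R r) \<bullet> v)) (at x)" for x x0 :: 'a
  proof -
    have 1: "((\<lambda>x. (x - x0) /\<^sub>R r) has_derivative (\<lambda>v. v /\<^sub>R r)) (at x)"
      by (auto intro!: derivative_eq_intros)
    show ?thesis
      using diff_chain_at[OF 1 smooth_has_derivative[OF smooth_bump]]
      by (simp add: o_def frechet_eq_gradient[OF smooth_differentiable[OF smooth_bump]])
  qed
  show "space_gradient (kernel_sum p P m r kernel_time) = (\<lambda>z. (1 / r) *\<^sub>R kernel_sum p P m r kernel_mixed z)"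
  proof
    fix z :: "'a \<times> real"
    obtain x t where z: "z = (x, t)" by (cases z)
    have "((\<lambda>x. kernel_sum p P m r kernel_time (x, t)) has_derivative
      (\<lambda>v. \<Sum>a\<in>P. (m a * (bump ((t - snd a) / r powr p) * ((t - snd a) / r powr p))) *
        ((gradient bump ((x - fst a) /\<^sub>R r) /\<^sub>R r) \<bullet> v))) (at x)"
      unfolding eq by (intro has_derivative_sum has_derivative_mult_right b)
    also have "(\<lambda>v. \<Sum>a\<in>P. (m a * (bump ((t - snd a) / r powr p) * ((t - snd a) / r powr p))) *
        ((gradient bump ((x - fst a) /\<^sub>R r) /\<^sub>R r) \<bullet> v)) =
        (\<lambda>v. ((1 / r) *\<^sub>R kernel_sum p P m r kernel_mixed z) \<bullet> v)"
      by (simp add: kernel_sum_def rescale_def kernel_mixed_def z inner_sum_left sum_distrib_left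
          divide_inverse mult.assoc mult.left_commute)
    finally show "space_gradient (kernel_sum p P m r kernel_time) z = (1 / r) *\<^sub>R kernel_sum p P m r kernel_mixed z"
      unfolding space_gradient_def z prod.case by (rule gradient_eqI)
  qed
qed

text \<open>Substituting z for the dilated point turns the derivative of each average into an
  integral over z against dilated kernels; summing over P produces \<open>kernel_sum\<close>, and
  the Jacobian is the denominator. The integrals restrict to any Borel set \<open>U\<close> that
  contains the cylinders, as the kernels vanish outside them.\<close>

lemma avg_sum_DERIV:
  fixes \<phi> :: "'a::euclidean_space \<times> real \<Rightarrow> real"
  assumes \<phi>: "\<phi> \<in> test_functions \<Omega>" and r: "0 < r"
    and U: "U \<in> sets borel" "\<And>a. a \<in> P \<Longrightarrow> pcyl p a r \<subseteq> U"
  shows "((\<lambda>r. \<Sum>a\<in>P. m a * avg p \<phi> a r) has_real_derivative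
    ((LINT z|leb U. space_gradient \<phi> z \<bullet> kernel_sum p P m r kernel_space z) +
     p * r powr (p - 1) * (LINT z|leb U. time_derivative \<phi> z * kernel_sum p P m r kernel_time z))
      / (r ^ DIM('a) * r powr p)) (at r)"
proof -
  have sm: "smooth \<phi>" by (rule test_function_smooth[OF \<phi>])
  obtain K where K: "compact K" "\<And>z. z \<notin> K \<Longrightarrow> space_gradient \<phi> z = 0" "\<And>z. z \<notin> K \<Longrightarrow> time_derivative \<phi> z = 0"
    using test_function_support[OF \<phi>] by metis
  have cs: "continuous_on UNIV (space_gradient \<phi>)" by (rule continuous_on_space_gradient[OF sm])
  have ct: "continuous_on UNIV (time_derivative \<phi>)"
    by (rule smooth_continuous_on[OF test_function_smooth[OF test_function_time_derivative[OF \<phi>]]])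
  define f where "f z w = (space_gradient \<phi> z \<bullet> fst w + time_derivative \<phi> z * (p * r powr (p - 1) * snd w)) * cyl_bump w" for z w
  have cf: "continuous_on UNIV (\<lambda>z. f z (rescale p r a z))" for a
    unfolding f_def by (intro continuous_intros cs ct continuous_rescale)
  have f_alt: "f z w = space_gradient \<phi> z \<bullet> kernel_space w + p * r powr (p - 1) * (time_derivative \<phi> z * kernel_time w)" for z w
    by (simp add: f_def kernel_space_def kernel_time_def algebra_simps)
  have fi: "integrable lborel (\<lambda>z. f z (rescale p r a z))" for a
    by (rule integrable_compact_support[OF cf K(1)]) (simp add: f_def K)
  have "((\<lambda>r. \<Sum>a\<in>P. m a * avg p \<phi> a r) has_real_derivative
      (\<Sum>a\<in>P. m a * (LINT w|lborel. f (fst a + r *\<^sub>R fst w, snd a + r powr p * snd w) w))) (at r)"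
    unfolding f_def by (intro DERIV_sum DERIV_cmult avg_DERIV[OF \<phi> r])
  also have "(\<Sum>a\<in>P. m a * (LINT w|lborel. f (fst a + r *\<^sub>R fst w, snd a + r powr p * snd w) w)) =
      (\<Sum>a\<in>P. m a * (LINT z|lborel. f z (rescale p r a z))) / (r ^ DIM('a) * r powr p)"
    unfolding sum_divide_distrib
    by (intro sum.cong refl) (simp add: rescale_integral borel_measurable_continuous_onI[OF cf] r)
  also have "(\<Sum>a\<in>P. m a * (LINT z|lborel. f z (rescale p r a z))) = (LINT z|lborel. (\<Sum>a\<in>P. m a * f z (rescale p r a z)))"
    using fi by (subst Bochner_Integration.integral_sum) auto
  also have "\<dots> = (LINT z|lborel. space_gradient \<phi> z \<bullet> kernel_sum p P m r kernel_space z +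
      p * r powr (p - 1) * (time_derivative \<phi> z * kernel_sum p P m r kernel_time z))"
    unfolding f_alt kernel_sum_def
    by (simp add: inner_sum_right sum.distrib sum_distrib_left distrib_left mult.assoc mult.left_commute)
  also have "\<dots> = (LINT z|lborel. space_gradient \<phi> z \<bullet> kernel_sum p P m r kernel_space z) +
      p * r powr (p - 1) * (LINT z|lborel. time_derivative \<phi> z * kernel_sum p P m r kernel_time z)"
  proof -
    have "integrable lborel (\<lambda>z. space_gradient \<phi> z \<bullet> kernel_sum p P m r kernel_space z)"
      by (rule integrable_compact_support[OF _ K(1)])
        (auto simp: K intro!: continuous_intros cs kernel_sum_continuous kernel_continuous)
    moreover have "integrable lborel (\<lambda>z. time_derivative \<phi> z * kernel_sum p P m r kernel_time z)"
      by (rule integrable_compact_support[OF _ K(1)])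
        (auto simp: K intro!: continuous_intros ct kernel_sum_continuous kernel_continuous)
    ultimately show ?thesis by simp
  qed
  also have "(LINT z|lborel. space_gradient \<phi> z \<bullet> kernel_sum p P m r kernel_space z) =
      (LINT z|leb U. space_gradient \<phi> z \<bullet> kernel_sum p P m r kernel_space z)"
  proof (rule integral_leb_eq[OF U(1), symmetric])
    fix z assume "z \<notin> U"
    then have "kernel_sum p P m r kernel_space z = 0" using U(2) by (intro kernel_sum_support r kernel_zero) blast+
    then show "space_gradient \<phi> z \<bullet> kernel_sum p P m r kernel_space z = 0" by simp
  qed
  also have "(LINT z|lborel. time_derivative \<phi> z * kernel_sum p P m r kernel_time z) =
      (LINT z|leb U. time_derivative \<phi> z * kernel_sum p P m r kernel_time z)"
  proof (rule integral_leb_eq[OF U(1), symmetric])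
    fix z assume "z \<notin> U"
    then have "kernel_sum p P m r kernel_time z = 0" using U(2) by (intro kernel_sum_support r kernel_zero) blast+
    then show "time_derivative \<phi> z * kernel_sum p P m r kernel_time z = 0" by simp
  qed
  finally show ?thesis .
qed

section \<open>Uniform estimate for discrete measures with growth\<close>

definition WM_gradient_norm :: "real \<Rightarrow> 'a::euclidean_space set \<Rightarrow> real \<Rightarrow> ('a \<times> real \<Rightarrow> real) \<Rightarrow> real" where
  "WM_gradient_norm p \<Omega> T \<phi> = Lp_norm (leb (\<Omega> \<times> {0<..<T})) p (space_gradient \<phi>)"

definition WM_time_norm :: "real \<Rightarrow> 'a::euclidean_space set \<Rightarrow> real \<Rightarrow> ('a \<times> real \<Rightarrow> real) \<Rightarrow> real" where
  "WM_time_norm p \<Omega> T \<phi> =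
    Lp_norm (leb {0<..<T}) (p / (p - 1)) (\<lambda>t. dual_norm p \<Omega> (\<lambda>x. time_derivative \<phi> (x, t)))"

definition WM_sup_norm :: "'a::euclidean_space set \<Rightarrow> real \<Rightarrow> ('a \<times> real \<Rightarrow> real) \<Rightarrow> real" where
  "WM_sup_norm \<Omega> T \<phi> =
    real_of_ereal (esssup (leb {0<..<T}) (\<lambda>t. ereal (Lp_norm (leb \<Omega>) 2 (\<lambda>x. \<phi> (x, t)))))"

lemma WM_norm_eq: "WM_norm p \<Omega> T \<phi> = WM_gradient_norm p \<Omega> T \<phi> + WM_time_norm p \<Omega> T \<phi> + WM_sup_norm \<Omega> T \<phi>"
  by (simp add: WM_norm_def WM_gradient_norm_def WM_time_norm_def WM_sup_norm_def)

text \<open>A negative essential supremum would contradict the nonnegativity of the norms on the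
  time interval, which has positive length. An infinite value is read as 0 by
  \<open>real_of_ereal\<close>, which agrees with the claim.\<close>

lemma WM_sup_norm_nonneg:
  assumes T: "0 < T"
  shows "0 \<le> WM_sup_norm \<Omega> T \<phi>"
proof -
  let ?M = "leb {0<..<T}" and ?f = "\<lambda>t. ereal (Lp_norm (leb \<Omega>) 2 (\<lambda>x. \<phi> (x, t)))"
  have "0 \<le> esssup ?M ?f"
  proof (rule ccontr)
    assume "\<not> 0 \<le> esssup ?M ?f"
    then have neg: "esssup ?M ?f < 0" by simp
    have "AE t in ?M. ?f t \<le> esssup ?M ?f" by (rule esssup_AE)
    then have "AE t in ?M. False"
    proof eventually_elim
      case (elim t)
      have "0 \<le> ?f t" by (simp add: Lp_norm_nonneg)
      then show ?case using elim neg by (meson le_less_trans not_le)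
    qed
    then have "emeasure ?M (space ?M) = 0" by (simp add: eventually_False ae_filter_eq_bot_iff)
    then show False using T by (simp add: space_restrict_space emeasure_restrict_space)
  qed
  then show ?thesis unfolding WM_sup_norm_def by (rule real_of_ereal_pos)
qed

lemma WM_time_norm_nonneg: "0 \<le> WM_time_norm p \<Omega> T \<phi>"
  and WM_gradient_norm_nonneg: "0 \<le> WM_gradient_norm p \<Omega> T \<phi>"
  by (simp_all add: WM_time_norm_def WM_gradient_norm_def Lp_norm_nonneg)

text \<open>Collects the powers of r in the bound of \<open>kernel_sum_bounds\<close> once D is C
  r^s: the sup bound contributes r^(s(q-1)), the volume r^(n+p), and the q-th root is taken at the
  end.\<close>

lemma growth_exponent:
  fixes B C v r s p q n :: real
  assumes "0 < r" "0 \<le> B" "0 \<le> C" "0 \<le> v" "0 < q"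
  shows "((B * (C * r powr s)) powr (q - 1) * (B * v * (r powr n * r powr p))) powr (1 / q) =
    ((B * C) powr (q - 1) * (B * v)) powr (1 / q) * r powr ((s * (q - 1) + n + p) / q)"
proof -
  define X where "X = (B * C) powr (q - 1) * (B * v)"
  have "r powr (s * (q - 1)) * (r powr n * r powr p) = r powr (s * (q - 1) + n + p)"
    by (simp add: powr_add)
  moreover have "(B * (C * r powr s)) powr (q - 1) = (B * C) powr (q - 1) * r powr (s * (q - 1))"
    by (simp add: powr_mult powr_powr)
  ultimately have "(B * (C * r powr s)) powr (q - 1) * (B * v * (r powr n * r powr p)) =
      X * r powr (s * (q - 1) + n + p)"
    by (simp only: X_def) (simp add: mult.assoc mult.left_commute)
  then have "((B * (C * r powr s)) powr (q - 1) * (B * v * (r powr n * r powr p))) powr (1 / q) =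
      (X * r powr (s * (q - 1) + n + p)) powr (1 / q)"
    by (rule arg_cong)
  also have "\<dots> = X powr (1 / q) * r powr ((s * (q - 1) + n + p) / q)"
    by (simp add: powr_mult powr_powr)
  finally show ?thesis by (simp only: X_def)
qed

text \<open>Two dualities. The gradient term pairs by Hoelder with the L^q norm of a kernel sum, q =
  p/(p-1); the time term pairs by \<open>time_derivative_pairing\<close> with the L^p norm of the
  spatial gradient of another. After division by r^(n+p), the growth exponent s leaves r^((s-n)/p -
  1) and r^((s-n)(1-1/p) - 1), and for r <= 1 both are at most r^(\<alpha>-1).\<close>

lemma avg_sum_deriv_bound:
  fixes \<Omega> :: "'a::euclidean_space set"
  assumes \<Omega>: "open \<Omega>" "bounded \<Omega>" and p: "1 < p" and T: "0 < T"
    and \<phi>: "\<phi> \<in> test_functions \<Omega>"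
    and B: "B > 0" "\<And>w :: 'a \<times> real. norm (kernel_space w) \<le> B"
      "\<And>w :: 'a \<times> real. norm (kernel_time w) \<le> B" "\<And>w :: 'a \<times> real. norm (kernel_mixed w) \<le> B"
    and C: "0 \<le> C"
  defines "v \<equiv> measure lborel (unit_cylinder :: ('a \<times> real) set)" and "q \<equiv> p / (p - 1)"
    and "n \<equiv> real DIM('a)"
  defines "A \<equiv> ((B * C) powr (q - 1) * (B * v)) powr (1 / q) + p * ((B * C) powr (p - 1) * (B * v)) powr (1 / p)"
  assumes P: "finite P" and m: "\<And>a. 0 \<le> m a" "sum m P = 1" and r: "0 < r" "r \<le> 1"
    and growth: "\<And>z. sum m (P \<inter> pcyl p z r) \<le> C * r powr s"
    and dom: "\<And>a. a \<in> P \<Longrightarrow> cball (fst a) r \<subseteq> \<Omega>" "\<And>a. a \<in> P \<Longrightarrow> pcyl p a r \<subseteq> \<Omega> \<times> {0<..<T}"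
    and \<alpha>: "\<alpha> \<le> (s - n) / p" "\<alpha> \<le> (s - n) * (1 - 1 / p)"
  shows "\<bar>((LINT z|leb (\<Omega> \<times> {0<..<T}). space_gradient \<phi> z \<bullet> kernel_sum p P m r kernel_space z) +
     p * r powr (p - 1) * (LINT z|leb (\<Omega> \<times> {0<..<T}). time_derivative \<phi> z * kernel_sum p P m r kernel_time z))
      / (r ^ DIM('a) * r powr p)\<bar> \<le>
    A * r powr (\<alpha> - 1) * (WM_gradient_norm p \<Omega> T \<phi> + WM_time_norm p \<Omega> T \<phi>)"
proof -
  let ?U = "\<Omega> \<times> {0<..<T}"
  define N1 where "N1 = WM_gradient_norm p \<Omega> T \<phi>"
  define N2 where "N2 = WM_time_norm p \<Omega> T \<phi>"
  have N: "0 \<le> N1" "0 \<le> N2" by (simp_all add: N1_def N2_def WM_time_norm_nonneg WM_gradient_norm_nonneg)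
  have q: "1 < q" "1 / p + 1 / q = 1" using p by (simp_all add: q_def field_simps)
  have v0: "0 \<le> v" by (simp add: v_def)
  have U: "?U \<in> sets borel" "bounded ?U"
    using \<Omega> by (auto intro!: borel_Times bounded_Times)
  have rn: "r ^ DIM('a) = r powr n" using r by (simp add: n_def powr_realpow)
  have rnp: "r powr n * r powr p = r powr (n + p)" by (simp add: powr_add)
  have meas: "kernel_space \<in> borel_measurable (borel :: ('a \<times> real) measure)"
    "kernel_time \<in> borel_measurable (borel :: ('a \<times> real) measure)"
    "kernel_mixed \<in> borel_measurable (borel :: ('a \<times> real) measure)"
    by (intro borel_measurable_continuous_onI kernel_continuous)+
  note S = kernel_sum_bounds[OF meas(1) B(2) kernel_zero(1) P m r(1) growth q(1) U]
  note M = kernel_sum_bounds[OF meas(3) B(4) kernel_zero(3) P m r(1) growth p U]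
  note Tm = kernel_sum_bounds[OF meas(2) B(3) kernel_zero(2) P m r(1) growth p U]
  have r_le: "r powr \<beta> \<le> r powr (\<alpha> - 1)" if "\<alpha> - 1 \<le> \<beta>" for \<beta>
    using that r by (intro powr_mono') auto
  define A1 where "A1 = ((B * C) powr (q - 1) * (B * v)) powr (1 / q)"
  define A2 where "A2 = ((B * C) powr (p - 1) * (B * v)) powr (1 / p)"
  have A12: "0 \<le> A1" "0 \<le> A2" "A = A1 + p * A2" by (simp_all add: A1_def A2_def A_def)
  have mg: "mem_Lp (leb ?U) p (space_gradient \<phi>)"
  proof -
    obtain K where K: "compact K" "\<And>z. z \<notin> K \<Longrightarrow> space_gradient \<phi> z = 0"
      using test_function_support[OF \<phi>] by metis
    have cs: "continuous_on UNIV (space_gradient \<phi>)" by (rule continuous_on_space_gradient[OF test_function_smooth[OF \<phi>]])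
    obtain B' where "\<And>z. norm (space_gradient \<phi> z) \<le> B'" using bounded_compact_support[OF cs K] by blast
    then show ?thesis
      using p by (intro mem_Lp_bounded[OF finite_measure_leb[OF U(2,1)] borel_measurable_leb[OF borel_measurable_continuous_onI[OF cs]]]) auto
  qed
  have t1: "\<bar>LINT z|leb ?U. space_gradient \<phi> z \<bullet> kernel_sum p P m r kernel_space z\<bar> / r powr (n + p) \<le> A1 * r powr (\<alpha> - 1) * N1"
  proof -
    have "\<bar>LINT z|leb ?U. space_gradient \<phi> z \<bullet> kernel_sum p P m r kernel_space z\<bar> \<le> N1 * Lp_norm (leb ?U) q (kernel_sum p P m r kernel_space)"
      unfolding N1_def WM_gradient_norm_def by (rule Holder_inner(2)[OF p q(2) mg S(2)])
    also have "\<dots> \<le> N1 * (A1 * r powr ((s * (q - 1) + n + p) / q))"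
      using S(3) growth_exponent[of r B C v q s n p] r B C v0 q N
      by (intro mult_left_mono) (simp_all add: A1_def v_def rn)
    finally have "\<bar>LINT z|leb ?U. space_gradient \<phi> z \<bullet> kernel_sum p P m r kernel_space z\<bar> / r powr (n + p) \<le>
        N1 * (A1 * r powr ((s * (q - 1) + n + p) / q)) / r powr (n + p)"
      by (rule divide_right_mono) simp
    also have "\<dots> = N1 * A1 * r powr ((s * (q - 1) + n + p) / q - (n + p))"
      by (simp add: powr_diff)
    also have "(s * (q - 1) + n + p) / q - (n + p) = (s - n) / p - 1"
      using p by (simp add: q_def field_simps)
    also have "N1 * A1 * r powr ((s - n) / p - 1) \<le> N1 * A1 * r powr (\<alpha> - 1)"
      using \<alpha> N A12 by (intro mult_left_mono r_le) auto
    finally show ?thesis by (simp add: mult.assoc mult.left_commute mult.commute)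
  qed
  have G: "space_gradient (kernel_sum p P m r kernel_time) = (\<lambda>z. (1 / r) *\<^sub>R kernel_sum p P m r kernel_mixed z)"
    by (rule kernel_time_gradient(2)[OF r(1)])
  \<comment> \<open>Each slice of the kernel sum is supported in finitely many closed balls inside
    the domain, which makes it a test function in space.\<close>
  have W: "(\<lambda>x. kernel_sum p P m r kernel_time (x, t)) \<in> Cc_infinity \<Omega>" for t
  proof (rule Cc_infinityI[of _ "\<Union>a\<in>P. cball (fst a) r"])
    show "kernel_sum p P m r kernel_time (x, t) = 0" if "x \<notin> (\<Union>a\<in>P. cball (fst a) r)" for x
    proof (rule kernel_sum_support[OF r(1) kernel_zero(2)])
      fix a assume "a \<in> P"
      then show "(x, t) \<notin> pcyl p a r" using that by (cases a) (force simp: mem_pcyl)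
    qed
  qed (use P dom(1) in \<open>auto intro!: compact_UN kernel_time_gradient r\<close>)
  define D where "D = B * (C * r powr s)"
  have t2: "\<bar>LINT z|leb ?U. time_derivative \<phi> z * kernel_sum p P m r kernel_time z\<bar> \<le>
      N2 * ((1 / r) * Lp_norm (leb ?U) p (kernel_sum p P m r kernel_mixed))"
  proof -
    have "\<bar>LINT z|leb ?U. time_derivative \<phi> z * kernel_sum p P m r kernel_time z\<bar> \<le>
        N2 * Lp_norm (leb ?U) p (space_gradient (kernel_sum p P m r kernel_time))"
      unfolding N2_def WM_time_norm_def
    proof (rule time_derivative_pairing[OF \<Omega> p T \<phi> W])
      show "kernel_sum p P m r kernel_time \<in> borel_measurable borel" by (rule kernel_sum_measurable[OF meas(2)])
      have D0: "0 \<le> D" using B(1) C by (simp add: D_def)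
      \<comment> \<open>\<open>time_derivative_pairing\<close> asks for one bound on the function
        and on its gradient; D and D/r bound them separately.\<close>
      show "\<bar>kernel_sum p P m r kernel_time z\<bar> \<le> D + D / r" for z
        using Tm(1)[of z] D0 r by (auto simp: D_def intro: order_trans)
      show "space_gradient (kernel_sum p P m r kernel_time) \<in> borel_measurable borel"
        unfolding G by (intro borel_measurable_scaleR borel_measurable_const kernel_sum_measurable[OF meas(3)])
      have "norm (kernel_sum p P m r kernel_mixed z) / r \<le> D / r" for z
        using M(1)[of z] r by (intro divide_right_mono) (auto simp: D_def)
      moreover have "norm (space_gradient (kernel_sum p P m r kernel_time) z) = norm (kernel_sum p P m r kernel_mixed z) / r" for z
        unfolding G using r by simp
      ultimately show "norm (space_gradient (kernel_sum p P m r kernel_time) z) \<le> D + D / r" for z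
        using D0 by (metis add_increasing)
    qed
    then show ?thesis unfolding G using Lp_norm_scale[of p "leb ?U" "1 / r" "kernel_sum p P m r kernel_mixed"] p r by simp
  qed
  have t3: "p * r powr (p - 1) * \<bar>LINT z|leb ?U. time_derivative \<phi> z * kernel_sum p P m r kernel_time z\<bar> / r powr (n + p) \<le>
      p * A2 * r powr (\<alpha> - 1) * N2"
  proof -
    have "\<bar>LINT z|leb ?U. time_derivative \<phi> z * kernel_sum p P m r kernel_time z\<bar> \<le>
        N2 * ((1 / r) * (A2 * r powr ((s * (p - 1) + n + p) / p)))"
    proof (rule order_trans[OF t2])
      have "Lp_norm (leb ?U) p (kernel_sum p P m r kernel_mixed) \<le> A2 * r powr ((s * (p - 1) + n + p) / p)"
        using M(3) growth_exponent[of r B C v p s n p] r B C v0 p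
        by (simp add: A2_def v_def rn)
      then show "N2 * ((1 / r) * Lp_norm (leb ?U) p (kernel_sum p P m r kernel_mixed)) \<le>
        N2 * ((1 / r) * (A2 * r powr ((s * (p - 1) + n + p) / p)))"
        using r N by (intro mult_left_mono) auto
    qed
    then have "p * r powr (p - 1) * \<bar>LINT z|leb ?U. time_derivative \<phi> z * kernel_sum p P m r kernel_time z\<bar> / r powr (n + p) \<le>
        p * r powr (p - 1) * (N2 * ((1 / r) * (A2 * r powr ((s * (p - 1) + n + p) / p)))) / r powr (n + p)"
      using p by (intro divide_right_mono mult_left_mono) auto
    also have "\<dots> = p * A2 * N2 * (r powr (p - 1) * (1 / r powr 1) * r powr ((s * (p - 1) + n + p) / p) / r powr (n + p))"
      using r by simp
    also have "r powr (p - 1) * (1 / r powr 1) * r powr ((s * (p - 1) + n + p) / p) / r powr (n + p) =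
        r powr (p - 1 - 1 + (s * (p - 1) + n + p) / p - (n + p))"
      by (simp only: powr_add powr_diff) simp
    also have "p - 1 - 1 + (s * (p - 1) + n + p) / p - (n + p) = (s - n) * (1 - 1 / p) - 1"
      using p by (simp add: field_simps)
    also have "p * A2 * N2 * r powr ((s - n) * (1 - 1 / p) - 1) \<le> p * A2 * N2 * r powr (\<alpha> - 1)"
      using \<alpha> N A12 p by (intro mult_left_mono r_le) auto
    finally show ?thesis by (simp add: mult.assoc mult.left_commute mult.commute)
  qed
  define I1 where "I1 = (LINT z|leb ?U. space_gradient \<phi> z \<bullet> kernel_sum p P m r kernel_space z)"
  define I2 where "I2 = (LINT z|leb ?U. time_derivative \<phi> z * kernel_sum p P m r kernel_time z)"
  have "\<bar>(I1 + p * r powr (p - 1) * I2) / (r ^ DIM('a) * r powr p)\<bar> = \<bar>I1 + p * r powr (p - 1) * I2\<bar> / r powr (n + p)"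
    by (simp add: rn rnp)
  also have "\<dots> \<le> (\<bar>I1\<bar> + p * r powr (p - 1) * \<bar>I2\<bar>) / r powr (n + p)"
    using abs_triangle_ineq[of I1 "p * r powr (p - 1) * I2"] p by (intro divide_right_mono) (auto simp: abs_mult)
  also have "\<dots> = \<bar>I1\<bar> / r powr (n + p) + p * r powr (p - 1) * \<bar>I2\<bar> / r powr (n + p)"
    by (rule add_divide_distrib)
  also have "\<dots> \<le> A1 * r powr (\<alpha> - 1) * N1 + p * A2 * r powr (\<alpha> - 1) * N2"
    using t1 t3 by (simp add: I1_def I2_def)
  also have "\<dots> \<le> A * r powr (\<alpha> - 1) * N1 + A * r powr (\<alpha> - 1) * N2"
    using A12 N p by (intro add_mono mult_right_mono) auto
  finally show ?thesis by (simp add: I1_def I2_def N1_def N2_def distrib_left)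
qed

text \<open>At one fixed scale the average is at most a constant times the L^1 norm of \<phi>, which
  Poincare's inequality on every time slice bounds by the gradient. This anchors the integration in
  r at its upper end.\<close>

lemma avg_initial_bound:
  fixes \<Omega> :: "'a::euclidean_space set"
  assumes \<Omega>: "open \<Omega>" "bounded \<Omega>" and p: "1 < p" and r: "0 < r"
  obtains A where "A > 0"
    "\<And>\<phi> a. \<phi> \<in> test_functions \<Omega> \<Longrightarrow> pcyl p a r \<subseteq> \<Omega> \<times> {0<..<T} \<Longrightarrow> \<bar>avg p \<phi> a r\<bar> \<le> A * WM_gradient_norm p \<Omega> T \<phi>"
proof -
  let ?U = "\<Omega> \<times> {0<..<T}"
  have U: "?U \<in> sets borel" "bounded ?U"
    using \<Omega> by (auto intro!: borel_Times bounded_Times)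
  have bor: "\<Omega> \<in> sets borel" "{0<..<T} \<in> sets borel" using \<Omega> by auto
  obtain C where C: "C > 0" "\<And>\<phi>. \<phi> \<in> Cc_infinity \<Omega> \<Longrightarrow> (LINT x|leb \<Omega>. \<bar>\<phi> x\<bar>) \<le> C * (LINT x|leb \<Omega>. norm (gradient \<phi> x))"
    using poincare_L1_sobolev[OF \<Omega> p] by metis
  have fin: "finite_measure (leb ?U)" by (rule finite_measure_leb[OF U(2,1)])
  define A where "A = C * measure (leb ?U) (space (leb ?U)) powr (1 - 1 / p) / (r ^ DIM('a) * r powr p)"
  have A0: "A \<ge> 0" using C(1) r by (simp add: A_def)
  have "\<bar>avg p \<phi> a r\<bar> \<le> (A + 1) * WM_gradient_norm p \<Omega> T \<phi>"
    if \<phi>: "\<phi> \<in> test_functions \<Omega>" and a: "pcyl p a r \<subseteq> ?U" for \<phi> a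
  proof -
    have sm: "smooth \<phi>" by (rule test_function_smooth[OF \<phi>])
    obtain K where K: "compact K" "\<And>z. z \<notin> K \<Longrightarrow> \<phi> z = 0" "\<And>z. z \<notin> K \<Longrightarrow> space_gradient \<phi> z = 0"
      using test_function_support[OF \<phi>] by metis
    have c: "continuous_on UNIV \<phi>" by (rule smooth_continuous_on[OF sm])
    have cs: "continuous_on UNIV (space_gradient \<phi>)" by (rule continuous_on_space_gradient[OF sm])
    have i\<phi>: "integrable (leb ?U) (\<lambda>z. \<bar>\<phi> z\<bar>)"
      using integrable_leb[OF U(1) integrable_compact_support[OF c K(1,2)]] by simp
    have ig: "integrable (leb ?U) (\<lambda>z. norm (space_gradient \<phi> z))"
      using integrable_leb[OF U(1) integrable_compact_support[OF cs K(1,3)]] by simp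
    obtain B' where B': "\<And>z. norm (space_gradient \<phi> z) \<le> B'" using bounded_compact_support[OF cs K(1,3)] by blast
    have mg: "mem_Lp (leb ?U) p (space_gradient \<phi>)"
      using p B' by (intro mem_Lp_bounded[OF fin borel_measurable_leb[OF borel_measurable_continuous_onI[OF cs]]]) auto
    have cf: "continuous_on UNIV (\<lambda>z. \<phi> z * cyl_bump (rescale p r a z))"
      by (intro continuous_intros c continuous_rescale)
    have z: "\<phi> z * cyl_bump (rescale p r a z) = 0" if "z \<notin> ?U" for z
      using that a cyl_bump_eq_0 rescale_in_unit_cylinder[OF r, of p a z] by (metis mult_zero_right subsetD)
    have "\<bar>LINT z|lborel. \<phi> z * cyl_bump (rescale p r a z)\<bar> = \<bar>LINT z|leb ?U. \<phi> z * cyl_bump (rescale p r a z)\<bar>"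
      using integral_leb_eq[of ?U "\<lambda>z. \<phi> z * cyl_bump (rescale p r a z)", OF U(1) z] by simp
    also have "\<dots> \<le> (LINT z|leb ?U. \<bar>\<phi> z * cyl_bump (rescale p r a z)\<bar>)" by (rule integral_abs_bound)
    also have "\<dots> \<le> (LINT z|leb ?U. \<bar>\<phi> z\<bar>)"
    proof (rule integral_mono'[OF i\<phi>])
      show "\<bar>\<phi> z * cyl_bump (rescale p r a z)\<bar> \<le> \<bar>\<phi> z\<bar>" for z
        using mult_le_one[OF bump_le_1 bump_nonneg bump_le_1, of "fst (rescale p r a z)" "snd (rescale p r a z)"]
        by (simp add: abs_mult cyl_bump_def bump_nonneg mult_left_le)
    qed auto
    also have "\<dots> = (LINT t|leb {0<..<T}. LINT x|leb \<Omega>. \<bar>\<phi> (x, t)\<bar>)"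
      by (rule integral_leb_Times(1)[OF bor i\<phi>])
    also have "\<dots> \<le> (LINT t|leb {0<..<T}. C * (LINT x|leb \<Omega>. norm (space_gradient \<phi> (x, t))))"
    proof (rule integral_mono)
      show "integrable (leb {0<..<T}) (\<lambda>t. C * (LINT x|leb \<Omega>. norm (space_gradient \<phi> (x, t))))"
        by (intro integrable_mult_right integral_leb_Times(2)[OF bor ig])
      show "(LINT x|leb \<Omega>. \<bar>\<phi> (x, t)\<bar>) \<le> C * (LINT x|leb \<Omega>. norm (space_gradient \<phi> (x, t)))" for t
        using C(2)[OF test_function_slice[OF \<phi>, of t]] by (simp add: space_gradient_def)
    qed (rule integral_leb_Times(2)[OF bor i\<phi>])
    also have "\<dots> = C * (LINT z|leb ?U. norm (space_gradient \<phi> z))"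
      by (simp add: integral_leb_Times(1)[OF bor ig])
    also have "\<dots> \<le> C * (measure (leb ?U) (space (leb ?U)) powr (1 - 1 / p) * WM_gradient_norm p \<Omega> T \<phi>)"
      using C(1) mem_Lp_imp_L1(2)[OF p fin mg] unfolding WM_gradient_norm_def by (intro mult_left_mono) auto
    finally have "\<bar>avg p \<phi> a r\<bar> \<le> A * WM_gradient_norm p \<Omega> T \<phi>"
      using rescale_integral[of "\<lambda>z w. \<phi> z * cyl_bump w" p r a, OF borel_measurable_continuous_onI[OF cf] r] r
      by (simp add: avg_def A_def divide_right_mono abs_divide mult.assoc)
    also have "\<dots> \<le> (A + 1) * WM_gradient_norm p \<Omega> T \<phi>"
      by (intro mult_right_mono) (auto simp: WM_gradient_norm_nonneg)
    finally show ?thesis .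
  qed
  then show ?thesis using that[of "A + 1"] A0 by simp
qed

text \<open>\<phi> is Lipschitz, and the dilated unit cylinder stays within 2 r of \<open>a\<close>,
  as \<open>r powr p\<close> <= r for r <= 1. The rate is uniform in \<open>a\<close>, which matters
  because the atoms change with the scale.\<close>

lemma avg_limit:
  fixes \<phi> :: "'a::euclidean_space \<times> real \<Rightarrow> real"
  assumes \<phi>: "\<phi> \<in> test_functions \<Omega>" and p: "1 \<le> p"
  obtains L where "L \<ge> 0"
    "\<And>a r. 0 < r \<Longrightarrow> r \<le> 1 \<Longrightarrow> \<bar>avg p \<phi> a r - \<phi> a * (LINT w|lborel. cyl_bump (w :: 'a \<times> real))\<bar> \<le> L * r"
proof -
  have \<phi>': "\<phi> \<in> Cc_infinity (\<Omega> \<times> UNIV)" using \<phi> by (simp add: test_functions_def)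
  obtain L where L: "L \<ge> 0" "\<And>z w. \<bar>\<phi> z - \<phi> w\<bar> \<le> L * dist z w" using Cc_infinity_lipschitz[OF \<phi>'] by blast
  define \<kappa> where "\<kappa> = (LINT w|lborel. cyl_bump (w :: 'a \<times> real))"
  have cb: "continuous_on UNIV (cyl_bump :: 'a \<times> real \<Rightarrow> real)" by (rule smooth_continuous_on[OF smooth_cyl_bump])
  let ?K = "closure unit_cylinder :: ('a \<times> real) set"
  have K: "compact ?K" by (simp add: bounded_unit_cylinder)
  have z: "cyl_bump w = 0" if "w \<notin> ?K" for w using that closure_subset cyl_bump_eq_0 by blast
  have ib: "integrable lborel (cyl_bump :: 'a \<times> real \<Rightarrow> real)" by (rule integrable_compact_support[OF cb K z])
  have b0: "0 \<le> cyl_bump w" for w :: "'a \<times> real" by (simp add: cyl_bump_def bump_nonneg)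
  have "\<bar>avg p \<phi> a r - \<phi> a * \<kappa>\<bar> \<le> 2 * L * \<kappa> * r" if r: "0 < r" "r \<le> 1" for a r
  proof -
    let ?pt = "\<lambda>w. (fst a + r *\<^sub>R fst w, snd a + r powr p * snd w)"
    have cpt: "continuous_on UNIV (\<lambda>w. \<phi> (?pt w))"
      by (rule continuous_on_compose2[OF Cc_infinity_continuous[OF \<phi>', of UNIV]]) (auto intro!: continuous_intros)
    have i1: "integrable lborel (\<lambda>w. \<phi> (?pt w) * cyl_bump w)"
      by (rule integrable_compact_support[OF _ K]) (auto intro!: continuous_intros cpt simp: z)
    have i2: "integrable lborel (\<lambda>w :: 'a \<times> real. \<phi> a * cyl_bump w)" using ib by simp
    have "avg p \<phi> a r - \<phi> a * \<kappa> = (LINT w|lborel. \<phi> (?pt w) * cyl_bump w - \<phi> a * cyl_bump w)"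
      using i1 i2 by (simp add: avg_def \<kappa>_def)
    also have "\<bar>\<dots>\<bar> \<le> (LINT w|lborel. \<bar>\<phi> (?pt w) * cyl_bump w - \<phi> a * cyl_bump w\<bar>)" by (rule integral_abs_bound)
    also have "\<dots> \<le> (LINT w|lborel. L * (2 * r) * cyl_bump (w :: 'a \<times> real))"
    proof (rule integral_mono)
      show "\<bar>\<phi> (?pt w) * cyl_bump w - \<phi> a * cyl_bump w\<bar> \<le> L * (2 * r) * cyl_bump w" for w
      proof (cases "w \<in> unit_cylinder")
        case True
        note b = unit_cylinder_bounds[OF True]
        have rp: "r powr p \<le> r" using powr_mono'[of 1 p r] r p by simp
        have "dist (?pt w) a = norm (r *\<^sub>R fst w, r powr p * snd w)"
          by (cases a) (simp add: dist_norm)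
        also have "\<dots> \<le> norm (r *\<^sub>R fst w) + norm (r powr p * snd w)" by (rule norm_Pair_le)
        also have "\<dots> \<le> r * 1 + r * 1"
        proof (rule add_mono)
          show "norm (r *\<^sub>R fst w) \<le> r * 1" using b r by simp
          show "norm (r powr p * snd w) \<le> r * 1"
            using b r rp mult_mono[OF rp, of "\<bar>snd w\<bar>" 1] by (simp add: abs_mult)
        qed
        finally have "L * dist (?pt w) a \<le> L * (2 * r)" using L(1) by (intro mult_left_mono) auto
        then have "\<bar>\<phi> (?pt w) - \<phi> a\<bar> \<le> L * (2 * r)" using L(2)[of "?pt w" a] by linarith
        then have "\<bar>\<phi> (?pt w) - \<phi> a\<bar> * cyl_bump w \<le> L * (2 * r) * cyl_bump w" using b0 by (rule mult_right_mono)
        then show ?thesis using b0[of w] by (simp add: left_diff_distrib[symmetric] abs_mult)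
      qed (simp add: cyl_bump_eq_0)
    qed (use i1 i2 ib in auto)
    also have "\<dots> = 2 * L * \<kappa> * r" by (simp add: \<kappa>_def)
    finally show ?thesis .
  qed
  moreover have "0 \<le> 2 * L * \<kappa>" using L(1) cyl_bump_integral_pos[where 'a = 'a] by (simp add: \<kappa>_def)
  ultimately show ?thesis using that[of "2 * L * \<kappa>"] by (simp add: \<kappa>_def)
qed

text \<open>Room is needed in two forms: closed balls in space make the slices of kernel sums
  compactly supported in the domain, and cylinders in space-time confine the integrals to
  it.\<close>

lemma compact_cylinder_room:
  fixes \<Omega> :: "'a::euclidean_space set"
  assumes E: "compact E" "E \<subseteq> \<Omega> \<times> {0<..<T}" and \<Omega>: "open \<Omega>" and p: "1 \<le> p"
  obtains r0 where "0 < r0" "r0 \<le> 1 / 3"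
    "\<And>a r. a \<in> E \<Longrightarrow> r \<le> r0 \<Longrightarrow> cball (fst a) r \<subseteq> \<Omega>"
    "\<And>a r. a \<in> E \<Longrightarrow> 0 < r \<Longrightarrow> r \<le> r0 \<Longrightarrow> pcyl p a r \<subseteq> \<Omega> \<times> {0<..<T}"
proof -
  have "open (\<Omega> \<times> {0<..<T})" using \<Omega> by (intro open_Times) auto
  then obtain e where e: "e > 0" "(\<Union>a\<in>E. ball a e) \<subseteq> \<Omega> \<times> {0<..<T}"
    using compact_subset_open_imp_ball_epsilon_subset[OF E(1) _ E(2)] by blast
  \<comment> \<open>The bound 1/3 matches the range of scales in \<open>discrete_frostman\<close>; a
    cylinder of radius r <= 1 lies within 2 r of its centre, and 2 r0 < e.\<close>
  define r0 where "r0 = min (1 / 3) (e / 4)"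
  have r0: "0 < r0" "r0 \<le> 1 / 3" "2 * r0 < e" using e(1) by (auto simp: r0_def)
  have 1: "cball (fst a) r \<subseteq> \<Omega>" if "a \<in> E" "r \<le> r0" for a r
  proof
    fix y assume "y \<in> cball (fst a) r"
    then have "(y, snd a) \<in> ball a e" using that r0 by (cases a) (auto simp: dist_Pair_Pair)
    then show "y \<in> \<Omega>" using e(2) that(1) by blast
  qed
  have 2: "pcyl p a r \<subseteq> \<Omega> \<times> {0<..<T}" if "a \<in> E" "0 < r" "r \<le> r0" for a r
  proof
    fix z assume z: "z \<in> pcyl p a r"
    obtain x t y s where az: "a = (x, t)" "z = (y, s)" by (cases a; cases z)
    have rp: "r powr p \<le> r" using powr_mono'[of 1 p r] that r0 p by simp
    have "dist a z \<le> dist x y + dist t s"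
      unfolding az dist_Pair_Pair by (rule sqrt_sum_squares_le_sum) auto
    also have "\<dots> < r + r" using z rp by (auto simp: az mem_pcyl dist_real_def abs_minus_commute)
    also have "\<dots> \<le> 2 * r0" using that by simp
    finally have "z \<in> ball a e" using r0 by simp
    then show "z \<in> \<Omega> \<times> {0<..<T}" using e(2) that(1) by blast
  qed
  show ?thesis using that r0(1,2) 1 2 by blast
qed

text \<open>Integrates \<open>avg_sum_deriv_bound\<close> from \<epsilon> to \<open>r0\<close>. As
  \<alpha> > 0, the integral of r^(\<alpha>-1) is bounded independently of \<epsilon>, so
  \<open>A\<close> and \<open>r0\<close> depend neither on the atoms nor on the scale at which their
  growth bound stops.\<close>

lemma discrete_energy_estimate:
  fixes \<Omega> :: "'a::euclidean_space set"
  assumes \<Omega>: "open \<Omega>" "bounded \<Omega>" and p: "1 < p" and T: "0 < T"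
    and E: "compact E" "E \<subseteq> \<Omega> \<times> {0<..<T}" and s: "real DIM('a) < s" and C: "0 \<le> C"
  obtains A r0 where "A > 0" "0 < r0" "r0 \<le> 1 / 3"
    "\<forall>\<phi> P m \<epsilon>. \<phi> \<in> test_functions \<Omega> \<longrightarrow> finite P \<longrightarrow> P \<subseteq> E \<longrightarrow> (\<forall>a. 0 \<le> m a) \<longrightarrow> sum m P = 1 \<longrightarrow>
      0 < \<epsilon> \<longrightarrow> \<epsilon> \<le> r0 \<longrightarrow> (\<forall>z r. \<epsilon> \<le> r \<longrightarrow> r \<le> r0 \<longrightarrow> sum m (P \<inter> pcyl p z r) \<le> C * r powr s) \<longrightarrow>
      \<bar>\<Sum>a\<in>P. m a * avg p \<phi> a \<epsilon>\<bar> \<le> A * WM_norm p \<Omega> T \<phi>"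
proof -
  let ?U = "\<Omega> \<times> {0<..<T}"
  obtain r0 where r0: "0 < r0" "r0 \<le> 1 / 3"
    "\<And>a r. a \<in> E \<Longrightarrow> r \<le> r0 \<Longrightarrow> cball (fst a) r \<subseteq> \<Omega>"
    "\<And>a r. a \<in> E \<Longrightarrow> 0 < r \<Longrightarrow> r \<le> r0 \<Longrightarrow> pcyl p a r \<subseteq> \<Omega> \<times> {0<..<T}"
    using compact_cylinder_room[OF E \<Omega>(1), of p] p by (metis less_imp_le)
  obtain B where B: "B > 0" "\<And>w :: 'a \<times> real. norm (kernel_space w) \<le> B"
    "\<And>w :: 'a \<times> real. norm (kernel_time w) \<le> B" "\<And>w :: 'a \<times> real. norm (kernel_mixed w) \<le> B"
    using kernel_bounded by blast
  define n where "n = real DIM('a)"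
  define \<alpha> where "\<alpha> = min ((s - n) / p) ((s - n) * (1 - 1 / p))"
  have \<alpha>: "\<alpha> > 0" "\<alpha> \<le> (s - n) / p" "\<alpha> \<le> (s - n) * (1 - 1 / p)" using s p by (auto simp: \<alpha>_def n_def)
  define q where "q = p / (p - 1)"
  define v where "v = measure lborel (unit_cylinder :: ('a \<times> real) set)"
  define A1 where "A1 = ((B * C) powr (q - 1) * (B * v)) powr (1 / q) + p * ((B * C) powr (p - 1) * (B * v)) powr (1 / p)"
  have A1: "A1 \<ge> 0" using p by (simp add: A1_def)
  obtain A0 where A0: "A0 > 0"
    "\<And>\<phi> a. \<phi> \<in> test_functions \<Omega> \<Longrightarrow> pcyl p a r0 \<subseteq> ?U \<Longrightarrow> \<bar>avg p \<phi> a r0\<bar> \<le> A0 * WM_gradient_norm p \<Omega> T \<phi>"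
    using avg_initial_bound[OF \<Omega> p r0(1), of T] by blast
  define A where "A = A0 + A1 / \<alpha>"
  have U: "?U \<in> sets borel" using \<Omega> by (auto intro!: borel_Times)
  have "\<bar>\<Sum>a\<in>P. m a * avg p \<phi> a \<epsilon>\<bar> \<le> A * WM_norm p \<Omega> T \<phi>"
    if \<phi>: "\<phi> \<in> test_functions \<Omega>" and P: "finite P" "P \<subseteq> E" and m: "\<And>a. 0 \<le> m a" "sum m P = 1"
      and \<epsilon>: "0 < \<epsilon>" "\<epsilon> \<le> r0"
      and growth: "\<And>z r. \<epsilon> \<le> r \<Longrightarrow> r \<le> r0 \<Longrightarrow> sum m (P \<inter> pcyl p z r) \<le> C * r powr s"
    for \<phi> P m \<epsilon>
  proof -
    define N where "N = WM_gradient_norm p \<Omega> T \<phi> + WM_time_norm p \<Omega> T \<phi>"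
    have N: "0 \<le> N" "WM_gradient_norm p \<Omega> T \<phi> \<le> N" "N \<le> WM_norm p \<Omega> T \<phi>"
      using WM_time_norm_nonneg[of p \<Omega> T \<phi>] WM_gradient_norm_nonneg[of p \<Omega> T \<phi>] WM_sup_norm_nonneg[OF T, of \<Omega> \<phi>]
      by (simp_all add: N_def WM_norm_eq)
    define h where "h r = (\<Sum>a\<in>P. m a * avg p \<phi> a r)" for r
    define h' where "h' r = ((LINT z|leb ?U. space_gradient \<phi> z \<bullet> kernel_sum p P m r kernel_space z) +
     p * r powr (p - 1) * (LINT z|leb ?U. time_derivative \<phi> z * kernel_sum p P m r kernel_time z))
      / (r ^ DIM('a) * r powr p)" for r
    have dh: "(h has_real_derivative h' r) (at r)" if "\<epsilon> \<le> r" "r \<le> r0" for r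
      unfolding h_def[abs_def] h'_def
    proof (rule avg_sum_DERIV[OF \<phi> _ U])
      show "0 < r" using that \<epsilon> by simp
      then show "pcyl p a r \<subseteq> ?U" if "a \<in> P" for a using that P(2) r0(4)[of a r] \<open>r \<le> r0\<close> by blast
    qed
    have bh: "\<bar>h' r\<bar> \<le> A1 * r powr (\<alpha> - 1) * N" if r: "\<epsilon> \<le> r" "r \<le> r0" for r
      unfolding h'_def A1_def q_def v_def N_def
    proof (rule avg_sum_deriv_bound[OF \<Omega> p T \<phi> B C P(1) m _ _ growth[OF r]])
      show "0 < r" "r \<le> 1" using r \<epsilon> r0 by auto
      then show "cball (fst a) r \<subseteq> \<Omega>" "pcyl p a r \<subseteq> ?U" if "a \<in> P" for a
        using that P(2) r0(3)[of a r] r0(4)[of a r] r(2) by blast+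
    qed (use \<alpha> in \<open>auto simp: n_def\<close>)
    \<comment> \<open>This takes the place of an integral: for both signs c the function A1
      N/\<alpha> r^\<alpha> + c h(r) is nondecreasing, because the derivative bound makes its slope
      nonnegative.\<close>
    have mono: "A1 * N / \<alpha> * \<epsilon> powr \<alpha> + c * h \<epsilon> \<le> A1 * N / \<alpha> * r0 powr \<alpha> + c * h r0" if c: "c = 1 \<or> c = -1" for c
    proof (rule DERIV_nonneg_imp_nondecreasing[OF \<epsilon>(2)])
      fix r assume r: "\<epsilon> \<le> r" "r \<le> r0"
      then have r': "r > 0" using \<epsilon> by simp
      have "((\<lambda>r. A1 * N / \<alpha> * r powr \<alpha> + c * h r) has_real_derivative A1 * N / \<alpha> * (\<alpha> * r powr (\<alpha> - 1)) + c * h' r) (at r)"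
        by (intro DERIV_add DERIV_cmult dh r has_real_derivative_powr r')
      moreover have "0 \<le> A1 * N / \<alpha> * (\<alpha> * r powr (\<alpha> - 1)) + c * h' r"
        using bh[OF r] c \<alpha>(1) by (auto simp: abs_le_iff mult.assoc mult.left_commute mult.commute)
      ultimately show "\<exists>y. ((\<lambda>r. A1 * N / \<alpha> * r powr \<alpha> + c * h r) has_real_derivative y) (at r) \<and> 0 \<le> y" by blast
    qed
    have "A1 * N / \<alpha> * r0 powr \<alpha> \<le> A1 * N / \<alpha> * 1"
      using A1 N(1) \<alpha>(1) r0 by (intro mult_left_mono powr_le1) auto
    moreover have "0 \<le> A1 * N / \<alpha> * \<epsilon> powr \<alpha>" using A1 N(1) \<alpha>(1) by simp
    ultimately have 1: "\<bar>h \<epsilon> - h r0\<bar> \<le> A1 * N / \<alpha>" using mono[of 1] mono[of "-1"] by (auto simp: abs_le_iff)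
    have "\<bar>h r0\<bar> \<le> (\<Sum>a\<in>P. \<bar>m a * avg p \<phi> a r0\<bar>)" unfolding h_def by (rule sum_abs)
    also have "\<dots> \<le> (\<Sum>a\<in>P. m a * (A0 * N))"
    proof (rule sum_mono)
      fix a assume a: "a \<in> P"
      have "\<bar>avg p \<phi> a r0\<bar> \<le> A0 * WM_gradient_norm p \<Omega> T \<phi>" using A0(2)[OF \<phi> r0(4)] a P(2) r0(1) by blast
      also have "\<dots> \<le> A0 * N" using A0(1) N(2) by (intro mult_left_mono) auto
      finally have "m a * \<bar>avg p \<phi> a r0\<bar> \<le> m a * (A0 * N)" using m(1) by (rule mult_left_mono)
      then show "\<bar>m a * avg p \<phi> a r0\<bar> \<le> m a * (A0 * N)" using m(1) by (simp add: abs_mult)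
    qed
    also have "\<dots> = A0 * N" using m(2) by (simp add: sum_distrib_right[symmetric])
    finally have "\<bar>h \<epsilon>\<bar> \<le> A * N" using 1 by (simp add: A_def distrib_right)
    also have "\<dots> \<le> A * WM_norm p \<Omega> T \<phi>" using A0(1) A1 \<alpha>(1) N(3) by (intro mult_left_mono) (auto simp: A_def)
    finally show ?thesis by (simp add: h_def)
  qed
  moreover have "A > 0" using A0(1) A1 \<alpha>(1) by (simp add: A_def add_pos_nonneg)
  ultimately show ?thesis using that r0(1,2) by blast
qed

section \<open>Passage to the limit for large dimension\<close>

lemma finite_radon_measure_on_restrict_space:
  fixes M :: "'b::{second_countable_topology, complete_space} measure"
  assumes fin: "finite_measure M" and sM: "sets M = sets borel" and X: "open X"
  shows "finite_radon_measure_on X (restrict_space M X)"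
proof -
  interpret finite_measure M by fact
  have XM: "X \<in> sets M" using X by (simp add: sM)
  have em: "emeasure (restrict_space M X) B = emeasure M B" if "B \<subseteq> X" "B \<in> sets borel" for B
    using that XM by (intro emeasure_restrict_space) (auto simp: sets_eq_imp_space_eq[OF sM])
  show ?thesis
    unfolding finite_radon_measure_on_def
  proof (intro conjI ballI)
    show "sets (restrict_space M X) = sets (restrict_space borel X)"
      by (rule sets_restrict_space_cong[OF sM])
    show "finite_measure (restrict_space M X)"
      using XM by (intro finite_measure_restrict_space fin) (simp add: sets_eq_imp_space_eq[OF sM])
    fix B assume "B \<in> sets (restrict_space M X)"
    then have B: "B \<subseteq> X" "B \<in> sets borel"
      using X by (auto simp: sets_restrict_space sM)
    have "emeasure M B = (SUP K\<in>{K. K \<subseteq> B \<and> compact K}. emeasure M K)"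
      by (rule inner_regular[OF sM _ B(2)]) simp
    also have "\<dots> = (SUP K\<in>{K. K \<subseteq> B \<and> compact K}. emeasure (restrict_space M X) K)"
      using B(1) by (intro SUP_cong refl em[symmetric]) (auto simp: borel_compact)
    finally show "emeasure (restrict_space M X) B = (SUP K\<in>{K. K \<subseteq> B \<and> compact K}. emeasure (restrict_space M X) K)"
      using em[OF B] by simp
  qed
qed

text \<open>Fixes s strictly between n and the dimension. The j-th Frostman measure has growth s
  only down to the scale (1/2)^j, so the energy estimate is applied at exactly that scale, and
  \<open>avg_limit\<close> bounds the difference from \<phi> by a multiple of (1/2)^j, which
  disappears along the weakly convergent subsequence.\<close>

theorem exists_WM_dual_measure:
  fixes \<Omega> :: "'a::euclidean_space set"
  assumes \<Omega>: "open \<Omega>" "bounded \<Omega>" and p: "1 < p" and T: "0 < T"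
    and E: "compact E" "E \<subseteq> \<Omega> \<times> {0<..<T}" and dim: "ereal (real DIM('a)) < hausdorff_dim p E"
  shows "\<exists>\<mu>. finite_radon_measure_on (\<Omega> \<times> {0<..<T}) \<mu> \<and> emeasure \<mu> (space \<mu>) \<noteq> 0 \<and>
    in_WM_dual p \<Omega> T \<mu> \<and> spt \<mu> \<subseteq> E"
proof -
  let ?U = "\<Omega> \<times> {0<..<T}"
  have oU: "open ?U" using \<Omega> by (intro open_Times) auto
  obtain s where s: "real DIM('a) < s" "ereal s < hausdorff_dim p E"
    using ereal_dense2[OF dim] by auto
  have s0: "0 < s" using s(1) by (meson less_trans of_nat_0_less_iff DIM_positive)
  have "hausdorff_measure p s E \<noteq> 0"
  proof
    assume "hausdorff_measure p s E = 0"
    then have "hausdorff_dim p E \<le> ereal s" unfolding hausdorff_dim_def using s0 by (intro INF_lower) auto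
    then show False using s(2) by simp
  qed
  then obtain K where K: "0 < K" "\<And>F. finite F \<Longrightarrow> (\<And>z r. (z, r) \<in> F \<Longrightarrow> 0 < r) \<Longrightarrow>
    E \<subseteq> (\<Union>(z, r)\<in>F. pcyl p z r) \<Longrightarrow> K \<le> (\<Sum>(z, r)\<in>F. r powr s)"
    using hausdorff_measure_nonzero_finite_covers[OF _ s0] by blast
  define C where "C = 54 powr s / K"
  have C: "0 \<le> C" using K(1) by (simp add: C_def)
  have "\<exists>P m. finite P \<and> P \<subseteq> E \<and> (\<forall>a. 0 \<le> m a) \<and> sum m P = 1 \<and>
      (\<forall>z r. (1 / 2) ^ j \<le> r \<longrightarrow> r \<le> 1 / 3 \<longrightarrow> sum m (P \<inter> pcyl p z r) \<le> C * r powr s)" for j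
  proof -
    obtain P m where "finite P" "P \<subseteq> E" "\<And>a. 0 \<le> m a" "sum m P = 1"
      "\<And>z r. (1 / 2) ^ j \<le> r \<Longrightarrow> r \<le> 1 / 3 \<Longrightarrow> sum m (P \<inter> pcyl p z r) \<le> 54 powr s / K * r powr s"
    proof (rule discrete_frostman[OF less_imp_le[OF p] s0 E(1) K(1), of j])
      fix F :: "(('a \<times> real) \<times> real) set"
      assume "finite F" "\<And>z r. (z, r) \<in> F \<Longrightarrow> 0 < r" "E \<subseteq> (\<Union>(z, r)\<in>F. pcyl p z r)"
      then show "K \<le> (\<Sum>(z, r)\<in>F. r powr s)" by (rule K(2))
    qed (rule that)
    then show ?thesis unfolding C_def by blast
  qed
  then obtain P m where P: "\<And>j. finite (P j)" "\<And>j. P j \<subseteq> E" and m: "\<And>j a. 0 \<le> m j a" "\<And>j. sum (m j) (P j) = 1"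
    and growth: "\<And>j z r. (1 / 2) ^ j \<le> r \<Longrightarrow> r \<le> 1 / 3 \<Longrightarrow> sum (m j) (P j \<inter> pcyl p z r) \<le> C * r powr s"
    by metis
  obtain M \<sigma> where M: "prob_space M" "sets M = sets borel" "emeasure M (- E) = 0" and \<sigma>: "strict_mono (\<sigma> :: nat \<Rightarrow> nat)"
    and conv: "\<forall>\<phi> B. continuous_on UNIV \<phi> \<longrightarrow> (\<forall>x. \<bar>\<phi> x\<bar> \<le> B) \<longrightarrow>
      (\<lambda>k. \<Sum>a\<in>P (\<sigma> k). m (\<sigma> k) a * \<phi> a) \<longlonglongrightarrow> (LINT x|M. \<phi> x)"
    by (rule weak_limit_of_discrete[OF E(1), of P m, OF P m]) (rule that)
  interpret prob_space M by (rule M(1))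
  obtain A r0 where A: "A > 0" "0 < r0" "r0 \<le> 1 / 3"
    and est: "\<forall>\<phi> P m \<epsilon>. \<phi> \<in> test_functions \<Omega> \<longrightarrow> finite P \<longrightarrow> P \<subseteq> E \<longrightarrow> (\<forall>a. 0 \<le> m a) \<longrightarrow> sum m P = 1 \<longrightarrow>
      0 < \<epsilon> \<longrightarrow> \<epsilon> \<le> r0 \<longrightarrow> (\<forall>z r. \<epsilon> \<le> r \<longrightarrow> r \<le> r0 \<longrightarrow> sum m (P \<inter> pcyl p z r) \<le> C * r powr s) \<longrightarrow>
      \<bar>\<Sum>a\<in>P. m a * avg p \<phi> a \<epsilon>\<bar> \<le> A * WM_norm p \<Omega> T \<phi>"
    by (rule discrete_energy_estimate[OF \<Omega> p T E s(1) C]) (rule that)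
  define \<kappa> where "\<kappa> = (LINT w|lborel. cyl_bump (w :: 'a \<times> real))"
  have \<kappa>: "\<kappa> > 0" unfolding \<kappa>_def by (rule cyl_bump_integral_pos)
  have bound: "\<bar>LINT z|M. \<phi> z\<bar> \<le> A / \<kappa> * WM_norm p \<Omega> T \<phi>" if \<phi>: "\<phi> \<in> test_functions \<Omega>" for \<phi>
  proof -
    have \<phi>': "\<phi> \<in> Cc_infinity (\<Omega> \<times> UNIV)" using \<phi> by (simp add: test_functions_def)
    obtain B where B: "\<And>z. \<bar>\<phi> z\<bar> \<le> B" using Cc_infinity_bounded[OF \<phi>'] by blast
    obtain L where L: "L \<ge> 0" "\<And>a r. 0 < r \<Longrightarrow> r \<le> 1 \<Longrightarrow> \<bar>avg p \<phi> a r - \<phi> a * \<kappa>\<bar> \<le> L * r"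
      using avg_limit[OF \<phi>, of p] p unfolding \<kappa>_def by (metis less_imp_le)
    define S where "S j = (\<Sum>a\<in>P j. m j a * \<phi> a)" for j
    have near: "\<kappa> * \<bar>S j\<bar> \<le> A * WM_norm p \<Omega> T \<phi> + L * (1 / 2) ^ j" if j: "(1 / 2) ^ j \<le> r0" for j
    proof -
      define \<epsilon> where "\<epsilon> = (1 / 2 :: real) ^ j"
      have \<epsilon>: "0 < \<epsilon>" "\<epsilon> \<le> r0" "\<epsilon> \<le> 1" using j by (auto simp: \<epsilon>_def power_le_one)
      have 1: "\<bar>\<Sum>a\<in>P j. m j a * avg p \<phi> a \<epsilon>\<bar> \<le> A * WM_norm p \<Omega> T \<phi>"
      proof (rule est[rule_format, OF \<phi> P m \<epsilon>(1,2)])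
        show "sum (m j) (P j \<inter> pcyl p z r) \<le> C * r powr s" if "\<epsilon> \<le> r" "r \<le> r0" for z r
          using that A(3) by (intro growth) (auto simp: \<epsilon>_def)
      qed
      have "\<kappa> * S j - (\<Sum>a\<in>P j. m j a * avg p \<phi> a \<epsilon>) = - (\<Sum>a\<in>P j. m j a * (avg p \<phi> a \<epsilon> - \<phi> a * \<kappa>))"
        by (simp add: S_def sum_distrib_left right_diff_distrib sum_subtractf mult.assoc mult.left_commute mult.commute)
      also have "\<bar>\<dots>\<bar> \<le> (\<Sum>a\<in>P j. m j a * (L * \<epsilon>))"
        using sum_abs[of "\<lambda>a. m j a * (avg p \<phi> a \<epsilon> - \<phi> a * \<kappa>)" "P j"]
          sum_mono[of "P j" "\<lambda>a. \<bar>m j a * (avg p \<phi> a \<epsilon> - \<phi> a * \<kappa>)\<bar>" "\<lambda>a. m j a * (L * \<epsilon>)"]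
          L(2)[OF \<epsilon>(1,3)] m(1)[of j] by (simp add: abs_mult mult_left_mono)
      also have "\<dots> = L * \<epsilon>" using m(2)[of j] by (simp add: sum_distrib_right[symmetric])
      finally have "\<bar>\<kappa> * S j\<bar> \<le> A * WM_norm p \<Omega> T \<phi> + L * \<epsilon>" using 1 by linarith
      then show ?thesis using \<kappa> by (simp add: abs_mult \<epsilon>_def)
    qed
    have half: "(\<lambda>k. (1 / 2 :: real) ^ \<sigma> k) \<longlonglongrightarrow> 0"
      using LIMSEQ_subseq_LIMSEQ[OF LIMSEQ_power_zero[of "1 / 2 :: real"] \<sigma>] by (simp add: o_def)
    have "(\<lambda>k. \<kappa> * \<bar>S (\<sigma> k)\<bar>) \<longlonglongrightarrow> \<kappa> * \<bar>LINT z|M. \<phi> z\<bar>"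
      unfolding S_def by (intro tendsto_intros conv[rule_format, of \<phi> B] B Cc_infinity_continuous[OF \<phi>'])
    moreover have "(\<lambda>k. A * WM_norm p \<Omega> T \<phi> + L * (1 / 2) ^ \<sigma> k) \<longlonglongrightarrow> A * WM_norm p \<Omega> T \<phi> + L * 0"
      by (intro tendsto_intros half)
    moreover have "eventually (\<lambda>k. \<kappa> * \<bar>S (\<sigma> k)\<bar> \<le> A * WM_norm p \<Omega> T \<phi> + L * (1 / 2) ^ \<sigma> k) sequentially"
      using order_tendstoD(2)[OF half A(2)] by eventually_elim (intro near less_imp_le)
    ultimately have "\<kappa> * \<bar>LINT z|M. \<phi> z\<bar> \<le> A * WM_norm p \<Omega> T \<phi> + L * 0"
      by (intro tendsto_le[OF sequentially_bot])
    then show ?thesis using \<kappa> by (simp add: pos_le_divide_eq mult.commute)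
  qed
  \<comment> \<open>The limit lives on the whole space and gives full measure to E; its restriction
    has the Borel sets of the space-time domain, as the notion of a Radon measure there
    demands.\<close>
  define \<mu> where "\<mu> = restrict_space M ?U"
  have UM: "?U \<inter> space M \<in> sets M" using oU by (simp add: M(2) sets_eq_imp_space_eq[OF M(2)])
  have AE: "AE z in M. z \<in> E"
    using M(3) E(1) by (subst AE_iff_measurable[of "- E"]) (auto simp: M(2) compact_imp_closed sets_eq_imp_space_eq[OF M(2)])
  have "in_WM_dual p \<Omega> T \<mu>"
    unfolding in_WM_dual_def
  proof (intro exI[of _ "A / \<kappa>"] ballI)
    fix \<phi> assume \<phi>: "\<phi> \<in> test_functions \<Omega>"
    have [measurable]: "\<phi> \<in> borel_measurable M"
      using \<phi> Cc_infinity_borel[of \<phi>] unfolding test_functions_def measurable_cong_sets[OF M(2) refl] by blast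
    have "(LINT z|\<mu>. \<phi> z) = (LINT z|M. indicator ?U z *\<^sub>R \<phi> z)"
      unfolding \<mu>_def by (rule integral_restrict_space[OF UM])
    also have "\<dots> = (LINT z|M. \<phi> z)"
    proof (rule integral_cong_AE)
      show "(\<lambda>z. indicator ?U z *\<^sub>R \<phi> z) \<in> borel_measurable M"
        using oU M(2) by (intro borel_measurable_scaleR borel_measurable_indicator) auto
      show "AE z in M. indicator ?U z *\<^sub>R \<phi> z = \<phi> z" using AE by eventually_elim (use E(2) in auto)
    qed measurable
    finally show "\<bar>LINT z|\<mu>. \<phi> z\<bar> \<le> A / \<kappa> * WM_norm p \<Omega> T \<phi>" using bound[OF \<phi>] by simp
  qed
  moreover have "finite_radon_measure_on ?U \<mu>"
    unfolding \<mu>_def by (rule finite_radon_measure_on_restrict_space[OF finite_measure_axioms M(2) oU])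
  moreover have em: "emeasure \<mu> B = emeasure M B" if "B \<subseteq> ?U" for B
    unfolding \<mu>_def using UM that by (rule emeasure_restrict_space)
  have sp: "space \<mu> = ?U" by (simp add: \<mu>_def space_restrict_space sets_eq_imp_space_eq[OF M(2)])
  have "emeasure \<mu> (space \<mu>) \<noteq> 0"
  proof -
    have "AE z in M. z \<in> ?U" using AE by eventually_elim (use E(2) in auto)
    then have "emeasure M ?U = 1" using oU by (intro emeasure_eq_1_AE) (auto simp: M(2))
    then show ?thesis using em[of ?U] sp by simp
  qed
  moreover have "spt \<mu> \<subseteq> E"
  proof
    fix z assume "z \<in> spt \<mu>"
    then have z: "\<And>U. open U \<Longrightarrow> z \<in> U \<Longrightarrow> emeasure \<mu> (U \<inter> ?U) > 0" by (simp add: spt_def sp)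
    show "z \<in> E"
    proof (rule ccontr)
      assume "z \<notin> E"
      then have "emeasure \<mu> (- E \<inter> ?U) > 0" using E(1) by (intro z) (auto simp: compact_imp_closed)
      moreover have "emeasure \<mu> (- E \<inter> ?U) \<le> emeasure M (- E)"
        using E(1) by (subst em) (auto intro!: emeasure_mono simp: M(2) compact_imp_closed)
      ultimately show False using M(3) by simp
    qed
  qed
  ultimately show ?thesis by blast
qed

section \<open>Mean-zero spatial profiles\<close>

text \<open>The inner difference equals \<open>expinv 3\<close> for u <= 1 and is at most 0 for u >=
  4, so the outer \<open>expinv\<close> gives a smooth plateau that descends to 0. The numbers 1 and
  4 are squares: applied to |x|^2/K^2 it cuts off between the radii K and 2 K. The plateau height is
  \<open>expinv (expinv 3)\<close>, not 1.\<close>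

definition cutoff :: "real \<Rightarrow> real" where
  "cutoff u = expinv (expinv 3 - expinv (u - 1))"

text \<open>The divergence of the radial field that sends x to h(x) x.\<close>

definition div_field :: "('a::euclidean_space \<Rightarrow> real) \<Rightarrow> 'a \<Rightarrow> real" where
  "div_field h x = (\<Sum>i\<in>Basis. frechet_derivative (\<lambda>x. h x * (x \<bullet> i)) (at x) i)"

lemma smooth_cutoff: "smooth g \<Longrightarrow> smooth (\<lambda>x. cutoff (g x))"
proof -
  assume g: "smooth g"
  have "smooth (\<lambda>x. expinv (expinv 3 + (-1) * expinv (g x + (-1))))"
    by (intro smooth_expinv smooth_add smooth_mult smooth_const g)
  then show ?thesis by (simp add: cutoff_def)
qed

lemma cutoff_nonneg: "0 \<le> cutoff u" and cutoff_low: "u \<le> 1 \<Longrightarrow> cutoff u = expinv (expinv 3)"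
  by (simp_all add: cutoff_def expinv_nonneg) (simp add: expinv_def)

lemma cutoff_high: "4 \<le> u \<Longrightarrow> cutoff u = 0"
  using expinv_mono[of 3 "u - 1"] by (simp add: cutoff_def expinv_eq_0_iff)

lemma cutoff_derivative:
  obtains D M where "\<And>u. (cutoff has_real_derivative D u) (at u)" "0 < M" "\<And>u. \<bar>D u\<bar> \<le> M"
    "\<And>u. u < 1 \<or> 4 < u \<Longrightarrow> D u = 0"
proof -
  define D where "D u = frechet_derivative cutoff (at u) 1" for u
  have sm: "smooth cutoff" using smooth_cutoff[OF smooth_ident] by simp
  have d: "(cutoff has_real_derivative D u) (at u)" for u
  proof -
    have "frechet_derivative cutoff (at u) h = D u * h" for h
      using frechet_linear(2)[OF smooth_differentiable[OF sm], of u h 1] by (simp add: D_def)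
    then have "frechet_derivative cutoff (at u) = (*) (D u)" by (simp add: fun_eq_iff)
    then show ?thesis using smooth_has_derivative[OF sm, of u] by (simp add: has_field_derivative_def)
  qed
  have z: "D u = 0" if u: "u < 1 \<or> 4 < u" for u
  proof -
    have "(cutoff has_real_derivative 0) (at u)"
    proof (cases "u < 1")
      case True
      show ?thesis
        by (rule has_field_derivative_transform_within_open[of "\<lambda>_. expinv (expinv 3)" _ _ "{..<1}"])
          (use True cutoff_low in auto)
    next
      case False
      show ?thesis
        by (rule has_field_derivative_transform_within_open[of "\<lambda>_. 0" _ _ "{4<..}"])
          (use False u cutoff_high in auto)
    qed
    then show ?thesis using d DERIV_unique by blast
  qed
  have c: "continuous_on UNIV D" unfolding D_def[abs_def] by (rule smooth_continuous_on[OF smooth_frechet[OF sm]])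
  have z': "D u = 0" if "u \<notin> {1..4}" for u using that z[of u] by auto
  obtain M where M: "M > 0" "\<And>u. norm (D u) \<le> M"
    using bounded_compact_support[OF c compact_Icc z'] by blast
  show ?thesis by (rule that[OF d M(1) _ z]) (use M(2) in auto)
qed

text \<open>
  The field \<open>x \<mapsto> (1 + |x|\<^sup>2)\<^bsup>-n/2\<^esup> x\<close> has positive divergence; cutting it off at radius \<open>K\<close> costs
  negative divergence of the order \<open>K\<^bsup>-n\<^esup>\<close> only, while enlarging a doubling cylinder by the factor
  \<open>K\<close> multiplies its measure by at most \<open>C K\<^bsup>s\<^esup>\<close> with \<open>s < n\<close>.
\<close>

lemma profile_exists:
  obtains c0 C1 :: real where "0 < c0" "0 < C1"
    "\<And>K. 1 < K \<Longrightarrow> \<exists>h :: 'a::euclidean_space \<Rightarrow> real. smooth h \<and> (\<forall>x. 2 * K \<le> norm x \<longrightarrow> h x = 0) \<and>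
      (\<forall>x. norm x < 1 \<longrightarrow> c0 \<le> div_field h x) \<and> (\<forall>x. - (C1 * K powr - real DIM('a)) \<le> div_field h x)"
proof -
  define n where "n = real DIM('a)"
  have n: "n > 0" by (simp add: n_def)
  obtain D M where D: "\<And>u. (cutoff has_real_derivative D u) (at u)" "0 < M" "\<And>u. \<bar>D u\<bar> \<le> M"
    "\<And>u. u < 1 \<or> 4 < u \<Longrightarrow> D u = 0"
    using cutoff_derivative by blast
  \<comment> \<open>On the unit ball 1 + |x|^2 is at most 2 and the cutoff sits on its plateau,
    which gives this lower bound for the divergence.\<close>
  define c0 where "c0 = n * 2 powr (- n / 2 - 1) * expinv (expinv 3)"
  define C1 where "C1 = 8 * M"
  have c0: "c0 > 0" using n by (simp add: c0_def expinv_pos_iff)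
  have C1: "C1 > 0" using D(2) by (simp add: C1_def)
  have "\<exists>h :: 'a \<Rightarrow> real. smooth h \<and> (\<forall>x. 2 * K \<le> norm x \<longrightarrow> h x = 0) \<and>
      (\<forall>x. norm x < 1 \<longrightarrow> c0 \<le> div_field h x) \<and> (\<forall>x. - (C1 * K powr - n) \<le> div_field h x)"
    if K: "1 < K" for K
  proof -
    define w where "w x = (1 + x \<bullet> x) powr (- n / 2)" for x :: 'a
    define \<eta> where "\<eta> x = cutoff ((1 / K\<^sup>2) * (x \<bullet> x))" for x :: 'a
    define h where "h x = w x * \<eta> x" for x
    have pos: "0 < 1 + x \<bullet> x" for x :: 'a by (simp add: add_pos_nonneg)
    have sw: "smooth w" unfolding w_def[abs_def]
      by (intro smooth_powr smooth_add smooth_const smooth_inner_self pos)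
    have s\<eta>: "smooth \<eta>" unfolding \<eta>_def[abs_def]
      by (intro smooth_cutoff smooth_mult smooth_const smooth_inner_self)
    have sh: "smooth h" unfolding h_def[abs_def] by (intro smooth_mult sw s\<eta>)
    have div: "div_field h x = n * h x + frechet_derivative h (at x) x" for x
    proof -
      have "frechet_derivative (\<lambda>x. h x * (x \<bullet> i)) (at x) i = h x + frechet_derivative h (at x) i * (x \<bullet> i)"
        if i: "i \<in> Basis" for i
      proof -
        have "((\<lambda>x. h x * (x \<bullet> i)) has_derivative
            (\<lambda>v. h x * (v \<bullet> i) + frechet_derivative h (at x) v * (x \<bullet> i))) (at x)"
          by (intro has_derivative_mult smooth_has_derivative sh has_derivative_inner_left has_derivative_ident)
        then show ?thesis using i by (simp add: frechet_derivative_eqI)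
      qed
      then have "div_field h x = n * h x + (\<Sum>i\<in>Basis. frechet_derivative h (at x) i * (x \<bullet> i))"
        by (simp add: div_field_def sum.distrib n_def)
      also have "(\<Sum>i\<in>Basis. frechet_derivative h (at x) i * (x \<bullet> i)) = gradient h x \<bullet> x"
        by (simp add: gradient_def inner_sum_left) (simp add: inner_commute)
      finally show ?thesis by (simp add: frechet_eq_gradient[OF smooth_differentiable[OF sh]])
    qed
    \<comment> \<open>With w = (1+|x|^2)^(-n/2), the terms n w and x . grad w combine to n
      (1+|x|^2)^(-n/2-1), which is positive; the remaining term carries the derivative of the
      cutoff.\<close>
    have formula: "div_field h x = n * (1 + x \<bullet> x) powr (- n / 2 - 1) * \<eta> x +
        2 * ((x \<bullet> x) / K\<^sup>2) * w x * D ((x \<bullet> x) / K\<^sup>2)" for x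
    proof -
      have u: "((\<lambda>x. x \<bullet> x) has_derivative (\<lambda>v. 2 * (x \<bullet> v))) (at x)"
        by (auto intro!: derivative_eq_intros simp: inner_commute)
      have 1: "((\<lambda>u. (1 + u) powr (- n / 2)) has_derivative ((*) ((- n / 2) * (1 + x \<bullet> x) powr (- n / 2 - 1)))) (at (x \<bullet> x))"
        using pos[of x] unfolding has_field_derivative_def[symmetric]
        by (auto intro!: derivative_eq_intros)
      have 2: "((\<lambda>u. cutoff ((1 / K\<^sup>2) * u)) has_derivative ((*) (D ((1 / K\<^sup>2) * (x \<bullet> x)) * (1 / K\<^sup>2)))) (at (x \<bullet> x))"
        unfolding has_field_derivative_def[symmetric]
        by (rule DERIV_chain2[OF D(1) DERIV_cmult_Id])
      have dw: "(w has_derivative (\<lambda>v. (- n / 2) * (1 + x \<bullet> x) powr (- n / 2 - 1) * (2 * (x \<bullet> v)))) (at x)"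
        using diff_chain_at[OF u 1] by (simp add: o_def w_def[abs_def])
      have d\<eta>: "(\<eta> has_derivative (\<lambda>v. D ((1 / K\<^sup>2) * (x \<bullet> x)) * (1 / K\<^sup>2) * (2 * (x \<bullet> v)))) (at x)"
        using diff_chain_at[OF u 2] by (simp add: o_def \<eta>_def[abs_def])
      have dh: "frechet_derivative h (at x) = (\<lambda>v. w x * (D ((1 / K\<^sup>2) * (x \<bullet> x)) * (1 / K\<^sup>2) * (2 * (x \<bullet> v))) +
          (- n / 2) * (1 + x \<bullet> x) powr (- n / 2 - 1) * (2 * (x \<bullet> v)) * \<eta> x)"
        unfolding h_def[abs_def] by (rule frechet_derivative_eqI[OF has_derivative_mult[OF dw d\<eta>]])
      have wx: "w x = (1 + x \<bullet> x) * (1 + x \<bullet> x) powr (- n / 2 - 1)"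
        using pos[of x] by (simp add: w_def powr_diff)
      have "n * w x - n * (1 + x \<bullet> x) powr (- n / 2 - 1) * (x \<bullet> x) = n * (1 + x \<bullet> x) powr (- n / 2 - 1)"
        unfolding wx by (simp add: algebra_simps)
      moreover have "div_field h x = (n * w x - n * (1 + x \<bullet> x) powr (- n / 2 - 1) * (x \<bullet> x)) * \<eta> x +
          2 * ((x \<bullet> x) / K\<^sup>2) * w x * D ((x \<bullet> x) / K\<^sup>2)"
        unfolding div dh by (simp add: h_def algebra_simps)
      ultimately show ?thesis by simp
    qed
    have zero: "h x = 0" if "2 * K \<le> norm x" for x
    proof -
      have "(2 * K)\<^sup>2 \<le> (norm x)\<^sup>2" using that K by (intro power_mono) auto
      then have "4 \<le> (1 / K\<^sup>2) * (x \<bullet> x)" using K by (simp add: dot_square_norm power_mult_distrib pos_le_divide_eq)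
      then show ?thesis by (simp add: h_def \<eta>_def cutoff_high)
    qed
    have near: "c0 \<le> div_field h x" if x: "norm x < 1" for x
    proof -
      have u1: "x \<bullet> x < 1" using x power_strict_mono[of "norm x" 1 2] by (simp add: dot_square_norm)
      have K2: "1 < K\<^sup>2" using K by (simp add: one_less_power)
      then have uK: "x \<bullet> x / K\<^sup>2 < 1" using u1 by (simp add: divide_less_eq)
      have "2 powr (- n / 2 - 1) \<le> (1 + x \<bullet> x) powr (- n / 2 - 1)"
        using u1 pos[of x] n by (intro powr_mono2') auto
      then have "c0 \<le> n * (1 + x \<bullet> x) powr (- n / 2 - 1) * expinv (expinv 3)"
        unfolding c0_def using n by (intro mult_right_mono mult_left_mono) (auto simp: expinv_nonneg)
      moreover have "\<eta> x = expinv (expinv 3)" using uK by (simp add: \<eta>_def cutoff_low)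
      ultimately show ?thesis using D(4)[of "x \<bullet> x / K\<^sup>2"] uK by (simp add: formula)
    qed
    have far: "- (C1 * K powr - n) \<le> div_field h x" for x
    proof -
      let ?u = "x \<bullet> x / K\<^sup>2"
      have a: "0 \<le> n * (1 + x \<bullet> x) powr (- n / 2 - 1) * \<eta> x"
        using n by (simp add: \<eta>_def cutoff_nonneg)
      \<comment> \<open>The cutoff varies only where 1 <= |x|^2/K^2 <= 4, and there w <= K^(-n); the
        constant is 2 * 4 * M.\<close>
      have "\<bar>2 * ?u * w x * D ?u\<bar> \<le> C1 * K powr - n"
      proof (cases "?u < 1 \<or> 4 < ?u")
        case True
        then show ?thesis using D(4)[of ?u] C1 by simp
      next
        case False
        then have "K\<^sup>2 \<le> x \<bullet> x" using K by (simp add: pos_le_divide_eq not_less)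
        then have "w x \<le> (K\<^sup>2) powr (- n / 2)"
          unfolding w_def using n K by (intro powr_mono2') (auto intro: add_increasing)
        also have "\<dots> = K powr - n"
          using K by (simp add: powr_powr[symmetric] powr_numeral[symmetric] powr_powr del: powr_numeral)
        finally have w: "w x \<le> K powr - n" .
        have "\<bar>2 * ?u * w x * D ?u\<bar> = 2 * ?u * w x * \<bar>D ?u\<bar>" by (simp add: abs_mult w_def)
        also have "\<dots> \<le> (2 * 4) * K powr - n * M"
          using w D(3)[of ?u] False by (intro mult_mono) (auto simp: w_def)
        finally show ?thesis by (simp add: C1_def mult_ac)
      qed
      then show ?thesis using a unfolding formula by linarith
    qed
    show ?thesis using sh zero near far by blast
  qed
  then show ?thesis using that c0 C1 unfolding n_def by blast
qed

lemma div_field_support: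
  assumes h: "smooth h" "\<And>x. R \<le> norm x \<Longrightarrow> h x = 0" and x: "R < norm x"
  shows "div_field h x = 0"
  unfolding div_field_def
proof (rule sum.neutral, rule)
  fix i :: 'a
  have "((\<lambda>x. 0) has_derivative (\<lambda>v. 0)) (at x)" by simp
  moreover have "open {x :: 'a. R < norm x}" by (intro open_Collect_less continuous_intros)
  ultimately have "((\<lambda>x. h x * (x \<bullet> i)) has_derivative (\<lambda>v. 0)) (at x)"
    by (rule has_derivative_transform_within_open[of _ _ _ _ "{x. R < norm x}"]) (use h(2) x in auto)
  then show "frechet_derivative (\<lambda>x. h x * (x \<bullet> i)) (at x) i = 0" by (simp add: frechet_derivative_eqI)
qed

lemma smooth_div_field: "smooth h \<Longrightarrow> smooth (div_field h)"
  unfolding div_field_def[abs_def]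
  by (intro smooth_sum smooth_frechet smooth_mult smooth_inner)

text \<open>A rescaled profile is a divergence, so it pairs with Sobolev functions through their gradients.\<close>

lemma div_field_pairing:
  fixes \<Omega> :: "'a::euclidean_space set"
  assumes \<Omega>: "open \<Omega>" "bounded \<Omega>" and p: "1 < p" and vg: "(v, g) \<in> sobolev_W1_0 p \<Omega>"
    and h: "smooth h" "\<And>x. R \<le> norm x \<Longrightarrow> h x = 0" and r: "0 < r" and dom: "cball x0 (R * r) \<subseteq> \<Omega>"
  shows "integrable (leb \<Omega>) (\<lambda>x. div_field h ((x - x0) /\<^sub>R r) * v x)"
    and "(LINT x|leb \<Omega>. div_field h ((x - x0) /\<^sub>R r) * v x) =
      - (LINT x|leb \<Omega>. g x \<bullet> (h ((x - x0) /\<^sub>R r) *\<^sub>R (x - x0)))"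
proof -
  have W: "mem_Lp (leb \<Omega>) p v" "mem_Lp (leb \<Omega>) p g" "weak_gradient \<Omega> v g"
    using vg by (auto simp: sobolev_W1_0_def sobolev_W1_def)
  have fin: "finite_measure (leb \<Omega>)" using \<Omega> by (intro finite_measure_leb) auto
  have iv: "integrable (leb \<Omega>) v" "integrable (leb \<Omega>) g"
    by (rule mem_Lp_imp_L1(1)[OF p fin W(1)], rule mem_Lp_imp_L1(1)[OF p fin W(2)])
  \<comment> \<open>The factor r offsets the 1/r of the chain rule, so that the divergence of the
    field with components \<open>\<Psi> i\<close> is the rescaled profile itself.\<close>
  define \<Psi> where "\<Psi> i x = r * (h ((x - x0) /\<^sub>R r) * (((x - x0) /\<^sub>R r) \<bullet> i))" for i x
  have \<Psi>: "\<Psi> i \<in> Cc_infinity \<Omega>" for i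
  proof (rule Cc_infinityI[OF _ compact_cball dom])
    show "smooth (\<Psi> i)" unfolding \<Psi>_def[abs_def]
      by (rule smooth_mult[OF smooth_const smooth_scale[OF smooth_mult[OF h(1) smooth_inner]]])
    show "\<Psi> i x = 0" if "x \<notin> cball x0 (R * r)" for x
    proof -
      have "R \<le> norm ((x - x0) /\<^sub>R r)"
        using that r by (simp add: dist_norm norm_minus_commute divide_inverse[symmetric] pos_le_divide_eq mult.commute[of "inverse r"])
      then show ?thesis using h(2) by (simp add: \<Psi>_def)
    qed
  qed
  have d\<Psi>: "frechet_derivative (\<Psi> i) (at x) i = frechet_derivative (\<lambda>x. h x * (x \<bullet> i)) (at ((x - x0) /\<^sub>R r)) i" for i x
  proof -
    have sm: "smooth (\<lambda>x. h x * (x \<bullet> i))" by (intro smooth_mult h(1) smooth_inner)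
    have 1: "((\<lambda>x. (x - x0) /\<^sub>R r) has_derivative (\<lambda>v. v /\<^sub>R r)) (at x)"
      by (auto intro!: derivative_eq_intros)
    have "((\<lambda>x. h ((x - x0) /\<^sub>R r) * (((x - x0) /\<^sub>R r) \<bullet> i)) has_derivative
        (\<lambda>v. frechet_derivative (\<lambda>x. h x * (x \<bullet> i)) (at ((x - x0) /\<^sub>R r)) (v /\<^sub>R r))) (at x)"
      using diff_chain_at[OF 1 smooth_has_derivative[OF sm]] by (simp add: o_def)
    then have "(\<Psi> i has_derivative (\<lambda>v. r * frechet_derivative (\<lambda>x. h x * (x \<bullet> i)) (at ((x - x0) /\<^sub>R r)) (v /\<^sub>R r))) (at x)"
      unfolding \<Psi>_def[abs_def] by (rule has_derivative_mult_right)
    then show ?thesis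
      using r by (simp add: frechet_derivative_eqI frechet_linear(2)[OF smooth_differentiable[OF sm]])
  qed
  have bdd: "integrable (leb \<Omega>) (\<lambda>x. u x * k x)" if u: "integrable (leb \<Omega>) u" and k: "k \<in> Cc_infinity \<Omega>" for u k
  proof -
    obtain b where b: "\<And>x. \<bar>k x\<bar> \<le> b" using Cc_infinity_bounded[OF k] by blast
    show ?thesis
    proof (rule Bochner_Integration.integrable_bound[of _ "\<lambda>x. b * u x"])
      show "(\<lambda>x. u x * k x) \<in> borel_measurable (leb \<Omega>)"
        using u by (intro borel_measurable_times borel_measurable_leb[OF Cc_infinity_borel[OF k]]) auto
      show "AE x in leb \<Omega>. norm (u x * k x) \<le> norm (b * u x)"
        using b order_trans[OF abs_ge_zero b] by (auto simp: abs_mult mult.commute intro!: mult_right_mono)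
    qed (use u in simp)
  qed
  have i1: "integrable (leb \<Omega>) (\<lambda>x. v x * frechet_derivative (\<Psi> i) (at x) i)" for i
    by (rule bdd[OF iv(1) Cc_infinity_frechet[OF \<Psi>]])
  have i2: "integrable (leb \<Omega>) (\<lambda>x. (g x \<bullet> i) * \<Psi> i x)" for i
    by (rule bdd[OF _ \<Psi>]) (use iv(2) in simp)
  have e1: "div_field h ((x - x0) /\<^sub>R r) * v x = (\<Sum>i\<in>Basis. v x * frechet_derivative (\<Psi> i) (at x) i)" for x
    unfolding d\<Psi> by (simp add: div_field_def sum_distrib_left mult.commute)
  have e2: "(\<Sum>i\<in>Basis. (g x \<bullet> i) * \<Psi> i x) = g x \<bullet> (h ((x - x0) /\<^sub>R r) *\<^sub>R (x - x0))" for x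
  proof -
    have "(\<Sum>i\<in>Basis. (g x \<bullet> i) * \<Psi> i x) = (\<Sum>i\<in>Basis. h ((x - x0) /\<^sub>R r) * ((g x \<bullet> i) * ((x - x0) \<bullet> i)))"
      using r by (intro sum.cong refl) (simp add: \<Psi>_def)
    also have "\<dots> = h ((x - x0) /\<^sub>R r) * (g x \<bullet> (x - x0))"
      by (simp add: sum_distrib_left[symmetric] euclidean_inner[of "g x" "x - x0"])
    finally show ?thesis by simp
  qed
  show "integrable (leb \<Omega>) (\<lambda>x. div_field h ((x - x0) /\<^sub>R r) * v x)"
    unfolding e1 by (intro Bochner_Integration.integrable_sum i1)
  have "(LINT x|leb \<Omega>. div_field h ((x - x0) /\<^sub>R r) * v x) = (\<Sum>i\<in>Basis. LINT x|leb \<Omega>. v x * frechet_derivative (\<Psi> i) (at x) i)"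
    unfolding e1 by (intro Bochner_Integration.integral_sum i1)
  also have "\<dots> = (\<Sum>i\<in>Basis. - (LINT x|leb \<Omega>. (g x \<bullet> i) * \<Psi> i x))"
    using W(3) \<Psi> by (intro sum.cong refl) (auto simp: weak_gradient_def)
  also have "\<dots> = - (LINT x|leb \<Omega>. (\<Sum>i\<in>Basis. (g x \<bullet> i) * \<Psi> i x))"
    using i2 by (simp add: Bochner_Integration.integral_sum sum_negf)
  finally show "(LINT x|leb \<Omega>. div_field h ((x - x0) /\<^sub>R r) * v x) =
      - (LINT x|leb \<Omega>. g x \<bullet> (h ((x - x0) /\<^sub>R r) *\<^sub>R (x - x0)))"
    by (simp add: e2)
qed

section \<open>Superpositions over disjoint cylinders\<close>

text \<open>At a given point at most one summand is nonzero, so the power passes through the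
  sum.\<close>

lemma disjoint_sum_powr_le:
  fixes f :: "'i \<Rightarrow> 'c::euclidean_space"
  assumes I: "finite I" and Q: "disjoint_family_on Q I"
    and f0: "\<And>i. i \<in> I \<Longrightarrow> z \<notin> Q i \<Longrightarrow> f i = 0" and fb: "\<And>i. i \<in> I \<Longrightarrow> norm (f i) \<le> b i" and q: "0 < q"
  shows "norm (\<Sum>i\<in>I. f i) powr q \<le> (\<Sum>i\<in>I. b i powr q * indicator (Q i) z)"
proof (cases "\<exists>j\<in>I. z \<in> Q j")
  case True
  then obtain j where j: "j \<in> I" "z \<in> Q j" by blast
  have "z \<notin> Q i" if "i \<in> I" "i \<noteq> j" for i
    using Q j that unfolding disjoint_family_on_def by blast
  then have "f i = 0" if "i \<in> I - {j}" for i using f0 that by blast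
  then have "(\<Sum>i\<in>I. f i) = f j" using sum.remove[OF I j(1), of f] by simp
  then have "norm (\<Sum>i\<in>I. f i) powr q \<le> b j powr q * indicator (Q j) z"
    using fb[OF j(1)] j(2) q by (simp add: powr_mono2)
  also have "\<dots> \<le> (\<Sum>i\<in>I. b i powr q * indicator (Q i) z)"
    by (rule member_le_sum[OF j(1)]) (use I in auto)
  finally show ?thesis .
next
  case False
  then have "(\<Sum>i\<in>I. f i) = 0" using f0 by (intro sum.neutral) blast
  then show ?thesis using q by (simp add: sum_nonneg)
qed

text \<open>The q-th power of the norm is additive over disjoint supports: this is where summation
  over many cylinders causes no loss.\<close>

lemma disjoint_sum_Lp_le:
  fixes f :: "'i \<Rightarrow> 'a::euclidean_space \<Rightarrow> 'c::euclidean_space"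
  assumes I: "finite I" and Q: "disjoint_family_on Q I"
    and Qm: "\<And>i. i \<in> I \<Longrightarrow> Q i \<in> sets borel" "\<And>i. i \<in> I \<Longrightarrow> bounded (Q i)"
    and f0: "\<And>i z. i \<in> I \<Longrightarrow> z \<notin> Q i \<Longrightarrow> f i z = 0" and fb: "\<And>i z. i \<in> I \<Longrightarrow> norm (f i z) \<le> b i"
    and q: "0 < q" and U: "U \<in> sets borel"
  shows "(LINT z|leb U. norm (\<Sum>i\<in>I. f i z) powr q) \<le> (\<Sum>i\<in>I. b i powr q * measure lborel (Q i))"
proof -
  have i: "integrable lborel (\<lambda>z. b i powr q * indicator (Q i) z :: real)" if "i \<in> I" for i
    using Qm[OF that] emeasure_bounded_finite[OF Qm(2)[OF that]]
    by (intro integrable_mult_right integrable_real_indicator) auto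
  have iS: "integrable lborel (\<lambda>z. \<Sum>i\<in>I. b i powr q * indicator (Q i) z :: real)"
    by (intro Bochner_Integration.integrable_sum i)
  have "(LINT z|leb U. norm (\<Sum>i\<in>I. f i z) powr q) = (LINT z|lborel. indicator U z * norm (\<Sum>i\<in>I. f i z) powr q)"
    using U by (simp add: integral_restrict_space)
  also have "\<dots> \<le> (LINT z|lborel. (\<Sum>i\<in>I. b i powr q * indicator (Q i) z))"
  proof (rule integral_mono'[OF iS])
    fix z
    have 0: "0 \<le> (\<Sum>i\<in>I. b i powr q * indicator (Q i) z :: real)" by (intro sum_nonneg) auto
    have "norm (\<Sum>i\<in>I. f i z) powr q \<le> (\<Sum>i\<in>I. b i powr q * indicator (Q i) z)"
      by (rule disjoint_sum_powr_le[OF I Q _ _ q]) (use f0 fb in auto)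
    then show "indicator U z * norm (\<Sum>i\<in>I. f i z) powr q \<le> (\<Sum>i\<in>I. b i powr q * indicator (Q i) z)"
      "0 \<le> (\<Sum>i\<in>I. b i powr q * indicator (Q i) z :: real)" using 0 by (auto simp: indicator_def)
  qed
  also have "\<dots> = (\<Sum>i\<in>I. LINT z|lborel. b i powr q * indicator (Q i) z)"
    by (intro Bochner_Integration.integral_sum i)
  also have "\<dots> = (\<Sum>i\<in>I. b i powr q * measure lborel (Q i))" by simp
  finally show ?thesis .
qed

section \<open>Volumes of cylinders, the time cutoff and superposed profiles\<close>

lemma pcyl_borel: "pcyl p a r \<in> sets borel" and pcyl_bounded: "bounded (pcyl p a r)"
  by (rule borel_open[OF open_pcyl]) (cases a, auto simp: pcyl_def intro!: bounded_Times)

lemma measure_pcyl: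
  fixes a :: "'a::euclidean_space \<times> real"
  assumes r: "0 < r"
  shows "measure lborel (pcyl p a r) = measure lborel (unit_cylinder :: ('a \<times> real) set) * (r ^ DIM('a) * r powr p)"
proof -
  have su: "(unit_cylinder :: ('a \<times> real) set) \<in> sets borel"
    unfolding unit_cylinder_def by (intro borel_open open_Times) auto
  have eq: "indicator unit_cylinder (rescale p r a z) = (indicator (pcyl p a r) z :: real)" for z
    by (simp add: indicator_def rescale_in_unit_cylinder[OF r])
  have "(LINT w|lborel. indicator (unit_cylinder :: ('a \<times> real) set) w :: real) =
      (LINT z|lborel. indicator (pcyl p a r) z) / (r ^ DIM('a) * r powr p)"
    using rescale_integral[of "\<lambda>z w. indicator unit_cylinder w" p r a, OF _ r]
      borel_measurable_indicator[OF pcyl_borel, of p a r] by (simp add: eq)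
  then have "measure lborel (unit_cylinder :: ('a \<times> real) set) = measure lborel (pcyl p a r) / (r ^ DIM('a) * r powr p)"
    using su pcyl_borel[of p a r] by simp
  moreover have "r ^ DIM('a) * r powr p \<noteq> 0" using r by simp
  ultimately show ?thesis by (metis nonzero_eq_divide_eq)
qed

text \<open>Stretching by 2 keeps the cutoff bounded away from 0 on |\<tau>| < 1, which
  \<open>bump\<close> itself is not.\<close>

definition tbump :: "real \<Rightarrow> real" where
  "tbump \<tau> = bump (\<tau> / 2)"

definition tbump' :: "real \<Rightarrow> real" where
  "tbump' \<tau> = frechet_derivative tbump (at \<tau>) 1"

lemma smooth_tbump: "smooth tbump"
proof -
  have eq: "tbump = (\<lambda>\<tau>. bump ((\<tau> - 0) /\<^sub>R 2))" by (simp add: tbump_def fun_eq_iff)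
  show ?thesis unfolding eq by (rule smooth_scale[OF smooth_bump])
qed

lemma tbump_DERIV: "(tbump has_real_derivative tbump' \<tau>) (at \<tau>)"
proof -
  have "frechet_derivative tbump (at \<tau>) h = tbump' \<tau> * h" for h
    using frechet_linear(2)[OF smooth_differentiable[OF smooth_tbump], of \<tau> h 1] by (simp add: tbump'_def)
  then have "frechet_derivative tbump (at \<tau>) = (*) (tbump' \<tau>)" by (simp add: fun_eq_iff)
  then show ?thesis using smooth_has_derivative[OF smooth_tbump, of \<tau>] by (simp add: has_field_derivative_def)
qed

lemma tbump_nonneg: "0 \<le> tbump \<tau>" and tbump_le_1: "tbump \<tau> \<le> 1"
  by (simp_all add: tbump_def bump_nonneg bump_le_1)

lemma tbump_eq_0: "2 \<le> \<bar>\<tau>\<bar> \<Longrightarrow> tbump \<tau> = 0"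
  by (simp add: tbump_def bump_eq_0)

lemma tbump_near: "\<bar>\<tau>\<bar> < 1 \<Longrightarrow> expinv (3 / 4) \<le> tbump \<tau>"
  using power_mono[of "\<bar>\<tau>\<bar>" 1 2] unfolding tbump_def bump_def
  by (intro expinv_mono) (simp add: power2_eq_square)

lemma tbump'_eq_0: "2 < \<bar>\<tau>\<bar> \<Longrightarrow> tbump' \<tau> = 0"
proof -
  assume \<tau>: "2 < \<bar>\<tau>\<bar>"
  have "(tbump has_real_derivative 0) (at \<tau>)"
    by (rule has_field_derivative_transform_within_open[of "\<lambda>_. 0" _ _ "{\<tau>. 2 < \<bar>\<tau>\<bar>}"])
      (use \<tau> tbump_eq_0 in \<open>auto intro!: open_Collect_less continuous_intros\<close>)
  then show ?thesis using tbump_DERIV DERIV_unique by blast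
qed

lemma continuous_tbump': "continuous_on UNIV tbump'"
  unfolding tbump'_def[abs_def] by (rule smooth_continuous_on[OF smooth_frechet[OF smooth_tbump]])

text \<open>There are no weights: every cylinder contributes a profile of the same amplitude, and
  scaling alone decides what it costs in the norm.\<close>

definition cluster :: "real \<Rightarrow> ('a::euclidean_space \<Rightarrow> real) \<Rightarrow> ('i \<Rightarrow> 'a \<times> real) \<Rightarrow> ('i \<Rightarrow> real) \<Rightarrow> 'i set \<Rightarrow> 'a \<times> real \<Rightarrow> real" where
  "cluster p h z r I w =
    (\<Sum>i\<in>I. tbump (snd (rescale p (r i) (z i) w)) * div_field h (fst (rescale p (r i) (z i) w)))"

text \<open>The profile lives in |y| <= 2 K, |\<tau>| <= 2. The factor 3 K leaves strict room around
  it in space, and in time too, since 2 r^p < 3 r^p <= (3 K r)^p for p >= 1.\<close>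

lemma rescale_outside:
  assumes p: "1 \<le> p" and K: "1 < K" and r: "0 < r" and w: "w \<notin> pcyl p a (3 * K * r)"
  shows "2 * K < norm (fst (rescale p r a w)) \<or> 2 < \<bar>snd (rescale p r a w)\<bar>"
proof (rule ccontr)
  assume *: "\<not> ?thesis"
  obtain x t y s where az: "a = (x, t)" "w = (y, s)" by (cases a; cases w)
  have "dist x y \<le> 2 * K * r"
    using * r by (simp add: az rescale_def dist_norm norm_minus_commute divide_inverse[symmetric] mult.commute[of "inverse r"] pos_divide_le_eq not_less)
  also have "\<dots> < 3 * K * r" using K r by simp
  finally have 1: "dist x y < 3 * K * r" .
  have "\<bar>s - t\<bar> \<le> 2 * r powr p"
    using * r by (simp add: az rescale_def abs_divide pos_divide_le_eq not_less)
  also have "\<dots> < 3 * r powr p" using r by simp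
  also have "\<dots> \<le> (3 * K) powr p * r powr p"
  proof (rule mult_right_mono)
    have "(3::real) \<le> (3 * K) powr 1" using K by simp
    also have "\<dots> \<le> (3 * K) powr p" using K p by (intro powr_mono) auto
    finally show "3 \<le> (3 * K) powr p" .
  qed simp
  also have "\<dots> = (3 * K * r) powr p" using K r by (simp add: powr_mult)
  finally show False using 1 w by (simp add: az mem_pcyl)
qed

lemma real_of_ereal_le: "x \<le> ereal c \<Longrightarrow> 0 \<le> c \<Longrightarrow> real_of_ereal x \<le> c"
  by (cases x) auto

text \<open>The spatial profiles keep the support inside the domain; in time the support is only
  bounded, as test functions may extend beyond (0,T).\<close>

lemma cluster_test_function:
  fixes z :: "'i \<Rightarrow> 'a::euclidean_space \<times> real"
  assumes p: "1 \<le> p" and h: "smooth h" "\<And>x. 2 * K \<le> norm x \<Longrightarrow> h x = 0" and K: "1 < K"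
    and I: "finite I" and r: "\<And>i. i \<in> I \<Longrightarrow> 0 < r i" and dom: "\<And>i. i \<in> I \<Longrightarrow> cball (fst (z i)) (2 * K * r i) \<subseteq> \<Omega>"
  shows "cluster p h z r I \<in> test_functions \<Omega>"
  unfolding test_functions_def cluster_def[abs_def]
proof (rule Cc_infinity_sum[OF I])
  fix i assume i: "i \<in> I"
  let ?K = "cball (fst (z i)) (2 * K * r i) \<times> cball (snd (z i)) (2 * r i powr p)"
  show "(\<lambda>w. tbump (snd (rescale p (r i) (z i) w)) * div_field h (fst (rescale p (r i) (z i) w))) \<in> Cc_infinity (\<Omega> \<times> UNIV)"
  proof (rule Cc_infinityI[of _ ?K])
    have "smooth (\<lambda>w :: 'a \<times> real. tbump ((snd w - snd (z i)) / r i powr p))"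
    proof -
      have "(s - t) / c = (s - t) /\<^sub>R c" for s t c :: real by (simp only: divide_inverse real_scaleR_def mult.commute)
      then show ?thesis by (simp only:) (rule smooth_snd[OF smooth_scale[OF smooth_tbump]])
    qed
    moreover have "smooth (\<lambda>w :: 'a \<times> real. div_field h ((fst w - fst (z i)) /\<^sub>R r i))"
      by (rule smooth_fst[OF smooth_scale[OF smooth_div_field[OF h(1)]]])
    ultimately show "smooth (\<lambda>w. tbump (snd (rescale p (r i) (z i) w)) * div_field h (fst (rescale p (r i) (z i) w)))"
      unfolding rescale_def fst_conv snd_conv by (rule smooth_mult)
    show "compact ?K" by (intro compact_Times compact_cball)
    show "?K \<subseteq> \<Omega> \<times> UNIV" using dom[OF i] by auto
    fix w assume w: "w \<notin> ?K"
    obtain y s where ws: "w = (y, s)" by (cases w)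
    have "2 * K < norm (fst (rescale p (r i) (z i) w)) \<or> 2 < \<bar>snd (rescale p (r i) (z i) w)\<bar>"
      using w r[OF i]
      by (auto simp: ws rescale_def dist_norm norm_minus_commute divide_inverse[symmetric] mult.commute[of "inverse (r i)"]
          pos_less_divide_eq abs_divide dist_real_def abs_minus_commute)
    then show "tbump (snd (rescale p (r i) (z i) w)) * div_field h (fst (rescale p (r i) (z i) w)) = 0"
      using div_field_support[OF h] tbump_eq_0 by auto
  qed
qed

lemma cluster_derivatives:
  fixes z :: "'i \<Rightarrow> 'a::euclidean_space \<times> real"
  assumes h: "smooth h"
  shows "space_gradient (cluster p h z r I) w =
      (\<Sum>i\<in>I. tbump (snd (rescale p (r i) (z i) w)) *\<^sub>R (gradient (div_field h) (fst (rescale p (r i) (z i) w)) /\<^sub>R r i))"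
    and "time_derivative (cluster p h z r I) w =
      (\<Sum>i\<in>I. tbump' (snd (rescale p (r i) (z i) w)) / r i powr p * div_field h (fst (rescale p (r i) (z i) w)))"
proof -
  obtain x t where w: "w = (x, t)" by (cases w)
  have sd: "smooth (div_field h)" by (rule smooth_div_field[OF h])
  have g: "((\<lambda>y. div_field h ((y - x0) /\<^sub>R \<rho>)) has_derivative (\<lambda>v. (gradient (div_field h) ((x - x0) /\<^sub>R \<rho>) /\<^sub>R \<rho>) \<bullet> v)) (at x)" for x0 \<rho>
  proof -
    have 1: "((\<lambda>x. (x - x0) /\<^sub>R \<rho>) has_derivative (\<lambda>v. v /\<^sub>R \<rho>)) (at x)"
      by (auto intro!: derivative_eq_intros)
    show ?thesis
      using diff_chain_at[OF 1 smooth_has_derivative[OF sd]]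
      by (simp add: o_def frechet_eq_gradient[OF smooth_differentiable[OF sd]])
  qed
  have "((\<lambda>y. cluster p h z r I (y, t)) has_derivative
      (\<lambda>v. \<Sum>i\<in>I. tbump (snd (rescale p (r i) (z i) w)) *
        ((gradient (div_field h) (fst (rescale p (r i) (z i) w)) /\<^sub>R r i) \<bullet> v))) (at x)"
    unfolding cluster_def rescale_def w fst_conv snd_conv
    by (intro has_derivative_sum has_derivative_mult_right g)
  also have "(\<lambda>v. \<Sum>i\<in>I. tbump (snd (rescale p (r i) (z i) w)) *
        ((gradient (div_field h) (fst (rescale p (r i) (z i) w)) /\<^sub>R r i) \<bullet> v)) =
      (\<lambda>v. (\<Sum>i\<in>I. tbump (snd (rescale p (r i) (z i) w)) *\<^sub>R (gradient (div_field h) (fst (rescale p (r i) (z i) w)) /\<^sub>R r i)) \<bullet> v)"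
    by (simp add: inner_sum_left mult.assoc)
  finally show "space_gradient (cluster p h z r I) w =
      (\<Sum>i\<in>I. tbump (snd (rescale p (r i) (z i) w)) *\<^sub>R (gradient (div_field h) (fst (rescale p (r i) (z i) w)) /\<^sub>R r i))"
    unfolding space_gradient_def w prod.case by (rule gradient_eqI)
  have td: "((\<lambda>s. tbump ((s - t0) / \<rho>) * c) has_real_derivative tbump' ((t - t0) / \<rho>) / \<rho> * c) (at t)" for t0 \<rho> c
  proof -
    have "((\<lambda>s. (s - t0) / \<rho>) has_real_derivative 1 / \<rho>) (at t)"
      unfolding divide_inverse by (auto intro!: derivative_eq_intros)
    then have "((\<lambda>s. tbump ((s - t0) / \<rho>)) has_real_derivative tbump' ((t - t0) / \<rho>) * (1 / \<rho>)) (at t)"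
      by (rule DERIV_chain2[OF tbump_DERIV])
    then have "((\<lambda>s. tbump ((s - t0) / \<rho>) * c) has_real_derivative tbump' ((t - t0) / \<rho>) * (1 / \<rho>) * c) (at t)"
      by (rule DERIV_cmult_right)
    then show ?thesis by simp
  qed
  have "((\<lambda>s. cluster p h z r I (x, s)) has_real_derivative
      (\<Sum>i\<in>I. tbump' (snd (rescale p (r i) (z i) w)) / r i powr p * div_field h (fst (rescale p (r i) (z i) w)))) (at t)"
    unfolding cluster_def rescale_def w fst_conv snd_conv by (intro DERIV_sum td)
  then show "time_derivative (cluster p h z r I) w =
      (\<Sum>i\<in>I. tbump' (snd (rescale p (r i) (z i) w)) / r i powr p * div_field h (fst (rescale p (r i) (z i) w)))"
    unfolding time_derivative_def w prod.case by (rule DERIV_imp_deriv)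
qed

text \<open>With cylinders of volume of order r^(n+p), every part of the norm costs r^n per
  cylinder: gradients are of order r^(-1) and taken to the power p; the field G whose divergence is
  the time derivative is of order r^(1-p) and taken to the power p/(p-1); the L^2 norm at a fixed
  time sees only balls of volume of order r^n.\<close>

lemma cluster_norm_bound:
  fixes \<Omega> :: "'a::euclidean_space set"
  assumes \<Omega>: "open \<Omega>" "bounded \<Omega>" and p: "1 < p"
    and h: "smooth h" "\<And>x. 2 * K \<le> norm x \<Longrightarrow> h x = 0" and K: "1 < K"
  obtains A where "0 \<le> A"
    "\<And>I (z :: 'i \<Rightarrow> 'a \<times> real) r. finite I \<Longrightarrow> (\<And>i. i \<in> I \<Longrightarrow> 0 < r i) \<Longrightarrow>
      (\<And>i. i \<in> I \<Longrightarrow> cball (fst (z i)) (2 * K * r i) \<subseteq> \<Omega>) \<Longrightarrow>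
      disjoint_family_on (\<lambda>i. pcyl p (z i) (3 * K * r i)) I \<Longrightarrow>
      WM_norm p \<Omega> T (cluster p h z r I) \<le>
        A * ((\<Sum>i\<in>I. r i ^ DIM('a)) powr (1 / p) + (\<Sum>i\<in>I. r i ^ DIM('a)) powr (1 - 1 / p) + (\<Sum>i\<in>I. r i ^ DIM('a)) powr (1 / 2))"
proof -
  let ?U = "\<Omega> \<times> {0<..<T}"
  have bor: "\<Omega> \<in> sets borel" "{0<..<T} \<in> sets borel" using \<Omega> by auto
  have U: "?U \<in> sets borel" "bounded ?U"
    using \<Omega> by (auto intro!: borel_Times bounded_Times)
  define q where "q = p / (p - 1)"
  have q: "1 < q" "1 / p + 1 / q = 1" "1 / q = 1 - 1 / p" using p by (simp_all add: q_def field_simps)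
  have sd: "smooth (div_field h)" by (rule smooth_div_field[OF h(1)])
  have ds: "div_field h x = 0" if "2 * K < norm x" for x by (rule div_field_support[OF h that])
  have dC: "div_field h \<in> Cc_infinity UNIV"
    by (rule Cc_infinityI[OF sd compact_cball, of 0 "2 * K"]) (auto intro: ds)
  have gs: "gradient (div_field h) x = 0" if x: "2 * K < norm x" for x
  proof (rule gradient_eqI)
    have "((\<lambda>x. 0) has_derivative (\<lambda>v. 0)) (at x)" by simp
    moreover have "open {x :: 'a. 2 * K < norm x}" by (intro open_Collect_less continuous_intros)
    ultimately have "(div_field h has_derivative (\<lambda>v. 0)) (at x)"
      by (rule has_derivative_transform_within_open[of _ _ _ _ "{x. 2 * K < norm x}"]) (use ds x in auto)
    then show "(div_field h has_derivative (\<lambda>v. 0 \<bullet> v)) (at x)" by simp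
  qed
  obtain B1 where B1: "\<And>x. \<bar>div_field h x\<bar> \<le> B1" using Cc_infinity_bounded[OF dC] by blast
  obtain K2 where K2: "compact K2" "\<And>x. x \<notin> K2 \<Longrightarrow> gradient (div_field h) x = 0" using gradient_support[OF dC] by metis
  obtain B2 where B2: "\<And>x. norm (gradient (div_field h) x) \<le> B2"
    using bounded_compact_support[OF continuous_on_gradient[OF sd] K2] by blast
  have ch: "continuous_on UNIV (\<lambda>x. h x *\<^sub>R x)" by (intro continuous_intros smooth_continuous_on h(1))
  have hz: "h x *\<^sub>R x = 0" if "x \<notin> cball 0 (2 * K)" for x using that h(2)[of x] by simp
  obtain B3 where B3: "\<And>x. norm (h x *\<^sub>R x) \<le> B3"
    using bounded_compact_support[OF ch compact_cball hz] by blast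
  have tz: "tbump' \<tau> = 0" if "\<tau> \<notin> cball 0 2" for \<tau> using that tbump'_eq_0[of \<tau>] by simp
  obtain B4 where B4: "\<And>\<tau>. norm (tbump' \<tau>) \<le> B4"
    using bounded_compact_support[OF continuous_tbump' compact_cball tz] by blast
  define B where "B = 1 + \<bar>B1\<bar> + \<bar>B2\<bar> + \<bar>B3\<bar> + \<bar>B4\<bar>"
  have B0: "0 < B" by (simp add: B_def add_pos_nonneg)
  have Bs: "\<bar>div_field h x\<bar> \<le> B" "norm (gradient (div_field h) x) \<le> B" "norm (h x *\<^sub>R x) \<le> B" "\<bar>tbump' \<tau>\<bar> \<le> B" for x \<tau>
    using B1[of x] B2[of x] B3[of x] B4[of \<tau>] by (auto simp: B_def)
  define v where "v = measure lborel (unit_cylinder :: ('a \<times> real) set)"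
  define V where "V = v * ((3 * K) ^ DIM('a) * (3 * K) powr p)"
  define V' where "V' = unit_ball_vol (real DIM('a)) * (3 * K) ^ DIM('a)"
  have V0: "0 \<le> V" "0 \<le> V'" using K by (auto simp: V_def V'_def v_def)
  define A where "A = (B powr p * V) powr (1 / p) + ((B * B) powr q * V) powr (1 / q) + (B powr 2 * V') powr (1 / 2)"
  have A0: "0 \<le> A" by (simp add: A_def)
  have main: "WM_norm p \<Omega> T (cluster p h z r I) \<le>
        A * ((\<Sum>i\<in>I. r i ^ DIM('a)) powr (1 / p) + (\<Sum>i\<in>I. r i ^ DIM('a)) powr (1 - 1 / p) + (\<Sum>i\<in>I. r i ^ DIM('a)) powr (1 / 2))"
    if I: "finite I" and r: "\<And>i. i \<in> I \<Longrightarrow> 0 < r i" and dom: "\<And>i. i \<in> I \<Longrightarrow> cball (fst (z i)) (2 * K * r i) \<subseteq> \<Omega>"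
      and disj: "disjoint_family_on (\<lambda>i. pcyl p (z i) (3 * K * r i)) I"
    for I and z :: "'i \<Rightarrow> 'a \<times> real" and r
  proof -
    define S where "S = (\<Sum>i\<in>I. r i ^ DIM('a))"
    let ?Q = "\<lambda>i. pcyl p (z i) (3 * K * r i)"
    let ?s = "\<lambda>i w. rescale p (r i) (z i) w"
    have out: "2 * K < norm (fst (?s i w)) \<or> 2 < \<bar>snd (?s i w)\<bar>" if "i \<in> I" "w \<notin> ?Q i" for i w
      using rescale_outside[OF _ K r[OF that(1)] that(2)] p by simp
    have mQ: "measure lborel (?Q i) = V * (r i ^ DIM('a) * r i powr p)" if "i \<in> I" for i
      using measure_pcyl[of "3 * K * r i" p "z i"] r[OF that] K
      by (simp add: V_def v_def power_mult_distrib powr_mult)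
    \<comment> \<open>The condition on e * \<beta> cancels the time length r^p of the cylinder and
      leaves r^n; it holds for (e, \<beta>) = (-1, p) and for (1 - p, q).\<close>
    have vol: "(\<Sum>i\<in>I. (c * r i powr e) powr \<beta> * measure lborel (?Q i)) = c powr \<beta> * V * S"
      if e: "e * \<beta> = - p" and c: "0 \<le> c" for e \<beta> c
    proof -
      have "(c * r i powr e) powr \<beta> * measure lborel (?Q i) = c powr \<beta> * V * r i ^ DIM('a)" if i: "i \<in> I" for i
      proof -
        have "r i powr (e * \<beta>) * r i powr p = 1" using r[OF i] e by (simp add: powr_add[symmetric])
        then have "(r i powr e) powr \<beta> * r i powr p = 1" by (simp add: powr_powr)
        moreover have "(c * r i powr e) powr \<beta> = c powr \<beta> * (r i powr e) powr \<beta>" using c by (simp add: powr_mult)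
        ultimately show ?thesis unfolding mQ[OF i] by (metis (no_types, lifting) mult.assoc mult.commute mult.right_neutral)
      qed
      then show ?thesis by (simp add: S_def sum_distrib_left)
    qed
    define \<phi> where "\<phi> = cluster p h z r I"
    have N1: "WM_gradient_norm p \<Omega> T \<phi> \<le> (B powr p * V) powr (1 / p) * S powr (1 / p)"
    proof -
      have "(LINT w|leb ?U. norm (space_gradient \<phi> w) powr p) \<le> (\<Sum>i\<in>I. (B * r i powr -1) powr p * measure lborel (?Q i))"
        unfolding \<phi>_def cluster_derivatives(1)[OF h(1)]
      proof (rule disjoint_sum_Lp_le[OF I disj pcyl_borel pcyl_bounded _ _ _ U(1)])
        fix i w assume i: "i \<in> I"
        show "tbump (snd (?s i w)) *\<^sub>R (gradient (div_field h) (fst (?s i w)) /\<^sub>R r i) = 0" if "w \<notin> ?Q i"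
          using out[OF i that] gs tbump_eq_0 by auto
        have "norm (tbump (snd (?s i w)) *\<^sub>R (gradient (div_field h) (fst (?s i w)) /\<^sub>R r i)) =
            tbump (snd (?s i w)) * (norm (gradient (div_field h) (fst (?s i w))) * inverse (r i))"
          using r[OF i] by (simp add: tbump_nonneg)
        also have "\<dots> \<le> 1 * (B * inverse (r i))"
          using r[OF i] Bs(2) B0 by (intro mult_mono tbump_le_1) (auto simp: tbump_nonneg)
        finally show "norm (tbump (snd (?s i w)) *\<^sub>R (gradient (div_field h) (fst (?s i w)) /\<^sub>R r i)) \<le> B * r i powr -1"
          using r[OF i] by (simp add: powr_minus)
      qed (use p in auto)
      also have "\<dots> = B powr p * V * S" using B0 by (intro vol) auto
      finally have "WM_gradient_norm p \<Omega> T \<phi> \<le> (B powr p * V * S) powr (1 / p)"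
        unfolding WM_gradient_norm_def Lp_norm_def using p by (intro powr_mono2) (auto simp: integral_nonneg_AE)
      then show ?thesis by (simp add: powr_mult)
    qed
    have N2: "WM_time_norm p \<Omega> T \<phi> \<le> ((B * B) powr q * V) powr (1 / q) * S powr (1 / q)"
    proof -
      \<comment> \<open>At each time the time derivative of the cluster is the spatial divergence of
        this field, by \<open>div_field_pairing\<close> applied to the individual profiles.\<close>
      define G where "G w = (\<Sum>i\<in>I. (tbump' (snd (?s i w)) / r i powr p) *\<^sub>R (h (fst (?s i w)) *\<^sub>R (fst w - fst (z i))))" for w
      have Gi: "(tbump' (snd (?s i w)) / r i powr p) *\<^sub>R (h (fst (?s i w)) *\<^sub>R (fst w - fst (z i))) =
          (tbump' (snd (?s i w)) / r i powr p * r i) *\<^sub>R (h (fst (?s i w)) *\<^sub>R fst (?s i w))" if "i \<in> I" for i w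
        using r[OF that] by (simp add: rescale_def)
      have Gb: "norm ((tbump' (snd (?s i w)) / r i powr p) *\<^sub>R (h (fst (?s i w)) *\<^sub>R (fst w - fst (z i)))) \<le> B * B * r i powr (1 - p)"
        if i: "i \<in> I" for i w
      proof -
        have "norm ((tbump' (snd (?s i w)) / r i powr p) *\<^sub>R (h (fst (?s i w)) *\<^sub>R (fst w - fst (z i)))) =
            \<bar>tbump' (snd (?s i w))\<bar> * norm (h (fst (?s i w)) *\<^sub>R fst (?s i w)) * (r i / r i powr p)"
          unfolding Gi[OF i] using r[OF i] by (simp add: abs_mult)
        also have "\<dots> \<le> B * B * (r i / r i powr p)"
          using r[OF i] B0 Bs(3,4) by (intro mult_right_mono mult_mono) auto
        finally show ?thesis using r[OF i] by (simp add: powr_diff)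
      qed
      have rne: "r i \<noteq> 0" if "i \<in> I" for i using r[OF that] by simp
      have cG: "continuous_on UNIV G"
        unfolding G_def[abs_def]
        by (intro continuous_intros continuous_on_compose2[OF continuous_tbump'] continuous_on_compose2[OF smooth_continuous_on[OF h(1), of UNIV]]
            continuous_rescale) (use rne in auto)
      have normG: "norm (G w) \<le> (\<Sum>i\<in>I. B * B * r i powr (1 - p))" for w
        unfolding G_def by (intro order_trans[OF norm_sum] sum_mono Gb)
      have GLp: "mem_Lp (leb ?U) q G"
        using q by (intro mem_Lp_bounded[OF finite_measure_leb[OF U(2,1)] borel_measurable_leb[OF borel_measurable_continuous_onI[OF cG]] normG]) auto
      then have iG: "integrable (leb ?U) (\<lambda>w. norm (G w) powr q)" by (simp add: mem_Lp_def)
      have cGt: "continuous_on UNIV (\<lambda>x. G (x, t))" for t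
        by (rule continuous_on_compose2[OF cG]) (auto intro!: continuous_intros)
      have GtLp: "mem_Lp (leb \<Omega>) q (\<lambda>x. G (x, t))" for t
        using q by (intro mem_Lp_bounded[OF finite_measure_leb[OF \<Omega>(2) bor(1)] borel_measurable_leb[OF borel_measurable_continuous_onI[OF cGt]] normG]) auto
      have pairing: "\<bar>LINT x|leb \<Omega>. time_derivative \<phi> (x, t) * u x\<bar> \<le> Lp_norm (leb \<Omega>) q (\<lambda>x. G (x, t)) * Lp_norm (leb \<Omega>) p g"
        if ug: "(u, g) \<in> sobolev_W1_0 p \<Omega>" for u g t
      proof -
        define c where "c i = tbump' ((t - snd (z i)) / r i powr p) / r i powr p" for i
        have mg: "mem_Lp (leb \<Omega>) p g" using ug by (auto simp: sobolev_W1_0_def sobolev_W1_def)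
        have s: "?s i (x, t) = ((x - fst (z i)) /\<^sub>R r i, (t - snd (z i)) / r i powr p)" for i x
          by (simp add: rescale_def)
        have dp1: "integrable (leb \<Omega>) (\<lambda>x. div_field h ((x - x0) /\<^sub>R \<rho>) * u x)"
          if "0 < \<rho>" "cball x0 (2 * K * \<rho>) \<subseteq> \<Omega>" for x0 \<rho>
          by (rule div_field_pairing(1)[OF \<Omega> p ug h(1) _ that]) (rule h(2))
        have dp2: "(LINT x|leb \<Omega>. div_field h ((x - x0) /\<^sub>R \<rho>) * u x) =
            - (LINT x|leb \<Omega>. g x \<bullet> (h ((x - x0) /\<^sub>R \<rho>) *\<^sub>R (x - x0)))"
          if "0 < \<rho>" "cball x0 (2 * K * \<rho>) \<subseteq> \<Omega>" for x0 \<rho>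
          by (rule div_field_pairing(2)[OF \<Omega> p ug h(1) _ that]) (rule h(2))
        have "(LINT x|leb \<Omega>. time_derivative \<phi> (x, t) * u x) =
            (LINT x|leb \<Omega>. (\<Sum>i\<in>I. c i * (div_field h ((x - fst (z i)) /\<^sub>R r i) * u x)))"
          by (simp add: \<phi>_def cluster_derivatives(2)[OF h(1)] s c_def sum_distrib_right mult.assoc)
        also have "\<dots> = (\<Sum>i\<in>I. LINT x|leb \<Omega>. c i * (div_field h ((x - fst (z i)) /\<^sub>R r i) * u x))"
          by (rule Bochner_Integration.integral_sum) (use dp1[OF r dom] in auto)
        also have "\<dots> = (\<Sum>i\<in>I. c i * - (LINT x|leb \<Omega>. g x \<bullet> (h ((x - fst (z i)) /\<^sub>R r i) *\<^sub>R (x - fst (z i)))))"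
          by (intro sum.cong refl) (simp add: dp2[OF r dom])
        also have "\<dots> = - (\<Sum>i\<in>I. LINT x|leb \<Omega>. c i * (g x \<bullet> (h ((x - fst (z i)) /\<^sub>R r i) *\<^sub>R (x - fst (z i)))))"
          by (simp add: sum_negf)
        also have "(\<Sum>i\<in>I. LINT x|leb \<Omega>. c i * (g x \<bullet> (h ((x - fst (z i)) /\<^sub>R r i) *\<^sub>R (x - fst (z i))))) =
            (LINT x|leb \<Omega>. (\<Sum>i\<in>I. c i * (g x \<bullet> (h ((x - fst (z i)) /\<^sub>R r i) *\<^sub>R (x - fst (z i))))))"
        proof (intro Bochner_Integration.integral_sum[symmetric] integrable_mult_right)
          fix i assume i: "i \<in> I"
          have cH: "continuous_on UNIV (\<lambda>x. h ((x - fst (z i)) /\<^sub>R r i) *\<^sub>R (x - fst (z i)))"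
            by (intro continuous_intros continuous_on_compose2[OF smooth_continuous_on[OF h(1), of UNIV]]) auto
          have "norm (h ((x - fst (z i)) /\<^sub>R r i) *\<^sub>R (x - fst (z i))) \<le> r i * B" for x
          proof -
            define y where "y = (x - fst (z i)) /\<^sub>R r i"
            have "x - fst (z i) = r i *\<^sub>R y" using r[OF i] by (simp add: y_def)
            then have "norm (h y *\<^sub>R (x - fst (z i))) = r i * norm (h y *\<^sub>R y)" using r[OF i] by (simp add: abs_mult)
            also have "\<dots> \<le> r i * B" using Bs(3) r[OF i] by (intro mult_left_mono) auto
            finally show ?thesis unfolding y_def .
          qed
          then have "mem_Lp (leb \<Omega>) q (\<lambda>x. h ((x - fst (z i)) /\<^sub>R r i) *\<^sub>R (x - fst (z i)))"
            using q by (intro mem_Lp_bounded[OF finite_measure_leb[OF \<Omega>(2) bor(1)] borel_measurable_leb[OF borel_measurable_continuous_onI[OF cH]]]) auto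
          then show "integrable (leb \<Omega>) (\<lambda>x. g x \<bullet> (h ((x - fst (z i)) /\<^sub>R r i) *\<^sub>R (x - fst (z i))))"
            by (rule Holder_inner(1)[OF p q(2) mg])
        qed
        also have "(\<lambda>x. \<Sum>i\<in>I. c i * (g x \<bullet> (h ((x - fst (z i)) /\<^sub>R r i) *\<^sub>R (x - fst (z i))))) = (\<lambda>x. g x \<bullet> G (x, t))"
          by (simp add: G_def s c_def inner_sum_right fun_eq_iff mult.assoc)
        finally have "\<bar>LINT x|leb \<Omega>. time_derivative \<phi> (x, t) * u x\<bar> = \<bar>LINT x|leb \<Omega>. g x \<bullet> G (x, t)\<bar>" by simp
        also have "\<dots> \<le> Lp_norm (leb \<Omega>) p g * Lp_norm (leb \<Omega>) q (\<lambda>x. G (x, t))"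
          by (rule Holder_inner(2)[OF p q(2) mg GtLp])
        finally show ?thesis by (simp add: mult.commute)
      qed
      define d where "d t = dual_norm p \<Omega> (\<lambda>x. time_derivative \<phi> (x, t))" for t
      have d: "0 \<le> d t" "d t \<le> Lp_norm (leb \<Omega>) q (\<lambda>x. G (x, t))" for t
        unfolding d_def using dual_norm_nonneg[OF p pairing] dual_norm_le[OF p pairing Lp_norm_nonneg] by blast+
      \<comment> \<open>For \<open>integral_mono'\<close> only the majorant has to be integrable, so
        the measurability of d is not at issue.\<close>
      have "(LINT t|leb {0<..<T}. norm (d t) powr q) \<le> (LINT t|leb {0<..<T}. LINT x|leb \<Omega>. norm (G (x, t)) powr q)"
      proof (rule integral_mono'[OF integral_leb_Times(2)[OF bor iG]])
        fix t
        have "norm (d t) powr q \<le> Lp_norm (leb \<Omega>) q (\<lambda>x. G (x, t)) powr q"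
          using d q by (intro powr_mono2) auto
        also have "\<dots> = (LINT x|leb \<Omega>. norm (G (x, t)) powr q)"
          using q(1) by (simp add: Lp_norm_def powr_powr integral_nonneg_AE)
        finally show "norm (d t) powr q \<le> (LINT x|leb \<Omega>. norm (G (x, t)) powr q)" .
      qed (simp add: integral_nonneg_AE)
      also have "\<dots> = (LINT w|leb ?U. norm (G w) powr q)"
        by (rule integral_leb_Times(1)[OF bor iG, symmetric])
      also have "\<dots> \<le> (\<Sum>i\<in>I. (B * B * r i powr (1 - p)) powr q * measure lborel (?Q i))"
        unfolding G_def
      proof (rule disjoint_sum_Lp_le[OF I disj pcyl_borel pcyl_bounded _ Gb _ U(1)])
        fix i w assume i: "i \<in> I" and w: "w \<notin> ?Q i"
        show "(tbump' (snd (?s i w)) / r i powr p) *\<^sub>R (h (fst (?s i w)) *\<^sub>R (fst w - fst (z i))) = 0"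
          using out[OF i w] h(2)[of "fst (?s i w)"] tbump'_eq_0[of "snd (?s i w)"] by auto
      qed (use q in auto)
      also have "\<dots> = (B * B) powr q * V * S"
        using B0 p by (intro vol) (auto simp: q_def field_simps)
      finally have "WM_time_norm p \<Omega> T \<phi> \<le> ((B * B) powr q * V * S) powr (1 / q)"
        unfolding WM_time_norm_def Lp_norm_def q_def[symmetric] d_def[symmetric] using q(1)
        by (intro powr_mono2) (auto simp: integral_nonneg_AE)
      then show ?thesis by (simp add: powr_mult)
    qed
    have N3: "WM_sup_norm \<Omega> T \<phi> \<le> (B powr 2 * V') powr (1 / 2) * S powr (1 / 2)"
    proof -
      have L2: "Lp_norm (leb \<Omega>) 2 (\<lambda>x. \<phi> (x, t)) \<le> (B powr 2 * V') powr (1 / 2) * S powr (1 / 2)" for t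
      proof -
        \<comment> \<open>The slices of disjoint cylinders at time t form a disjoint family of
          balls, some of them empty.\<close>
        define Q' where "Q' i = {x. (x, t) \<in> ?Q i}" for i
        have Q'eq: "Q' i = (if \<bar>t - snd (z i)\<bar> < (3 * K * r i) powr p then ball (fst (z i)) (3 * K * r i) else {})" for i
          by (cases "z i") (auto simp: Q'_def mem_pcyl)
        have mQ': "measure lborel (Q' i) \<le> V' * r i ^ DIM('a)" if i: "i \<in> I" for i
          using content_ball[of "3 * K * r i" "fst (z i)"] r[OF i] K V0
          by (auto simp: Q'eq V'_def power_mult_distrib mult.assoc)
        have disj': "disjoint_family_on Q' I"
          using disj unfolding disjoint_family_on_def Q'_def by blast
        have "(LINT x|leb \<Omega>. norm (\<phi> (x, t)) powr 2) \<le> (\<Sum>i\<in>I. B powr 2 * measure lborel (Q' i))"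
          unfolding \<phi>_def cluster_def
        proof (rule disjoint_sum_Lp_le[OF I disj' _ _ _ _ _ bor(1)])
          fix i x assume i: "i \<in> I"
          show "tbump (snd (?s i (x, t))) * div_field h (fst (?s i (x, t))) = 0" if "x \<notin> Q' i"
            using out[OF i, of "(x, t)"] that ds tbump_eq_0 by (auto simp: Q'_def)
          have "\<bar>tbump (snd (?s i (x, t)))\<bar> * \<bar>div_field h (fst (?s i (x, t)))\<bar> \<le> 1 * B"
            using Bs(1) by (intro mult_mono) (auto simp: tbump_nonneg tbump_le_1)
          then show "norm (tbump (snd (?s i (x, t))) * div_field h (fst (?s i (x, t)))) \<le> B"
            by (simp add: abs_mult)
        qed (auto simp: Q'eq)
        also have "\<dots> \<le> (\<Sum>i\<in>I. B powr 2 * (V' * r i ^ DIM('a)))"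
          by (intro sum_mono mult_left_mono mQ') auto
        also have "\<dots> = B powr 2 * V' * S" by (simp add: S_def sum_distrib_left mult.assoc)
        finally have "Lp_norm (leb \<Omega>) 2 (\<lambda>x. \<phi> (x, t)) \<le> (B powr 2 * V' * S) powr (1 / 2)"
          unfolding Lp_norm_def by (intro powr_mono2) (auto simp: integral_nonneg_AE)
        also have "\<dots> = (B powr 2 * V') powr (1 / 2) * S powr (1 / 2)" by (rule powr_mult) 
        finally show ?thesis .
      qed
      let ?f = "\<lambda>t. ereal (Lp_norm (leb \<Omega>) 2 (\<lambda>x. \<phi> (x, t)))"
      show ?thesis
      proof (cases "?f \<in> borel_measurable (leb {0<..<T})")
        case True
        then have "esssup (leb {0<..<T}) ?f \<le> ereal ((B powr 2 * V') powr (1 / 2) * S powr (1 / 2))"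
          by (rule esssup_I) (use L2 in auto)
        then show ?thesis unfolding WM_sup_norm_def by (rule real_of_ereal_le) simp
      next
        case False
        \<comment> \<open>For a non-measurable argument \<open>esssup\<close> is top, which
          \<open>real_of_ereal\<close> sends to 0.\<close>
        then show ?thesis unfolding WM_sup_norm_def by (simp add: esssup_non_measurable top_ereal_def)
      qed
    qed
    have le: "(B powr p * V) powr (1 / p) \<le> A" "((B * B) powr q * V) powr (1 / q) \<le> A" "(B powr 2 * V') powr (1 / 2) \<le> A"
      by (simp_all add: A_def)
    have "WM_norm p \<Omega> T \<phi> \<le> A * S powr (1 / p) + A * S powr (1 / q) + A * S powr (1 / 2)"
      unfolding WM_norm_eq
      using N1 N2 N3 mult_right_mono[OF le(1), of "S powr (1 / p)"] mult_right_mono[OF le(2), of "S powr (1 / q)"]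
        mult_right_mono[OF le(3), of "S powr (1 / 2)"] by simp
    then show ?thesis by (simp add: \<phi>_def S_def q(3) distrib_left)
  qed
  show ?thesis by (rule that[OF A0 main])
qed

section \<open>Measures on sets of small dimension\<close>

lemma powr_arbitrarily_small:
  fixes \<gamma> \<eta> \<delta>0 :: real
  assumes "0 < \<gamma>" "0 < \<eta>" "0 < \<delta>0"
  obtains \<delta> where "0 < \<delta>" "\<delta> \<le> \<delta>0" "\<delta> powr \<gamma> \<le> \<eta>"
proof (rule that[of "min \<delta>0 (\<eta> powr (1 / \<gamma>))"])
  have "min \<delta>0 (\<eta> powr (1 / \<gamma>)) powr \<gamma> \<le> (\<eta> powr (1 / \<gamma>)) powr \<gamma>"
    using assms by (intro powr_mono2) auto
  then show "min \<delta>0 (\<eta> powr (1 / \<gamma>)) powr \<gamma> \<le> \<eta>" using assms by (simp add: powr_powr)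
qed (use assms in auto)

text \<open>Takes the predecessor of the first scale below x. It replaces an arbitrary radius by one
  of the scales \<delta>/L^j at which the mass around bad points will be controlled, at the cost of
  a factor L.\<close>

lemma geometric_scale:
  fixes L \<delta> x :: real
  assumes L: "1 < L" and x: "0 < x" "x \<le> \<delta>"
  obtains j where "x \<le> \<delta> / L ^ j" "\<delta> / L ^ j \<le> L * x"
proof -
  have \<delta>: "0 < \<delta>" using x by simp
  have "\<exists>k. (1 / L) ^ k < x / \<delta>" using real_arch_pow_inv[of "x / \<delta>" "1 / L"] x \<delta> L by auto
  then have ex: "\<exists>k. \<delta> / L ^ k < x" using \<delta> by (simp add: power_one_over pos_less_divide_eq mult.commute)
  define k where "k = (LEAST k. \<delta> / L ^ k < x)"
  have k: "\<delta> / L ^ k < x" unfolding k_def by (rule LeastI_ex[OF ex])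
  then have "k \<noteq> 0" using x by (intro notI) simp
  then obtain j where j: "k = Suc j" using not0_implies_Suc by blast
  have "\<not> \<delta> / L ^ j < x" using not_less_Least[of j "\<lambda>k. \<delta> / L ^ k < x"] j by (simp add: k_def)
  moreover have "\<delta> / L ^ j \<le> L * x"
  proof -
    have "\<delta> / L ^ j = L * (\<delta> / L ^ k)" using L by (simp add: j)
    also have "\<dots> \<le> L * x" using k L by (intro mult_left_mono) auto
    finally show ?thesis .
  qed
  ultimately show ?thesis using that[of j] by simp
qed

text \<open>A compact subset of X - E is covered by finitely many null neighbourhoods and hence
  null; inner regularity carries this over to X - E.\<close>

lemma spt_null_outside:
  fixes X :: "'b::t2_space set"
  assumes rad: "finite_radon_measure_on X \<mu>" and X: "open X" and E: "compact E" "E \<subseteq> X" and spt: "spt \<mu> \<subseteq> E"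
  shows "emeasure \<mu> (X - E) = 0"
proof -
  have sets: "sets \<mu> = sets (restrict_space borel X)" and fin: "finite_measure \<mu>"
    and reg: "\<And>B. B \<in> sets \<mu> \<Longrightarrow> emeasure \<mu> B = (SUP K\<in>{K. K \<subseteq> B \<and> compact K}. emeasure \<mu> K)"
    using rad by (auto simp: finite_radon_measure_on_def)
  have sp: "space \<mu> = X" using sets_eq_imp_space_eq[OF sets] by (simp add: space_restrict_space)
  have m: "B \<inter> X \<in> sets \<mu>" if "B \<in> sets borel" for B using that X by (auto simp: sets sets_restrict_space)
  have "emeasure \<mu> K = 0" if K: "K \<subseteq> X - E" "compact K" for K
  proof -
    have "\<exists>U. open U \<and> z \<in> U \<and> emeasure \<mu> (U \<inter> X) = 0" if "z \<in> K" for z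
    proof -
      have "z \<in> X" "z \<notin> spt \<mu>" using that K(1) spt by auto
      then show ?thesis unfolding spt_def sp by auto
    qed
    then obtain U where U: "\<And>z. z \<in> K \<Longrightarrow> open (U z) \<and> z \<in> U z \<and> emeasure \<mu> (U z \<inter> X) = 0" by metis
    obtain K' where K': "K' \<subseteq> K" "finite K'" "K \<subseteq> (\<Union>z\<in>K'. U z)"
      using compactE_image[OF K(2), of K U] U by (metis UN_I subsetI)
    have "emeasure \<mu> K \<le> emeasure \<mu> (\<Union>z\<in>K'. U z \<inter> X)"
      using K(1) K' U by (intro emeasure_mono sets.finite_UN m borel_open) auto
    also have "\<dots> \<le> (\<Sum>z\<in>K'. emeasure \<mu> (U z \<inter> X))"
      using K' U by (intro emeasure_subadditive_finite) (auto intro!: m borel_open)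
    also have "\<dots> = 0" using K'(1) U by (intro sum.neutral) blast
    finally show ?thesis by simp
  qed
  then have "(SUP K\<in>{K. K \<subseteq> X - E \<and> compact K}. emeasure \<mu> K) = 0"
    by (intro antisym SUP_least) auto
  moreover have "X - E \<in> sets \<mu>" using m[OF borel_open[OF open_Compl[OF compact_imp_closed[OF E(1)]]]] by (simp add: Diff_eq Int_commute)
  ultimately show ?thesis using reg by simp
qed

text \<open>
  At a point where no scale is simultaneously heavy and doubling, the density stays bounded, so
  such points are negligible; the remaining ones provide the cylinders of the covering.
\<close>

lemma good_cylinder_family:
  fixes \<mu> :: "('a::euclidean_space \<times> real) measure" and X :: "('a \<times> real) set"
  assumes \<mu>: "finite_measure \<mu>" "\<And>A. open A \<Longrightarrow> A \<inter> X \<in> sets \<mu>" "space \<mu> = X" and E: "compact E" "E \<subseteq> X"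
    and null: "emeasure \<mu> (X - E) = 0" and pos: "0 < measure \<mu> X"
    and H: "hausdorff_measure p s E = 0" and p: "1 \<le> p" and s: "0 \<le> s" and K: "1 < K" and \<delta>: "0 < \<delta>"
  defines "m \<equiv> \<lambda>A. measure \<mu> (A \<inter> X)" and "L \<equiv> 9 * K"
  obtains J r where "finite J" "J \<subseteq> E" "\<And>a. a \<in> J \<Longrightarrow> 0 < r a \<and> r a \<le> \<delta>"
    "disjoint_family_on (\<lambda>a. pcyl p a (3 * K * r a)) J"
    "\<And>a. a \<in> J \<Longrightarrow> r a powr s \<le> m (pcyl p a (r a))"
    "\<And>a. a \<in> J \<Longrightarrow> m (pcyl p a (L * r a)) \<le> L powr s * m (pcyl p a (r a))"
    "measure \<mu> X / 2 \<le> L powr s * (\<Sum>a\<in>J. m (pcyl p a (r a)))"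
proof -
  interpret finite_measure \<mu> by (rule \<mu>(1))
  have L: "1 < L" using K by (simp add: L_def)
  define M where "M = measure \<mu> X"
  have M: "0 < M" using pos by (simp add: M_def)
  have mM: "m A \<le> M" for A
    unfolding m_def M_def using \<mu>(2)[of UNIV] by (intro finite_measure_mono) auto
  have mono: "m A \<le> m B" if "A \<subseteq> B" "open B" for A B
    unfolding m_def using that \<mu>(2) by (intro finite_measure_mono) auto
  have sub: "m (\<Union>a\<in>I. A a) \<le> (\<Sum>a\<in>I. m (A a))" if "finite I" "\<And>a. a \<in> I \<Longrightarrow> open (A a)" for I :: "('a \<times> real) set" and A
  proof -
    have "(\<Union>a\<in>I. A a) \<inter> X = (\<Union>a\<in>I. A a \<inter> X)" by blast
    then show ?thesis unfolding m_def using that \<mu>(2)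
      by (simp only:) (intro finite_measure_subadditive_finite, auto)
  qed
  define good where "good a r \<longleftrightarrow> 0 < r \<and> r \<le> \<delta> \<and> r powr s \<le> m (pcyl p a r) \<and> m (pcyl p a (L * r)) \<le> L powr s * m (pcyl p a r)" for a r
  define Bad where "Bad = {a \<in> E. \<forall>r. \<not> good a r}"
  \<comment> \<open>The maximum serves both needs of the induction below: 1 for a scale that is not
    heavy, M/\<delta>^s for the largest scale.\<close>
  define Mb where "Mb = max 1 (M / \<delta> powr s)"
  have Mb: "1 \<le> Mb" "M / \<delta> powr s \<le> Mb" by (auto simp: Mb_def)
  \<comment> \<open>Induction from large to small scales: a scale that is not heavy has density
    below 1, and at one that fails to be doubling the density is below that of the next larger
    scale.\<close>
  have bad: "m (pcyl p a (\<delta> / L ^ j)) \<le> Mb * (\<delta> / L ^ j) powr s" if a: "a \<in> Bad" for a j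
  proof (induction j)
    case 0
    have "M \<le> Mb * \<delta> powr s" using Mb(2) \<delta> by (simp add: pos_divide_le_eq)
    then show ?case using mM[of "pcyl p a \<delta>"] by simp
  next
    case (Suc j)
    define r where "r = \<delta> / L ^ Suc j"
    have r: "0 < r" "L * r = \<delta> / L ^ j" using \<delta> L by (simp_all add: r_def)
    have "r \<le> \<delta>" unfolding r_def using \<delta> L one_le_power[of L "Suc j"] by (simp add: pos_divide_le_eq mult_left_le_one_le)
    then have "m (pcyl p a r) < r powr s \<or> L powr s * m (pcyl p a r) < m (pcyl p a (L * r))"
      using a r(1) by (auto simp: Bad_def good_def not_le)
    then show ?case
    proof
      assume "m (pcyl p a r) < r powr s"
      also have "\<dots> \<le> Mb * r powr s" using mult_right_mono[OF Mb(1), of "r powr s"] by simp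
      finally show ?thesis by (simp add: r_def)
    next
      assume "L powr s * m (pcyl p a r) < m (pcyl p a (L * r))"
      also have "\<dots> \<le> Mb * (L * r) powr s" using Suc.IH by (simp add: r(2))
      also have "\<dots> = L powr s * (Mb * r powr s)" using L r(1) by (simp add: powr_mult)
      finally have "m (pcyl p a r) < Mb * r powr s" using L by simp
      then show ?thesis by (simp add: r_def)
    qed
  qed
  \<comment> \<open>Calibrated so that the cover of the bad points constructed next has measure at
    most M/2.\<close>
  define \<eta> where "\<eta> = M / (2 * (Mb * (3 * L) powr s))"
  have "0 < Mb * (3 * L) powr s" using Mb(1) L by (intro mult_pos_pos) auto
  then have \<eta>: "0 < \<eta>" "Mb * (3 * L) powr s * \<eta> = M / 2"
    using M unfolding \<eta>_def by (auto intro!: divide_pos_pos mult_pos_pos)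
  obtain z \<rho> where z\<rho>: "E \<subseteq> (\<Union>i::nat. pcyl p (z i) (\<rho> i))" "\<And>i. 0 < \<rho> i \<and> \<rho> i < \<delta> / 3"
    "(\<Sum>i. ennreal (\<rho> i powr s)) < ennreal \<eta>"
  proof (rule hausdorff_measure_zero_cover[OF H, of "\<delta> / 3" \<eta>])
    show "0 < \<delta> / 3" using \<delta> by simp
  qed (rule \<eta>(1), rule that)
  \<comment> \<open>Only cylinders that meet \<open>Bad\<close> are kept, since the density bound is
    available around bad points alone; each lies in a cylinder of radius 3 \<rho> around such a
    point. Their open union then stands in for \<open>Bad\<close>, whose measurability never comes
    up, and leaves E - W compact.\<close>
  define V where "V i = (if pcyl p (z i) (\<rho> i) \<inter> Bad = {} then {} else pcyl p (z i) (\<rho> i))" for i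
  have oV: "open (V i)" for i by (simp add: V_def open_pcyl)
  define W where "W = (\<Union>i. V i)"
  have oW: "open W" unfolding W_def using oV by blast
  have BadW: "Bad \<subseteq> W"
  proof
    fix a assume a: "a \<in> Bad"
    then obtain i where "a \<in> pcyl p (z i) (\<rho> i)" using z\<rho>(1) by (auto simp: Bad_def)
    then have "a \<in> V i" using a by (auto simp: V_def)
    then show "a \<in> W" by (auto simp: W_def)
  qed
  have Vb: "m (V i) \<le> Mb * (3 * L) powr s * \<rho> i powr s" for i
  proof (cases "pcyl p (z i) (\<rho> i) \<inter> Bad = {}")
    case True
    then show ?thesis using Mb(1) by (simp add: V_def m_def)
  next
    case False
    then obtain a where a: "a \<in> pcyl p (z i) (\<rho> i)" "a \<in> Bad" by blast
    have \<rho>: "0 < \<rho> i" "3 * \<rho> i \<le> \<delta>" using z\<rho>(2)[of i] by auto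
    obtain j where j: "3 * \<rho> i \<le> \<delta> / L ^ j" "\<delta> / L ^ j \<le> L * (3 * \<rho> i)"
      using geometric_scale[OF L _ \<rho>(2)] \<rho>(1) by auto
    have "pcyl p (z i) (\<rho> i) \<subseteq> pcyl p a (3 * \<rho> i)"
      using a(1) center_in_pcyl[OF \<rho>(1), of a p] by (intro pcyl_engulf[OF p \<rho>(1)]) auto
    also have "\<dots> \<subseteq> pcyl p a (\<delta> / L ^ j)" using p \<rho> j by (intro pcyl_mono) auto
    finally have "m (V i) \<le> m (pcyl p a (\<delta> / L ^ j))" by (intro mono) (auto simp: V_def open_pcyl)
    also have "\<dots> \<le> Mb * (\<delta> / L ^ j) powr s" by (rule bad[OF a(2)])
    also have "\<dots> \<le> Mb * (L * (3 * \<rho> i)) powr s"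
      using j \<rho> s Mb(1) by (intro mult_left_mono powr_mono2) auto
    also have "\<dots> = Mb * (3 * L) powr s * \<rho> i powr s" using L \<rho> by (simp add: powr_mult mult_ac)
    finally show ?thesis .
  qed
  have W2: "m W \<le> M / 2"
  proof -
    have "emeasure \<mu> (W \<inter> X) = emeasure \<mu> (\<Union>i. V i \<inter> X)" by (simp add: W_def)
    also have "\<dots> \<le> (\<Sum>i. emeasure \<mu> (V i \<inter> X))"
      using \<mu>(2) oV by (intro emeasure_subadditive_countably) auto
    also have "\<dots> \<le> (\<Sum>i. ennreal (Mb * (3 * L) powr s) * ennreal (\<rho> i powr s))"
    proof (intro suminf_le summableI)
      show "emeasure \<mu> (V i \<inter> X) \<le> ennreal (Mb * (3 * L) powr s) * ennreal (\<rho> i powr s)" for i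
        using Vb[of i] Mb(1) by (simp add: emeasure_eq_measure m_def ennreal_mult[symmetric] ennreal_leI)
    qed
    also have "\<dots> = ennreal (Mb * (3 * L) powr s) * (\<Sum>i. ennreal (\<rho> i powr s))" by (rule ennreal_suminf_cmult)
    also have "\<dots> \<le> ennreal (Mb * (3 * L) powr s) * ennreal \<eta>" using z\<rho>(3) by (intro mult_left_mono) auto
    also have "\<dots> = ennreal (M / 2)" 
      using Mb(1) \<eta>(1) by (subst ennreal_mult[symmetric]) (auto simp only: \<eta>(2) intro!: mult_nonneg_nonneg powr_ge_zero)
    finally show ?thesis using M by (simp add: emeasure_eq_measure m_def)
  qed
  have cEW: "compact (E - W)" using E(1) oW by (rule compact_diff)
  have "\<exists>r. good a r" if "a \<in> E - W" for a using that BadW by (auto simp: Bad_def)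
  then obtain r where r: "\<And>a. a \<in> E - W \<Longrightarrow> good a (r a)" by metis
  have rpos: "0 < r a" if "a \<in> E - W" for a using r[OF that] by (simp add: good_def)
  obtain G where G: "G \<subseteq> E - W" "finite G" "E - W \<subseteq> (\<Union>a\<in>G. pcyl p a (r a))"
  proof (rule compactE_image[OF cEW, of "E - W" "\<lambda>a. pcyl p a (r a)"])
    show "E - W \<subseteq> (\<Union>a\<in>E - W. pcyl p a (r a))" using center_in_pcyl[OF rpos] by blast
  qed (rule open_pcyl, rule that)
  \<comment> \<open>The selection is made for the 3 K-fold cylinders, where the profiles live. Their
    threefold enlargements have the factor 9 K = L, the one for which doubling is known.\<close>
  obtain J where J: "J \<subseteq> G" "disjoint_family_on (\<lambda>a. pcyl p a (3 * K * r a)) J"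
    "\<And>a. a \<in> G \<Longrightarrow> 0 < 3 * K * r a \<Longrightarrow> \<exists>b\<in>J. 3 * K * r a \<le> 3 * K * r b \<and> pcyl p a (3 * K * r a) \<inter> pcyl p b (3 * K * r b) \<noteq> {}"
    using Vitali_pcyl[OF G(2), of p "\<lambda>a. a" "\<lambda>a. 3 * K * r a"] by blast
  have fJ: "finite J" using J(1) G(2) finite_subset by blast
  have JE: "J \<subseteq> E - W" using J(1) G(1) by blast
  have cover: "E - W \<subseteq> (\<Union>b\<in>J. pcyl p b (L * r b))"
  proof
    fix w assume "w \<in> E - W"
    then obtain a where a: "a \<in> G" "w \<in> pcyl p a (r a)" using G(3) by auto
    have ra: "0 < r a" using rpos a(1) G(1) by blast
    have 3: "0 < 3 * K * r a" using ra K by simp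
    obtain b where b: "b \<in> J" "3 * K * r a \<le> 3 * K * r b" "pcyl p a (3 * K * r a) \<inter> pcyl p b (3 * K * r b) \<noteq> {}"
      using J(3)[OF a(1) 3] by blast
    have "r a \<le> 3 * K * r a" using ra K by simp
    then have "pcyl p a (r a) \<subseteq> pcyl p a (3 * K * r a)" using p ra by (intro pcyl_mono) auto
    also have "\<dots> \<subseteq> pcyl p b (3 * (3 * K * r b))" by (rule pcyl_engulf[OF p 3 b(2,3)])
    finally have "w \<in> pcyl p b (L * r b)" using a(2) by (auto simp: L_def mult.assoc)
    then show "w \<in> (\<Union>b\<in>J. pcyl p b (L * r b))" using b(1) by blast
  qed
  have doub: "m (pcyl p a (L * r a)) \<le> L powr s * m (pcyl p a (r a))" if "a \<in> J" for a
    using r[of a] that JE by (auto simp: good_def)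
  \<comment> \<open>Outside E there is no mass, so the bad cover and the enlarged selected cylinders
    together carry everything; W takes at most half, which leaves half for the selected
    ones.\<close>
  have "M \<le> m (W \<union> (\<Union>b\<in>J. pcyl p b (L * r b)))"
  proof -
    let ?A = "(W \<union> (\<Union>b\<in>J. pcyl p b (L * r b))) \<inter> X"
    have oA: "?A \<in> sets \<mu>" using oW by (intro \<mu>(2) open_Un open_UN) (auto simp: open_pcyl)
    have XE: "X - E \<in> sets \<mu>" using \<mu>(2)[of "- E"] E(1) by (simp add: Diff_eq Int_commute open_Compl compact_imp_closed)
    have "M \<le> measure \<mu> (?A \<union> (X - E))"
      unfolding M_def using cover oA XE by (intro finite_measure_mono sets.Un) auto
    also have "\<dots> \<le> measure \<mu> ?A + measure \<mu> (X - E)" using oA XE by (rule measure_Un_le)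
    also have "measure \<mu> (X - E) = 0" using null by (simp add: measure_def)
    finally show ?thesis by (simp add: m_def)
  qed
  also have "\<dots> \<le> m W + m (\<Union>b\<in>J. pcyl p b (L * r b))"
  proof -
    have "(W \<union> (\<Union>b\<in>J. pcyl p b (L * r b))) \<inter> X = (W \<inter> X) \<union> ((\<Union>b\<in>J. pcyl p b (L * r b)) \<inter> X)" by blast
    then show ?thesis unfolding m_def
      by (simp only:) (intro measure_Un_le \<mu>(2) oW open_UN ballI open_pcyl)
  qed
  also have "m (\<Union>b\<in>J. pcyl p b (L * r b)) \<le> (\<Sum>b\<in>J. m (pcyl p b (L * r b)))"
    by (rule sub[OF fJ open_pcyl])
  also have "\<dots> \<le> (\<Sum>b\<in>J. L powr s * m (pcyl p b (r b)))" by (intro sum_mono doub)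
  finally have "M / 2 \<le> L powr s * (\<Sum>b\<in>J. m (pcyl p b (r b)))" using W2 by (simp add: sum_distrib_left)
  then have half: "measure \<mu> X / 2 \<le> L powr s * (\<Sum>a\<in>J. m (pcyl p a (r a)))" by (simp add: M_def)
  have gJ: "0 < r a \<and> r a \<le> \<delta>" "r a powr s \<le> m (pcyl p a (r a))" if "a \<in> J" for a
    using r[of a] that JE by (auto simp: good_def)
  have "J \<subseteq> E" using JE by blast
  then show ?thesis by (rule that[OF fJ _ gJ(1) J(2) gJ(2) doub half])
qed

text \<open>Three zones around each centre: in the core cylinder the time cutoff is at least
  \<open>expinv (3 / 4)\<close> and the divergence at least c0; in the larger cylinder the product
  is at least -b because the cutoff is at most 1; beyond it the profile vanishes. Charging -b in the
  core as well only weakens the bound.\<close>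

lemma cluster_integral_lower_bound:
  fixes \<mu> :: "('a::euclidean_space \<times> real) measure" and X :: "('a \<times> real) set"
  assumes \<mu>: "finite_measure \<mu>" "sets \<mu> = sets (restrict_space borel X)" "open X" and p: "1 \<le> p" and K: "1 < K"
    and h: "smooth h" "\<And>x. 2 * K \<le> norm x \<Longrightarrow> h x = 0" "\<And>x. norm x < 1 \<Longrightarrow> c0 \<le> div_field h x"
      "\<And>x. - b \<le> div_field h x" and c0: "0 \<le> c0" and b: "0 \<le> b"
    and J: "finite J" and r: "\<And>a. a \<in> J \<Longrightarrow> 0 < r a" and \<phi>: "cluster p h (\<lambda>a. a) r J \<in> test_functions \<Omega>"
  shows "(\<Sum>a\<in>J. expinv (3 / 4) * c0 * measure \<mu> (pcyl p a (r a) \<inter> X) - b * measure \<mu> (pcyl p a (3 * K * r a) \<inter> X)) \<le>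
    (LINT w|\<mu>. cluster p h (\<lambda>a. a) r J w)"
proof -
  interpret finite_measure \<mu> by (rule \<mu>(1))
  have sp: "space \<mu> = X" using sets_eq_imp_space_eq[OF \<mu>(2)] by (simp add: space_restrict_space)
  let ?e = "expinv (3 / 4)"
  have e: "0 \<le> ?e" by (rule expinv_nonneg)
  have Q: "pcyl p a \<rho> \<inter> X \<in> sets \<mu>" for a \<rho>
    using \<mu>(3) open_pcyl[of p a \<rho>] by (auto simp: \<mu>(2) sets_restrict_space)
  have pt: "?e * c0 * indicator (pcyl p a (r a) \<inter> X) w - b * indicator (pcyl p a (3 * K * r a) \<inter> X) w \<le>
      tbump (snd (rescale p (r a) a w)) * div_field h (fst (rescale p (r a) a w))"
    if a: "a \<in> J" and w: "w \<in> X" for a w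
  proof -
    let ?y = "fst (rescale p (r a) a w)" and ?\<tau> = "snd (rescale p (r a) a w)"
    have ra: "0 < r a" by (rule r[OF a])
    have sub: "pcyl p a (r a) \<subseteq> pcyl p a (3 * K * r a)"
      using p ra K by (intro pcyl_mono) auto
    consider "w \<in> pcyl p a (r a)" | "w \<notin> pcyl p a (r a)" "w \<in> pcyl p a (3 * K * r a)" | "w \<notin> pcyl p a (3 * K * r a)"
      by blast
    then show ?thesis
    proof cases
      case 1
      then have "rescale p (r a) a w \<in> unit_cylinder" using rescale_in_unit_cylinder[OF ra] by blast
      then have u: "norm ?y < 1" "\<bar>?\<tau>\<bar> < 1" using unit_cylinder_bounds by blast+
      have "?e * c0 \<le> tbump ?\<tau> * div_field h ?y"
        using tbump_near[OF u(2)] h(3)[OF u(1)] c0 e by (intro mult_mono) (auto simp: tbump_nonneg)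
      then show ?thesis using 1 sub w b by (auto simp: indicator_def)
    next
      case 2
      have "- b \<le> tbump ?\<tau> * - b" using mult_right_mono[OF tbump_le_1 b, of ?\<tau>] by simp
      also have "\<dots> \<le> tbump ?\<tau> * div_field h ?y" using h(4) by (intro mult_left_mono tbump_nonneg)
      finally show ?thesis using 2 w by (simp add: indicator_def)
    next
      case 3
      then have "2 * K < norm ?y \<or> 2 < \<bar>?\<tau>\<bar>" by (rule rescale_outside[OF p K ra])
      then have "tbump ?\<tau> * div_field h ?y = 0"
      proof
        assume far: "2 * K < norm ?y"
        have "div_field h ?y = 0" by (rule div_field_support[OF h(1) _ far]) (rule h(2))
        then show ?thesis by simp
      qed (simp add: tbump_eq_0)
      then show ?thesis using 3 sub by (auto simp: indicator_def)
    qed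
  qed
  have \<phi>': "cluster p h (\<lambda>a. a) r J \<in> Cc_infinity (\<Omega> \<times> UNIV)" using \<phi> by (simp add: test_functions_def)
  obtain B where B: "\<And>w. \<bar>cluster p h (\<lambda>a. a) r J w\<bar> \<le> B" using Cc_infinity_bounded[OF \<phi>'] by blast
  have "cluster p h (\<lambda>a. a) r J \<in> borel_measurable \<mu>"
    unfolding measurable_cong_sets[OF \<mu>(2) refl] by (intro measurable_restrict_space1 Cc_infinity_borel[OF \<phi>'])
  then have i\<phi>: "integrable \<mu> (cluster p h (\<lambda>a. a) r J)"
    by (intro integrable_const_bound[where B = B]) (use B in auto)
  have ind: "integrable \<mu> (\<lambda>w. indicator (pcyl p a \<rho> \<inter> X) w :: real)" for a \<rho>
    using Q by (intro integrable_real_indicator) (auto simp: less_top[symmetric])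
  have ig: "integrable \<mu> (\<lambda>w. ?e * c0 * indicator (pcyl p a (r a) \<inter> X) w - b * indicator (pcyl p a (3 * K * r a) \<inter> X) w)" for a
    by (intro Bochner_Integration.integrable_diff integrable_mult_right ind)
  have "(\<Sum>a\<in>J. ?e * c0 * measure \<mu> (pcyl p a (r a) \<inter> X) - b * measure \<mu> (pcyl p a (3 * K * r a) \<inter> X)) =
      (\<Sum>a\<in>J. LINT w|\<mu>. ?e * c0 * indicator (pcyl p a (r a) \<inter> X) w - b * indicator (pcyl p a (3 * K * r a) \<inter> X) w)"
    using ind Q by (intro sum.cong refl) (simp add: Int_absorb2 sp)
  also have "\<dots> = (LINT w|\<mu>. (\<Sum>a\<in>J. ?e * c0 * indicator (pcyl p a (r a) \<inter> X) w - b * indicator (pcyl p a (3 * K * r a) \<inter> X) w))"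
    by (intro Bochner_Integration.integral_sum[symmetric] ig)
  also have "\<dots> \<le> (LINT w|\<mu>. cluster p h (\<lambda>a. a) r J w)"
  proof (rule integral_mono[OF _ i\<phi>])
    show "integrable \<mu> (\<lambda>w. \<Sum>a\<in>J. ?e * c0 * indicator (pcyl p a (r a) \<inter> X) w - b * indicator (pcyl p a (3 * K * r a) \<inter> X) w)"
      by (intro Bochner_Integration.integrable_sum ig)
    fix w assume "w \<in> space \<mu>"
    then show "(\<Sum>a\<in>J. ?e * c0 * indicator (pcyl p a (r a) \<inter> X) w - b * indicator (pcyl p a (3 * K * r a) \<inter> X) w) \<le> cluster p h (\<lambda>a. a) r J w"
      unfolding cluster_def using pt by (intro sum_mono) (auto simp: sp)
  qed
  finally show ?thesis .
qed

text \<open>The order of choices matters. First s < n is fixed by the dimension; K is taken so large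
  that the negative part of the profile, measured through doubling, costs at most half of the
  positive one; only then are h and the norm constant A, which depend on K, available; \<delta>
  comes last and makes the norm small, while the lower bound c1 for the integral does not depend on
  it.\<close>

theorem no_WM_dual_measure:
  fixes \<Omega> :: "'a::euclidean_space set"
  assumes \<Omega>: "open \<Omega>" "bounded \<Omega>" and p: "1 < p" and T: "0 < T"
    and E: "compact E" "E \<subseteq> \<Omega> \<times> {0<..<T}" and dim: "hausdorff_dim p E < ereal (real DIM('a))"
    and rad: "finite_radon_measure_on (\<Omega> \<times> {0<..<T}) \<mu>" and nz: "emeasure \<mu> (space \<mu>) \<noteq> 0"
    and dual: "in_WM_dual p \<Omega> T \<mu>" and spt: "spt \<mu> \<subseteq> E"
  shows False
proof -
  define X where "X = \<Omega> \<times> {0<..<T}"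
  define n where "n = real DIM('a)"
  have oX: "open X" unfolding X_def using \<Omega> by (intro open_Times) auto
  have \<mu>: "finite_measure \<mu>" "sets \<mu> = sets (restrict_space borel X)"
    using rad by (auto simp: finite_radon_measure_on_def X_def)
  have sp: "space \<mu> = X" using sets_eq_imp_space_eq[OF \<mu>(2)] by (simp add: space_restrict_space)
  interpret finite_measure \<mu> by (rule \<mu>(1))
  have Xm: "A \<inter> X \<in> sets \<mu>" if "open A" for A
    using that oX by (auto simp: \<mu>(2) sets_restrict_space)
  have EX: "E \<subseteq> X" using E(2) by (simp add: X_def)
  have null: "emeasure \<mu> (X - E) = 0"
    using spt_null_outside[OF rad[folded X_def] oX E(1) EX spt] .
  define M where "M = measure \<mu> X"
  have M: "0 < M" using nz by (simp add: M_def sp emeasure_eq_measure zero_less_measure_iff)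
  obtain s where s: "0 \<le> s" "hausdorff_measure p s E = 0" "s < n"
    using dim unfolding hausdorff_dim_def INF_less_iff n_def by auto
  obtain c0 C1 where c: "0 < c0" "0 < C1"
    and prof: "\<And>K. 1 < K \<Longrightarrow> \<exists>h :: 'a \<Rightarrow> real. smooth h \<and> (\<forall>x. 2 * K \<le> norm x \<longrightarrow> h x = 0) \<and>
      (\<forall>x. norm x < 1 \<longrightarrow> c0 \<le> div_field h x) \<and> (\<forall>x. - (C1 * K powr - real DIM('a)) \<le> div_field h x)"
    using profile_exists by blast
  define e0 where "e0 = expinv (3 / 4) * c0"
  have e0: "0 < e0" using c(1) by (simp add: e0_def expinv_pos_iff)
  \<comment> \<open>With \<kappa> = 1/K the left side is C1 9^s \<kappa>^(n-s), which tends to 0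
    with \<kappa> because s < n.\<close>
  obtain K where K: "1 < K" "C1 * K powr - n * (9 * K) powr s \<le> e0 / 2"
  proof -
    obtain \<kappa> where \<kappa>: "0 < \<kappa>" "\<kappa> \<le> 1 / 2" "\<kappa> powr (n - s) \<le> e0 / (2 * C1 * 9 powr s)"
      using powr_arbitrarily_small[of "n - s" "e0 / (2 * C1 * 9 powr s)" "1 / 2"] s e0 c by auto
    have "C1 * (1 / \<kappa>) powr - n * (9 * (1 / \<kappa>)) powr s = C1 * 9 powr s * \<kappa> powr (n - s)"
      using \<kappa>(1) by (simp add: powr_divide powr_minus powr_diff powr_mult field_simps)
    also have "\<dots> \<le> C1 * 9 powr s * (e0 / (2 * C1 * 9 powr s))" using c \<kappa>(3) by (intro mult_left_mono) auto
    also have "\<dots> = e0 / 2" using c by simp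
    finally show ?thesis using that[of "1 / \<kappa>"] \<kappa>(1,2) by (simp add: less_divide_eq)
  qed
  define b where "b = C1 * K powr - n"
  have b: "0 \<le> b" using c(2) by (simp add: b_def)
  define L where "L = 9 * K"
  have L: "1 < L" using K(1) by (simp add: L_def)
  obtain h :: "'a \<Rightarrow> real" where h: "smooth h" "\<And>x. 2 * K \<le> norm x \<Longrightarrow> h x = 0"
    "\<And>x. norm x < 1 \<Longrightarrow> c0 \<le> div_field h x" "\<And>x. - b \<le> div_field h x"
    using prof[OF K(1)] unfolding b_def n_def by blast
  obtain A where A: "0 \<le> A"
    "\<And>I (z :: 'a \<times> real \<Rightarrow> 'a \<times> real) r. finite I \<Longrightarrow> (\<And>i. i \<in> I \<Longrightarrow> 0 < r i) \<Longrightarrow>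
      (\<And>i. i \<in> I \<Longrightarrow> cball (fst (z i)) (2 * K * r i) \<subseteq> \<Omega>) \<Longrightarrow>
      disjoint_family_on (\<lambda>i. pcyl p (z i) (3 * K * r i)) I \<Longrightarrow>
      WM_norm p \<Omega> T (cluster p h z r I) \<le>
        A * ((\<Sum>i\<in>I. r i ^ DIM('a)) powr (1 / p) + (\<Sum>i\<in>I. r i ^ DIM('a)) powr (1 - 1 / p) + (\<Sum>i\<in>I. r i ^ DIM('a)) powr (1 / 2))"
    using cluster_norm_bound[OF \<Omega> p h(1,2) K(1), of T] by blast
  obtain C where C: "\<And>\<phi>. \<phi> \<in> test_functions \<Omega> \<Longrightarrow> \<bar>LINT z|\<mu>. \<phi> z\<bar> \<le> C * WM_norm p \<Omega> T \<phi>"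
    using dual by (auto simp: in_WM_dual_def)
  obtain r0 where r0: "0 < r0" "\<And>a r. a \<in> E \<Longrightarrow> r \<le> r0 \<Longrightarrow> cball (fst a) r \<subseteq> \<Omega>"
    using compact_cylinder_room[OF E \<Omega>(1), of p] p by (metis less_imp_le)
  \<comment> \<open>Half of the positive part survives the negative one, and the core cylinders
    carry at least M/(2 L^s).\<close>
  define c1 where "c1 = e0 / 2 * (M / 2 / L powr s)"
  have c1: "0 < c1" using e0 M L by (simp add: c1_def)
  define \<beta> where "\<beta> = min (1 / p) (min (1 - 1 / p) (1 / 2))"
  have \<beta>: "0 < \<beta>" "\<beta> \<le> 1 / p" "\<beta> \<le> 1 - 1 / p" "\<beta> \<le> 1 / 2" using p unfolding \<beta>_def by (simp, linarith+)
  define D where "D = \<bar>C\<bar> * A * 3"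
  have D: "0 \<le> D" using A(1) by (simp add: D_def)
  obtain S0 where S0: "0 < S0" "S0 \<le> 1" "S0 powr \<beta> \<le> c1 / (2 * (D + 1))"
    using powr_arbitrarily_small[OF \<beta>(1), of "c1 / (2 * (D + 1))" 1] c1 D by auto
  obtain \<delta> where \<delta>: "0 < \<delta>" "\<delta> \<le> r0 / (2 * K)" "\<delta> powr (n - s) \<le> S0 / M"
    using powr_arbitrarily_small[of "n - s" "S0 / M" "r0 / (2 * K)"] s S0(1) M r0(1) K(1) by auto
  let ?m = "\<lambda>B. measure \<mu> (B \<inter> X)"
  obtain J r where J: "finite J" "J \<subseteq> E" "\<And>a. a \<in> J \<Longrightarrow> 0 < r a \<and> r a \<le> \<delta>"
    "disjoint_family_on (\<lambda>a. pcyl p a (3 * K * r a)) J"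
    "\<And>a. a \<in> J \<Longrightarrow> r a powr s \<le> ?m (pcyl p a (r a))"
    "\<And>a. a \<in> J \<Longrightarrow> ?m (pcyl p a (L * r a)) \<le> L powr s * ?m (pcyl p a (r a))"
    "M / 2 \<le> L powr s * (\<Sum>a\<in>J. ?m (pcyl p a (r a)))"
  proof (rule good_cylinder_family[OF \<mu>(1) Xm sp E(1) EX null M[unfolded M_def] s(2) less_imp_le[OF p] s(1) K(1) \<delta>(1)])
  qed (auto simp: M_def L_def intro: that)
  have rJ: "0 < r a" if "a \<in> J" for a using J(3) that by blast
  have dom: "cball (fst a) (2 * K * r a) \<subseteq> \<Omega>" if "a \<in> J" for a
  proof (rule r0(2))
    show "a \<in> E" using that J(2) by blast
    have "2 * K * r a \<le> 2 * K * \<delta>" using J(3)[OF that] K(1) by (intro mult_left_mono) auto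
    also have "\<dots> \<le> r0" using \<delta>(2) K(1) by (simp add: pos_le_divide_eq mult.commute)
    finally show "2 * K * r a \<le> r0" .
  qed
  define \<phi> where "\<phi> = cluster p h (\<lambda>a. a) r J"
  have \<phi>: "\<phi> \<in> test_functions \<Omega>" unfolding \<phi>_def
    by (rule cluster_test_function[OF less_imp_le[OF p] h(1) _ K(1) J(1) rJ dom]) (use h(2) in auto)
  define S where "S = (\<Sum>a\<in>J. r a ^ DIM('a))"
  have S0': "0 \<le> S" unfolding S_def by (intro sum_nonneg zero_le_power less_imp_le rJ)
  have sumM: "(\<Sum>a\<in>J. ?m (pcyl p a (r a))) \<le> M"
  proof -
    have sub: "pcyl p a (r a) \<subseteq> pcyl p a (3 * K * r a)" if "a \<in> J" for a
      using p rJ[OF that] K(1) by (intro pcyl_mono) auto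
    have "disjoint_family_on (\<lambda>a. pcyl p a (r a) \<inter> X) J"
      using J(4) sub unfolding disjoint_family_on_def by blast
    then have "(\<Sum>a\<in>J. ?m (pcyl p a (r a))) = measure \<mu> (\<Union>a\<in>J. pcyl p a (r a) \<inter> X)"
      using J(1) Xm[OF open_pcyl] by (intro finite_measure_finite_Union[symmetric]) blast+
    also have "\<dots> \<le> M" unfolding M_def using Xm[of UNIV] by (intro finite_measure_mono) auto
    finally show ?thesis .
  qed
  \<comment> \<open>Heaviness bounds r^n by \<delta>^(n-s) times the mass of the cylinder, and
    disjoint cylinders have total mass at most M; so S is small with \<delta>.\<close>
  have "S \<le> (\<Sum>a\<in>J. \<delta> powr (n - s) * ?m (pcyl p a (r a)))"
    unfolding S_def
  proof (rule sum_mono)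
    fix a assume a: "a \<in> J"
    have "r a ^ DIM('a) = r a powr (n - s) * r a powr s"
      using rJ[OF a] by (simp add: powr_add[symmetric] n_def powr_realpow)
    also have "\<dots> \<le> \<delta> powr (n - s) * ?m (pcyl p a (r a))"
      using J(3,5)[OF a] s(3) by (intro mult_mono powr_mono2) auto
    finally show "r a ^ DIM('a) \<le> \<delta> powr (n - s) * ?m (pcyl p a (r a))" .
  qed
  also have "\<dots> \<le> \<delta> powr (n - s) * M" unfolding sum_distrib_left[symmetric] by (intro mult_left_mono sumM) auto
  also have "\<dots> \<le> S0 / M * M" using \<delta>(3) M by (intro mult_right_mono) auto
  finally have SS: "S \<le> S0" using M by simp
  have Sp: "S powr \<gamma> \<le> S0 powr \<beta>" if "\<beta> \<le> \<gamma>" for \<gamma>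
  proof -
    have "S powr \<gamma> \<le> S0 powr \<gamma>" using SS S0' that \<beta>(1) by (intro powr_mono2) auto
    also have "\<dots> \<le> S0 powr \<beta>" using S0 that by (intro powr_mono') auto
    finally show ?thesis .
  qed
  have WM0: "0 \<le> WM_norm p \<Omega> T \<phi>"
    using WM_time_norm_nonneg[of p \<Omega> T \<phi>] WM_gradient_norm_nonneg[of p \<Omega> T \<phi>] WM_sup_norm_nonneg[OF T, of \<Omega> \<phi>]
    by (simp add: WM_norm_eq)
  have "WM_norm p \<Omega> T \<phi> \<le> A * (S powr (1 / p) + S powr (1 - 1 / p) + S powr (1 / 2))"
    unfolding \<phi>_def S_def by (rule A(2)[OF J(1) rJ dom J(4)])
  also have "\<dots> \<le> A * (3 * S0 powr \<beta>)"
    using Sp[OF \<beta>(2)] Sp[OF \<beta>(3)] Sp[OF \<beta>(4)] by (intro mult_left_mono A(1)) linarith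
  finally have WM1: "\<bar>C\<bar> * WM_norm p \<Omega> T \<phi> \<le> \<bar>C\<bar> * (A * (3 * S0 powr \<beta>))" by (rule mult_left_mono) simp
  have "(LINT w|\<mu>. \<phi> w) \<le> C * WM_norm p \<Omega> T \<phi>" using C[OF \<phi>] by linarith
  also have "\<dots> \<le> \<bar>C\<bar> * WM_norm p \<Omega> T \<phi>" using WM0 by (intro mult_right_mono) auto
  also note WM1
  finally have up: "(LINT w|\<mu>. \<phi> w) \<le> D * S0 powr \<beta>" by (simp add: D_def mult_ac)
  have "D * S0 powr \<beta> \<le> D * (c1 / (2 * (D + 1)))" using S0(3) D by (intro mult_left_mono) auto
  also have "\<dots> < c1" using c1 D by (simp add: field_simps add_nonneg_pos)
  finally have small: "D * S0 powr \<beta> < c1" .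
  have "c1 \<le> e0 / 2 * (\<Sum>a\<in>J. ?m (pcyl p a (r a)))"
    unfolding c1_def using J(7) L e0 by (intro mult_left_mono) (auto simp: pos_divide_le_eq mult.commute)
  also have "\<dots> \<le> (\<Sum>a\<in>J. e0 * ?m (pcyl p a (r a)) - b * ?m (pcyl p a (3 * K * r a)))"
    unfolding sum_distrib_left
  proof (rule sum_mono)
    fix a assume a: "a \<in> J"
    have "pcyl p a (3 * K * r a) \<subseteq> pcyl p a (L * r a)"
      using p rJ[OF a] K(1) by (intro pcyl_mono) (auto simp: L_def)
    then have "?m (pcyl p a (3 * K * r a)) \<le> ?m (pcyl p a (L * r a))"
      using Xm[OF open_pcyl] by (intro finite_measure_mono) blast+
    also have "\<dots> \<le> L powr s * ?m (pcyl p a (r a))" by (rule J(6)[OF a])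
    finally have "b * ?m (pcyl p a (3 * K * r a)) \<le> b * (L powr s * ?m (pcyl p a (r a)))"
      using b by (rule mult_left_mono)
    also have "\<dots> = (C1 * K powr - n * (9 * K) powr s) * ?m (pcyl p a (r a))" by (simp add: b_def L_def mult.assoc)
    also have "\<dots> \<le> e0 / 2 * ?m (pcyl p a (r a))" by (intro mult_right_mono K(2)) simp
    finally show "e0 / 2 * ?m (pcyl p a (r a)) \<le> e0 * ?m (pcyl p a (r a)) - b * ?m (pcyl p a (3 * K * r a))"
      by simp
  qed
  also have "\<dots> \<le> (LINT w|\<mu>. \<phi> w)"
    unfolding e0_def \<phi>_def
    by (rule cluster_integral_lower_bound[OF \<mu> oX less_imp_le[OF p] K(1) h less_imp_le[OF c(1)] b J(1) rJ \<phi>[unfolded \<phi>_def]])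
  finally show False using up small by simp
qed

theorem proposition1p4:
  fixes p T :: real
    and \<Omega> :: "(real ^ 'n) set"
    and E :: "((real ^ 'n) \<times> real) set"
  assumes "1 < p"
    and "bounded_lipschitz_domain \<Omega>"
    and "0 < T"
    and "compact E"
    and "E \<subseteq> \<Omega> \<times> {0<..<T}"
  shows "(hausdorff_dim p E < ereal (real CARD('n)) \<longrightarrow>
            \<not> (\<exists>\<mu>. finite_radon_measure_on (\<Omega> \<times> {0<..<T}) \<mu> \<and> emeasure \<mu> (space \<mu>) \<noteq> 0 \<and>
                   in_WM_dual p \<Omega> T \<mu> \<and> spt \<mu> \<subseteq> E)) \<and>
         (ereal (real CARD('n)) < hausdorff_dim p E \<longrightarrow>
            (\<exists>\<mu>. finite_radon_measure_on (\<Omega> \<times> {0<..<T}) \<mu> \<and> emeasure \<mu> (space \<mu>) \<noteq> 0 \<and>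
                 in_WM_dual p \<Omega> T \<mu> \<and> spt \<mu> \<subseteq> E))"
proof (intro conjI impI notI)
  have \<Omega>: "open \<Omega>" "bounded \<Omega>" using assms(2) by (auto simp: bounded_lipschitz_domain_def)
  have dim: "DIM(real ^ 'n) = CARD('n)" by simp
  show False
    if "hausdorff_dim p E < ereal (real CARD('n))"
      and \<mu>: "\<exists>\<mu>. finite_radon_measure_on (\<Omega> \<times> {0<..<T}) \<mu> \<and> emeasure \<mu> (space \<mu>) \<noteq> 0 \<and>
        in_WM_dual p \<Omega> T \<mu> \<and> spt \<mu> \<subseteq> E"
    using \<mu> no_WM_dual_measure[OF \<Omega> assms(1,3-5)] that(1) dim by auto
  show "\<exists>\<mu>. finite_radon_measure_on (\<Omega> \<times> {0<..<T}) \<mu> \<and> emeasure \<mu> (space \<mu>) \<noteq> 0 \<and>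
      in_WM_dual p \<Omega> T \<mu> \<and> spt \<mu> \<subseteq> E"
    if "ereal (real CARD('n)) < hausdorff_dim p E"
    by (rule exists_WM_dual_measure[OF \<Omega> assms(1,3-5)]) (use that in simp)
qed

end
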